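(* Let $t \in \{2,3,4,5\}$ and let $L$ and $L'$ be extremal even unimodular lattices of rank $24t$. Then: (i) If $t \in \{2,3,4\}$ (ranks $48$, $72$, $96$), then $\Theta_L^{(2)} = \Theta_{L'}^{(2)}$. (ii) If $t = 5$ (rank $120$), then there is an integer $c(L,L') \in \mathbb{Z}$ such that $$\Theta_L^{(2)} - \Theta_{L'}^{(2)} = c(L,L')\,\chi_{10}^6 .$$
   Context: An even unimodular lattice $L$ of rank $n$ is a positive definite integral lattice of rank $n$ that is self-dual and satisfies $(x,x)\in 2\mathbb{Z}$ for all $x \in L$. Write $\min(L)$ for the minimum of $(x,x)$ over nonzero $x\in L$. One has $\min(L) \le 2\lfloor n/24\rfloor + 2$, and $L$ is called extremal if equality holds; thus for rank $24t$, extremal means $\min(L) = 2t+2$. Let $\mathbb{H}_2$ be the Siegel upper half-space of degree $2$ (complex symmetric $2\times 2$ matrices with positive definite imaginary part). The degree-$2$ Siegel theta series of $L$ is $$\Theta_L^{(2)}(Z) = \sum_{(x_1,x_2)\in L^2} \exp\bigl(\pi i\,\mathrm{tr}(((x_i,x_j))_{i,j}\,Z)\bigr), \qquad Z \in \mathbb{H}_2,$$ a scalar-valued Siegel modular form of degree $2$ and weight $n/2$ on $\mathrm{Sp}_4(\mathbb{Z})$. A degree-$2$ Siegel modular form $F$ on $\mathrm{Sp}_4(\mathbb{Z})$ has Fourier expansion $F(Z) = \sum_{T\ge 0} a(F;T) e^{2\pi i\,\mathrm{tr}(TZ)}$, with $T$ ranging over positive semidefinite half-integral symmetric $2\times 2$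 matrices (integer diagonal entries, off-diagonal entries in $\frac12\mathbb{Z}$). $\chi_{10}$ is Igusa's cusp form of weight $10$ on $\mathrm{Sp}_4(\mathbb{Z})$ (the generator of the one-dimensional space of degree-$2$ Siegel cusp forms of weight $10$), in the standard integral normalization: it has integer Fourier coefficients and $a\bigl(\chi_{10}; \begin{pmatrix}1&1/2\\1/2&1\end{pmatrix}\bigr) = 1$. *)

theory Defs
  imports "HOL-Analysis.Analysis"
begin

section \<open>Even unimodular lattices\<close>

text \<open>Positive definite lattices are realised inside a real inner product space. The ambient
  space may be larger than the real span of the lattice.\<close>

definition lattice_of_rank :: "nat \<Rightarrow> 'a::real_inner set \<Rightarrow> bool" where
  "lattice_of_rank n L \<longleftrightarrow>
     (\<exists>B. finite B \<and> card B = n \<and> independent B \<and>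
          L = {(\<Sum>b\<in>B. of_int (c b) *\<^sub>R b) | c :: 'a \<Rightarrow> int. True})"

definition dual_lattice :: "'a::real_inner set \<Rightarrow> 'a set" where
  "dual_lattice L = {y \<in> span L. \<forall>x\<in>L. x \<bullet> y \<in> \<int>}"

definition even_unimodular :: "nat \<Rightarrow> 'a::real_inner set \<Rightarrow> bool" where
  "even_unimodular n L \<longleftrightarrow>
     lattice_of_rank n L \<and>
     (\<forall>x\<in>L. \<forall>y\<in>L. x \<bullet> y \<in> \<int>) \<and>
     dual_lattice L = L \<and>
     (\<forall>x\<in>L. \<exists>k::int. x \<bullet> x = 2 * of_int k)"

definition lattice_min :: "'a::real_inner set \<Rightarrow> real" where
  "lattice_min L = Inf ((\<lambda>x. x \<bullet> x) ` (L - {0}))"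

definition extremal :: "nat \<Rightarrow> 'a::real_inner set \<Rightarrow> bool" where
  "extremal n L \<longleftrightarrow> even_unimodular n L \<and> lattice_min L = real (2 * (n div 24) + 2)"

section \<open>Degree-2 Siegel theta series\<close>

definition siegel_H2 :: "(complex^2^2) set" where
  "siegel_H2 = {Z. transpose Z = Z \<and> (\<forall>v::real^2. v \<noteq> 0 \<longrightarrow> v \<bullet> (map_matrix Im Z *v v) > 0)}"

definition gram2 :: "'a::real_inner \<Rightarrow> 'a \<Rightarrow> real^2^2" where
  "gram2 x y = vector [vector [x \<bullet> x, x \<bullet> y], vector [y \<bullet> x, y \<bullet> y]]"

definition siegel_theta :: "'a::real_inner set \<Rightarrow> complex^2^2 \<Rightarrow> complex" where
  "siegel_theta L Z =
     (\<Sum>\<^sub>\<infinity>(x, y)\<in>L \<times> L. exp (of_real pi * \<i> * trace (map_matrix of_real (gram2 x y) ** Z)))"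

section \<open>Siegel modular forms of degree 2\<close>

text \<open>The upper half-space is an open subset of the symmetric matrices only, so differentiability
  is taken within it. The real derivative is then determined only on symmetric matrices; a
  complex linear choice of it on all matrices exists if and only if it is complex linear there.\<close>

definition holomorphic_H2 :: "(complex^2^2 \<Rightarrow> complex) \<Rightarrow> bool" where
  "holomorphic_H2 F \<longleftrightarrow>
     (\<forall>Z\<in>siegel_H2. \<exists>D. (F has_derivative D) (at Z within siegel_H2) \<and>
        (\<forall>c V. D (mat c ** V) = c * D V))"

text \<open>The block conditions say that the matrix with block rows \<open>(A, B)\<close> and \<open>(C, D)\<close> satisfies
  \<open>transpose M ** J ** M = J\<close> for the standard alternating matrix \<open>J\<close>.\<close>

definition in_Sp4Z :: "int^2^2 \<Rightarrow> int^2^2 \<Rightarrow> int^2^2 \<Rightarrow> int^2^2 \<Rightarrow> bool" where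
  "in_Sp4Z A B C D \<longleftrightarrow>
     transpose A ** C = transpose C ** A \<and>
     transpose B ** D = transpose D ** B \<and>
     transpose A ** D - transpose C ** B = mat 1"

definition siegel_modular_form :: "nat \<Rightarrow> (complex^2^2 \<Rightarrow> complex) \<Rightarrow> bool" where
  "siegel_modular_form k F \<longleftrightarrow>
     holomorphic_H2 F \<and>
     (\<forall>A B C D. in_Sp4Z A B C D \<longrightarrow>
        (\<forall>Z\<in>siegel_H2.
           F ((map_matrix of_int A ** Z + map_matrix of_int B) **
              matrix_inv (map_matrix of_int C ** Z + map_matrix of_int D))
           = det (map_matrix of_int C ** Z + map_matrix of_int D) ^ k * F Z))"

definition half_integral_psd :: "(real^2^2) set" where
  "half_integral_psd =
     {T. transpose T = T \<and> T$1$1 \<in> \<int> \<and> T$2$2 \<in> \<int> \<and> 2 * T$1$2 \<in> \<int> \<and>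
         (\<forall>v. v \<bullet> (T *v v) \<ge> 0)}"

definition fourier_expansion :: "(complex^2^2 \<Rightarrow> complex) \<Rightarrow> (real^2^2 \<Rightarrow> complex) \<Rightarrow> bool" where
  "fourier_expansion F a \<longleftrightarrow>
     (\<forall>Z\<in>siegel_H2.
        ((\<lambda>T. a T * exp (2 * of_real pi * \<i> * trace (map_matrix of_real T ** Z)))
          has_sum F Z) half_integral_psd)"

text \<open>The existence of a Fourier expansion is automatic for modular forms (Koecher); a cusp form is
  one whose expansion is supported on positive definite matrices.\<close>

definition siegel_cusp_form :: "nat \<Rightarrow> (complex^2^2 \<Rightarrow> complex) \<Rightarrow> bool" where
  "siegel_cusp_form k F \<longleftrightarrow>
     siegel_modular_form k F \<and>
     (\<exists>a. fourier_expansion F a \<and>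
        (\<forall>T\<in>half_integral_psd. a T \<noteq> 0 \<longrightarrow> (\<forall>v. v \<noteq> 0 \<longrightarrow> v \<bullet> (T *v v) > 0)))"

text \<open>Functions are total on matrices, so this determines the form only on the upper half-space.\<close>

definition is_igusa_chi10 :: "(complex^2^2 \<Rightarrow> complex) \<Rightarrow> bool" where
  "is_igusa_chi10 F \<longleftrightarrow>
     siegel_cusp_form 10 F \<and>
     (\<forall>G. siegel_cusp_form 10 G \<longrightarrow> (\<exists>c. \<forall>Z\<in>siegel_H2. G Z = c * F Z)) \<and>
     (\<exists>a. fourier_expansion F a \<and> (\<forall>T\<in>half_integral_psd. a T \<in> \<int>) \<and>
        a (vector [vector [1, 1/2], vector [1/2, 1]]) = 1)"

end

theory Submission
  imports Defs "HOL-Complex_Analysis.Complex_Analysis"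
begin

text \<open>Let \<open>D\<close> be the difference of the two theta series. Its Fourier coefficient at the binary form
\<open>[n, \<rho>, m]\<close> (the half-integral matrix with diagonal \<open>n, m\<close> and off-diagonal entry \<open>\<rho> / 2\<close>) is the
difference of the numbers of pairs of lattice vectors with \<open>(x, x) = 2n\<close>, \<open>(x, y) = \<rho>\<close>, \<open>(y, y) = 2m\<close>.
Extremality makes it vanish for \<open>1 \<le> m \<le> t\<close> and at the zero form. The proof shows that a family of
coefficients with this vanishing, with the symmetries of a modular form of weight \<open>12t\<close>, is zero if
\<open>t \<le> 4\<close>, and for \<open>t = 5\<close> is determined by its value at \<open>[6, 6, 6]\<close> (\<open>siegel_coeffs_vanish\<close>).

Only three symmetries enter: the exchange of \<open>n\<close> and \<open>m\<close>, the shear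
\<open>[n, \<rho>, m] \<mapsto> [n + \<rho> + m, \<rho> + 2m, m]\<close>, and the inversion \<open>\<tau> \<mapsto> - 1 / \<tau>\<close> in one diagonal variable.
Collect the coefficients with fixed \<open>m\<close> into the Fourier-Jacobi coefficient
\<open>\<phi>\<^sub>m(\<tau>, z) = (\<Sum>n \<rho>. A n \<rho> m * q ^ n * \<zeta> ^ \<rho>)\<close>, and let \<open>r\<close> be the least \<open>m\<close> for which it is not zero.
Exchanging \<open>n\<close> and \<open>m\<close> shows that \<open>\<phi>\<^sub>r\<close> is divisible by \<open>q ^ r\<close>. The lowest nonvanishing Taylor coefficient
of \<open>\<phi>\<^sub>r\<close> at \<open>z = 0\<close>, of degree \<open>\<nu>\<close> say, is a modular form for \<open>SL\<^sub>2(\<int>)\<close> of weight \<open>12t + \<nu>\<close> whose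
\<open>q\<close>-expansion starts at \<open>q ^ r\<close> or later (\<open>taylor_coeff_modular\<close>). Since a nonzero form of weight \<open>w\<close> vanishes at the
cusp to order at most \<open>w / 12\<close> (\<open>level_one_vanishing\<close>), \<open>\<nu> \<ge> 12 (r - t)\<close>. So for every \<open>n\<close> the moments
\<open>\<Sum>\<rho>. A n \<rho> r * \<rho> ^ \<nu>\<close> vanish for \<open>\<nu> < 12 (r - t)\<close>. On the other hand the shear
allows one to restrict, by induction on \<open>n\<close>, to \<open>\<bar>\<rho>\<bar> \<le> r\<close>; these are \<open>2r + 1\<close> unknowns, and a
Vandermonde argument gives a contradiction as soon as \<open>2r < 12 (r - t)\<close>, that is \<open>5r > 6t\<close>. The
index \<open>r = 0\<close> is impossible in the same way, as \<open>\<phi>\<^sub>0\<close> has weight \<open>12t\<close> and order greater than \<open>t\<close>. Because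
otherwise \<open>r > t\<close>, this excludes everything except \<open>t = 5\<close>, \<open>r = 6\<close>. There one moment is missing, and the
coefficient at \<open>[6, 6, 6]\<close> replaces it.

For \<open>t = 5\<close> this is applied to \<open>D\<close> minus \<open>c\<close> times the sixth power of \<open>\<chi>\<^sub>1\<^sub>0\<close>, where \<open>c\<close> is the coefficient
of \<open>D\<close> at \<open>[6, 6, 6]\<close>. The coefficients of \<open>\<chi>\<^sub>1\<^sub>0\<close> are supported on positive definite forms, so
those of the sixth power vanish for \<open>m < 6\<close>, and the only way to write \<open>[6, 6, 6]\<close> as a sum of six such forms
is six times \<open>[1, 1, 1]\<close>; hence that power has coefficient 1 at \<open>[6, 6, 6]\<close> (\<open>siegel_expansion_power\<close>).

Two analytic inputs are developed from Cauchy's theorem. The behaviour of a theta series under inversion is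
Poisson summation for Gaussians over a unimodular lattice (\<open>unimodular_poisson\<close>). It is
reduced to one variable by splitting off one basis vector at a time, and in one variable it follows from
the quasi-periodicity of the Gaussian sum as an entire function of its shift. The bound for the order at the
cusp is obtained by dividing by a power of the discriminant: the quotient has negative weight and
no poles, so it tends to zero at the boundary of the unit disc, and the maximum principle applies. The
modularity of the discriminant comes from Euler's pentagonal number theorem and one-dimensional Poisson summation.\<close>

section \<open>The exponential with period one\<close>

definition e2 :: "complex \<Rightarrow> complex" where
  "e2 z = exp (2 * of_real pi * \<i> * z)"

lemma e2_add: "e2 (x + y) = e2 x * e2 y"
  by (simp add: e2_def ring_distribs exp_add)

lemma e2_0 [simp]: "e2 0 = 1"
  by (simp add: e2_def)

lemma e2_of_int [simp]: "e2 (of_int n) = 1"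
  using exp_integer_2pi[of "of_int n"] by (simp add: e2_def mult_ac)

lemma e2_1 [simp]: "e2 1 = 1"
  using e2_of_int[of 1] by simp

lemma norm_e2: "norm (e2 z) = exp (- (2 * pi * Im z))"
  by (simp add: e2_def)

lemma e2_nonzero [simp]: "e2 z \<noteq> 0"
  by (simp add: e2_def)

lemma e2_power: "e2 z ^ n = e2 (of_nat n * z)"
  by (simp add: e2_def exp_of_nat_mult [symmetric] mult_ac)

lemma e2_holomorphic [holomorphic_intros]:
  "f holomorphic_on S \<Longrightarrow> (\<lambda>z. e2 (f z)) holomorphic_on S"
  unfolding e2_def by (intro holomorphic_intros)

lemma e2_continuous [continuous_intros]:
  "continuous_on S f \<Longrightarrow> continuous_on S (\<lambda>z. e2 (f z))"
  unfolding e2_def by (intro continuous_intros)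

lemma e2_has_derivative: "(e2 has_field_derivative 2 * of_real pi * \<i> * e2 z) (at z within S)"
  unfolding e2_def by (auto intro!: derivative_eq_intros simp: mult_ac)

lemma e2_eq_1_iff: "e2 z = 1 \<longleftrightarrow> z \<in> \<int>"
proof
  assume "e2 z = 1"
  then obtain n :: int where n: "2 * pi * Re z = of_int (2 * n) * pi" "Im z = 0"
    unfolding e2_def exp_eq_1 by auto
  hence "Re z = of_int n" by simp
  with n have "z = of_int n" by (simp add: complex_eq_iff)
  thus "z \<in> \<int>" by simp
qed (auto elim!: Ints_cases)

lemma norm_e2_less_1: "Im \<tau> > 0 \<Longrightarrow> norm (e2 \<tau>) < 1"
  by (simp add: norm_e2)

lemma e2_surj: "q \<noteq> 0 \<Longrightarrow> norm q < 1 \<Longrightarrow> \<exists>\<tau>. Im \<tau> > 0 \<and> e2 \<tau> = q"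
proof -
  assume q: "q \<noteq> 0" "norm q < 1"
  define \<tau> where "\<tau> = Ln q / (2 * of_real pi * \<i>)"
  have eq: "e2 \<tau> = q" unfolding e2_def \<tau>_def using q by simp
  have "exp (- (2 * pi * Im \<tau>)) < 1" using norm_e2[of \<tau>] eq q by simp
  hence "Im \<tau> > 0" by (simp add: zero_less_mult_iff)
  with eq show ?thesis by blast
qed

section \<open>Unordered sums and power series\<close>

lemma summable_on_norm_bound:
  fixes f :: "'i \<Rightarrow> complex"
  assumes "g summable_on A" and "\<And>x. x \<in> A \<Longrightarrow> norm (f x) \<le> g x"
  shows "(\<lambda>x. norm (f x)) summable_on A"
  using assms by (rule Infinite_Sum.abs_summable_on_comparison_test')

lemma summable_on_bound:
  fixes f :: "'i \<Rightarrow> complex"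
  assumes "g summable_on A" and "\<And>x. x \<in> A \<Longrightarrow> norm (f x) \<le> g x"
  shows "f summable_on A"
  using summable_on_norm_bound[OF assms] by (rule Infinite_Sum.abs_summable_summable)

lemma summable_on_times_bound:
  fixes f :: "'a \<times> 'b \<Rightarrow> complex"
  assumes M: "M summable_on A"
    and s: "\<And>x. x \<in> A \<Longrightarrow> (\<lambda>y. norm (f (x, y))) summable_on B"
    and le: "\<And>x. x \<in> A \<Longrightarrow> infsum (\<lambda>y. norm (f (x, y))) B \<le> M x"
  shows "f summable_on A \<times> B"
proof -
  have "(\<lambda>x. norm (f x)) summable_on (A \<times> B)"
    unfolding Infinite_Sum.abs_summable_on_Sigma_iff
  proof (intro conjI ballI s)
    show "(\<lambda>x. norm (infsum (\<lambda>y. norm (f (x, y))) B)) summable_on A"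
      using Infinite_Sum.abs_summable_on_comparison_test'[OF M, of "\<lambda>x. infsum (\<lambda>y. norm (f (x, y))) B"] le
      by (simp add: infsum_nonneg)
  qed
  thus ?thesis by (rule Infinite_Sum.abs_summable_summable)
qed

lemma infsum_complex_norm:
  fixes f :: "'a \<Rightarrow> complex"
  assumes "f summable_on A"
  shows "norm (infsum f A) \<le> infsum (\<lambda>x. norm (f x)) A"
  using assms by (intro norm_infsum_bound) (simp add: summable_on_iff_abs_summable_on_complex[symmetric])

lemma infsum_finite_sum:
  fixes f :: "'i \<Rightarrow> 'j \<Rightarrow> complex"
  assumes "finite A" "\<And>i. i \<in> A \<Longrightarrow> f i summable_on B"
  shows "infsum (\<lambda>j. \<Sum>i\<in>A. f i j) B = (\<Sum>i\<in>A. infsum (f i) B)"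
proof -
  have "((\<lambda>j. \<Sum>i\<in>A. f i j) has_sum (\<Sum>i\<in>A. infsum (f i) B)) B"
    using assms
  proof (induction A rule: finite_induct)
    case (insert i A)
    thus ?case by (simp add: has_sum_add)
  qed auto
  thus ?thesis by (rule infsumI)
qed

lemma infsum_residue_classes:
  fixes f :: "int \<Rightarrow> complex"
  assumes N: "N > 0" and f: "f summable_on UNIV"
  shows "infsum f UNIV = (\<Sum>i<N. infsum (\<lambda>j. f (int N * j + int i)) UNIV)"
proof -
  have bij: "bij_betw (\<lambda>(i,j). int N * j + int i) ({..<N} \<times> UNIV) UNIV"
    by (rule bij_betwI[of _ _ _ "\<lambda>k. (nat (k mod int N), k div int N)"]) (use N in \<open>auto simp: nat_less_iff\<close>)
  have fs2: "(\<lambda>(i,j). f (int N * j + int i)) summable_on ({..<N} \<times> UNIV)"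
    using f summable_on_reindex_bij_betw[OF bij, of f] by (simp add: case_prod_unfold)
  have "infsum f UNIV = infsum (\<lambda>(i,j). f (int N * j + int i)) ({..<N} \<times> UNIV)"
    using infsum_reindex_bij_betw[OF bij, of f] by (simp add: case_prod_unfold)
  also have "\<dots> = (\<Sum>i<N. infsum (\<lambda>j. f (int N * j + int i)) UNIV)"
    using infsum_Sigma'_banach[OF fs2] by simp
  finally show ?thesis .
qed

lemma filterlim_int_intervals:
  "filterlim (\<lambda>N::nat. {- int N..int N}) (finite_subsets_at_top UNIV) sequentially"
  unfolding filterlim_finite_subsets_at_top
proof safe
  fix X :: "int set" assume X: "finite X"
  define M where "M = nat (Max (insert 0 (abs ` X)))"
  have "X \<subseteq> {- int N..int N}" if "N \<ge> M" for N
  proof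
    fix x assume "x \<in> X"
    hence "\<bar>x\<bar> \<le> Max (insert 0 (abs ` X))" using X by (intro Max_ge) auto
    with that show "x \<in> {- int N..int N}" by (auto simp: M_def)
  qed
  thus "\<forall>\<^sub>F N in sequentially. finite {- int N..int N} \<and> X \<subseteq> {- int N..int N} \<and> {- int N..int N} \<subseteq> UNIV"
    by (intro eventually_mono[OF eventually_ge_at_top[of M]]) auto
qed

lemma has_sum_group:
  fixes f :: "'s \<Rightarrow> complex"
  assumes f: "f summable_on S"
  shows "((\<lambda>k. infsum f {s\<in>S. \<phi> s = k}) has_sum infsum f S) UNIV"
proof -
  have bij: "bij_betw snd (Sigma UNIV (\<lambda>k. {s\<in>S. \<phi> s = k})) S"
    by (rule bij_betwI[of _ _ _ "\<lambda>s. (\<phi> s, s)"]) auto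
  have "((\<lambda>p. f (snd p)) has_sum infsum f S) (Sigma UNIV (\<lambda>k. {s\<in>S. \<phi> s = k}))"
    using has_sum_reindex_bij_betw[OF bij, of f] f by simp
  thus ?thesis
    by (rule has_sum_SigmaD) (use f in \<open>auto intro!: has_sum_infsum summable_on_subset_banach[OF f]\<close>)
qed

lemma summable_const_imp_finite:
  assumes "(\<lambda>_. c :: complex) summable_on S" "c \<noteq> 0"
  shows "finite S"
proof (rule ccontr)
  assume inf: "infinite S"
  have "(\<lambda>_. norm c) summable_on S" using assms(1) by (simp only: summable_on_iff_abs_summable_on_complex)
  moreover have "\<not> (\<lambda>_. norm c) summable_on S" using infsum_diverge_constant[OF inf, of "norm c"] assms(2) by simp
  ultimately show False by blast
qed

text \<open>The Weierstrass M-test for unordered sums: finite partial sums converge locally uniformly along the net of finite subsets.\<close>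
lemma holomorphic_on_infsum:
  fixes f :: "'i \<Rightarrow> complex \<Rightarrow> complex"
  assumes hol: "\<And>i. i \<in> I \<Longrightarrow> f i holomorphic_on S" and S: "open S"
    and bound: "\<And>x. x \<in> S \<Longrightarrow> \<exists>d>0. cball x d \<subseteq> S \<and>
        (\<exists>M. M summable_on I \<and> (\<forall>i\<in>I. \<forall>y\<in>cball x d. norm (f i y) \<le> M i))"
  shows "(\<lambda>z. infsum (\<lambda>i. f i z) I) holomorphic_on S"
proof -
  have "(\<lambda>z. infsum (\<lambda>i. f i z) I) field_differentiable (at x)" if x: "x \<in> S" for x
  proof -
    obtain d M where d: "d > 0" "cball x d \<subseteq> S" and M: "M summable_on I"
      and le: "\<And>i y. i \<in> I \<Longrightarrow> y \<in> cball x d \<Longrightarrow> norm (f i y) \<le> M i"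
      using bound[OF x] by blast
    have ul: "uniform_limit (cball x d) (\<lambda>X y. \<Sum>i\<in>X. f i y) (\<lambda>y. infsum (\<lambda>i. f i y) I)
                (finite_subsets_at_top I)"
      by (rule Weierstrass_m_test_general[OF le M])
    have hol': "(\<lambda>y. \<Sum>i\<in>X. f i y) holomorphic_on S" if "X \<subseteq> I" for X
      by (intro holomorphic_on_sum hol) (use that in auto)
    have "(\<lambda>y. infsum (\<lambda>i. f i y) I) holomorphic_on ball x d"
    proof (rule holomorphic_uniform_limit[OF _ ul])
      show "\<forall>\<^sub>F X in finite_subsets_at_top I. continuous_on (cball x d) (\<lambda>y. \<Sum>i\<in>X. f i y) \<and>
              (\<lambda>y. \<Sum>i\<in>X. f i y) holomorphic_on ball x d"
      proof (rule eventually_finite_subsets_at_top_weakI)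
        fix X assume "X \<subseteq> I"
        note h = hol'[OF this]
        show "continuous_on (cball x d) (\<lambda>y. \<Sum>i\<in>X. f i y) \<and>
              (\<lambda>y. \<Sum>i\<in>X. f i y) holomorphic_on ball x d"
          using holomorphic_on_subset[OF h] holomorphic_on_imp_continuous_on d ball_subset_cball
          by (meson order_trans)
      qed
    qed auto
    thus ?thesis
      using d by (metis holomorphic_on_imp_differentiable_at open_ball centre_in_ball)
  qed
  thus ?thesis
    using S by (simp add: holomorphic_on_open field_differentiable_def)
qed

lemma powser_leading_factor:
  fixes c :: "nat \<Rightarrow> complex"
  assumes sums: "(\<lambda>n. c n * q ^ n) sums F" and ord: "\<And>n. n < r \<Longrightarrow> c n = 0"
  defines "F1 \<equiv> (\<Sum>n. c (n + r) * q ^ n)"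
  shows "(\<lambda>n. c (n + r) * q ^ n) sums F1" "F = q ^ r * F1"
proof -
  have "(\<lambda>n. c (n + r) * q ^ (n + r)) sums (F - (\<Sum>i<r. c i * q ^ i))"
    using sums by (rule sums_split_initial_segment)
  hence s: "(\<lambda>n. c (n + r) * q ^ (n + r)) sums F" using ord by simp
  show s1: "(\<lambda>n. c (n + r) * q ^ n) sums F1"
  proof (cases "q = 0")
    case True
    thus ?thesis unfolding F1_def using powser_sums_zero[of "\<lambda>n. c (n + r)"] by simp
  next
    case False
    have "(\<lambda>n. c (n + r) * q ^ (n + r) / q ^ r) sums (F / q ^ r)" by (rule sums_divide[OF s])
    hence "(\<lambda>n. c (n + r) * q ^ n) sums (F / q ^ r)" using False by (simp add: power_add)
    thus ?thesis unfolding F1_def by (simp add: sums_iff)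
  qed
  have "(\<lambda>n. q ^ r * (c (n + r) * q ^ n)) sums (q ^ r * F1)" by (rule sums_mult[OF s1])
  hence "(\<lambda>n. c (n + r) * q ^ (n + r)) sums (q ^ r * F1)" by (simp add: power_add mult_ac)
  thus "F = q ^ r * F1" using s sums_unique2 by blast
qed

section \<open>Fourier series of entire periodic functions\<close>

abbreviation unit_seg :: "real \<Rightarrow> complex" where
  "unit_seg \<equiv> linepath (- (1/2)) (1/2)"

text \<open>The integration path is centred at \<open>0\<close>, so that it lies in the strip \<open>\<bar>Re z\<bar> < 1\<close>, where
\<open>0\<close> is the only integer; the inversion formula below divides by \<open>e2 z - 1\<close>.\<close>
definition fourier_coeff :: "(complex \<Rightarrow> complex) \<Rightarrow> int \<Rightarrow> complex" where
  "fourier_coeff g l = contour_integral unit_seg (\<lambda>z. g z * e2 (- of_int l * z))"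

lemma unit_seg_strip: "closed_segment (- (1/2)) (1/2) \<subseteq> {z::complex. \<bar>Re z\<bar> < 1}"
proof
  fix z :: complex assume "z \<in> closed_segment (- (1/2)) (1/2)"
  then obtain u where u: "0 \<le> u" "u \<le> 1" "z = (1 - u) *\<^sub>R (- (1/2)) + u *\<^sub>R (1/2)"
    by (auto simp: closed_segment_def)
  have "Re z = u - 1/2" by (simp add: u(3) field_simps)
  with u show "z \<in> {z::complex. \<bar>Re z\<bar> < 1}" by auto
qed

lemma strip_open_convex: "open {z::complex. \<bar>Re z\<bar> < 1}" "convex {z::complex. \<bar>Re z\<bar> < 1}"
proof -
  have eq: "{z::complex. \<bar>Re z\<bar> < 1} = {z. Re z < 1} \<inter> {z. Re z > -1}" by auto
  show "open {z::complex. \<bar>Re z\<bar> < 1}" unfolding eq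
    by (intro open_Int open_halfspace_Re_lt open_halfspace_Re_gt)
  show "convex {z::complex. \<bar>Re z\<bar> < 1}" unfolding eq
    by (intro convex_Int convex_halfspace_Re_lt convex_halfspace_Re_gt)
qed

text \<open>Integration by parts; the boundary terms cancel because \<open>E\<close> agrees at both ends of the path.\<close>
lemma fourier_coeff_deriv:
  assumes hol: "E holomorphic_on {z. \<bar>Re z\<bar> < 1}" and per: "E (1/2) = E (- (1/2))"
  shows "fourier_coeff (deriv E) l = 2 * of_real pi * \<i> * of_int l * fourier_coeff E l"
proof -
  let ?S = "{z::complex. \<bar>Re z\<bar> < 1}"
  let ?F = "\<lambda>z. E z * e2 (- of_int l * z)"
  have der: "(?F has_field_derivative
      (deriv E z * e2 (- of_int l * z) + - (2 * of_real pi * \<i> * of_int l) * (E z * e2 (- of_int l * z)))) (at z within ?S)"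
    if "z \<in> ?S" for z
  proof -
    have "(E has_field_derivative deriv E z) (at z within ?S)"
      using holomorphic_derivI[OF hol strip_open_convex(1) that] has_field_derivative_at_within by blast
    moreover have "((\<lambda>z. e2 (- of_int l * z)) has_field_derivative
                     2 * of_real pi * \<i> * e2 (- of_int l * z) * (- of_int l)) (at z within ?S)"
      by (rule DERIV_chain2[OF e2_has_derivative[where S = UNIV]])
         (auto intro!: derivative_eq_intros)
    ultimately show ?thesis
      by (rule DERIV_mult[THEN DERIV_cong]) (simp add: algebra_simps)
  qed
  have "((\<lambda>z. deriv E z * e2 (- of_int l * z) + - (2 * of_real pi * \<i> * of_int l) * (E z * e2 (- of_int l * z)))
          has_contour_integral (?F (pathfinish unit_seg) - ?F (pathstart unit_seg))) unit_seg"
    by (rule contour_integral_primitive[OF der]) (use unit_seg_strip in auto)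
  moreover have "e2 (- of_int l * (1/2)) = e2 (- of_int l * (- (1/2)))"
  proof -
    have "e2 (- of_int l * (- (1/2))) = e2 (- of_int l * (1/2) + of_int l)"
      by (rule arg_cong[of _ _ e2]) (simp add: field_simps)
    thus ?thesis by (simp only: e2_add e2_of_int mult_1_right)
  qed
  ultimately have *: "((\<lambda>z. deriv E z * e2 (- of_int l * z) + - (2 * of_real pi * \<i> * of_int l) * (E z * e2 (- of_int l * z)))
          has_contour_integral 0) unit_seg"
    using per by simp
  have i1: "(\<lambda>z. deriv E z * e2 (- of_int l * z)) contour_integrable_on unit_seg"
    by (intro contour_integrable_continuous_linepath continuous_intros
        continuous_on_subset[OF holomorphic_on_imp_continuous_on[OF holomorphic_deriv[OF hol strip_open_convex(1)]] unit_seg_strip])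
  have i2: "(\<lambda>z. E z * e2 (- of_int l * z)) contour_integrable_on unit_seg"
    by (intro contour_integrable_continuous_linepath continuous_intros
        continuous_on_subset[OF holomorphic_on_imp_continuous_on[OF hol] unit_seg_strip])
  have "fourier_coeff (deriv E) l + - (2 * of_real pi * \<i> * of_int l) * fourier_coeff E l = 0"
    unfolding fourier_coeff_def
    using contour_integral_unique[OF *] contour_integral_add[OF i1 contour_integrable_lmul[OF i2]]
      contour_integral_lmul[OF i2] by metis
  thus ?thesis by (simp add: algebra_simps)
qed

text \<open>The Riemann-Lebesgue lemma, in the differentiable case: divide the bounded coefficients of the derivative by \<open>l\<close>.\<close>
lemma fourier_coeff_tendsto_0:
  assumes hol: "E holomorphic_on {z. \<bar>Re z\<bar> < 1}" and per: "E (1/2) = E (- (1/2))"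
  shows "(\<lambda>N::nat. fourier_coeff E (int N)) \<longlonglongrightarrow> 0" "(\<lambda>N::nat. fourier_coeff E (- int N)) \<longlonglongrightarrow> 0"
proof -
  have cont: "continuous_on (closed_segment (- (1/2)) (1/2)) (deriv E)"
    by (rule continuous_on_subset[OF holomorphic_on_imp_continuous_on[OF holomorphic_deriv[OF hol strip_open_convex(1)]] unit_seg_strip])
  hence "bounded (deriv E ` closed_segment (- (1/2)) (1/2))"
    by (intro compact_imp_bounded compact_continuous_image) auto
  then obtain B where B: "\<And>z. z \<in> closed_segment (- (1/2)) (1/2) \<Longrightarrow> norm (deriv E z) \<le> B"
    unfolding bounded_iff by blast
  have B0: "B \<ge> 0" using B[of "1/2"] by (meson ends_in_segment(2) norm_ge_zero order_trans)
  have le: "norm (fourier_coeff (deriv E) l) \<le> B" for l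
  proof -
    have "norm (fourier_coeff (deriv E) l) \<le> B * norm (1/2 - (- (1/2)) :: complex)"
      unfolding fourier_coeff_def
    proof (rule contour_integral_bound_linepath)
      show "(\<lambda>z. deriv E z * e2 (- of_int l * z)) contour_integrable_on unit_seg"
        by (intro contour_integrable_continuous_linepath continuous_intros cont)
      fix z :: complex assume z: "z \<in> closed_segment (- (1/2)) (1/2)"
      hence "Im z = 0" by (auto simp: closed_segment_def)
      thus "norm (deriv E z * e2 (- of_int l * z)) \<le> B"
        using B[OF z] by (simp add: norm_mult norm_e2)
    qed (use B0 in auto)
    thus ?thesis by simp
  qed
  have le2: "norm (fourier_coeff E l) \<le> B / real_of_int \<bar>l\<bar>" if "l \<noteq> 0" for l
  proof -
    have "2 * pi * real_of_int \<bar>l\<bar> * norm (fourier_coeff E l) \<le> B"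
      using le[of l] unfolding fourier_coeff_deriv[OF assms] by (simp add: norm_mult)
    moreover have "1 * (real_of_int \<bar>l\<bar> * norm (fourier_coeff E l)) \<le> 2 * pi * (real_of_int \<bar>l\<bar> * norm (fourier_coeff E l))"
      using pi_ge_two by (intro mult_right_mono) auto
    ultimately have "real_of_int \<bar>l\<bar> * norm (fourier_coeff E l) \<le> B"
      by (simp only: mult_1 mult.assoc)
    thus ?thesis using that by (simp add: field_simps)
  qed
  have lim: "(\<lambda>N. B / real N) \<longlonglongrightarrow> 0" by real_asymp
  show "(\<lambda>N::nat. fourier_coeff E (int N)) \<longlonglongrightarrow> 0"
    by (rule Lim_null_comparison[OF _ lim], rule eventually_mono[OF eventually_gt_at_top[of 0]])
       (use le2[of "int _"] in force)
  show "(\<lambda>N::nat. fourier_coeff E (- int N)) \<longlonglongrightarrow> 0"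
    by (rule Lim_null_comparison[OF _ lim], rule eventually_mono[OF eventually_gt_at_top[of 0]])
       (use le2[of "- int _"] in force)
qed

text \<open>Chernoff's argument. The quotient \<open>E z = (g z - g 0) / (e2 z - 1)\<close> is holomorphic near the path of
integration, and \<open>g z = g 0 + E z * (e2 z - 1)\<close> turns the symmetric partial sums of the Fourier coefficients of \<open>g\<close> into a
telescoping sum of those of \<open>E\<close>, which tend to zero.\<close>
lemma fourier_inversion_at_0:
  assumes hol: "g holomorphic_on UNIV" and per: "\<And>z. g (z + 1) = g z"
  shows "(\<lambda>N::nat. \<Sum>l\<in>{- int N..int N}. fourier_coeff g l) \<longlonglongrightarrow> g 0"
proof -
  let ?S = "{z::complex. \<bar>Re z\<bar> < 1}"
  define u where "u = (\<lambda>z. if z = 0 then deriv g 0 else (g z - g 0) / (z - 0))"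
  define v where "v = (\<lambda>z. if z = 0 then deriv e2 0 else (e2 z - e2 0) / (z - 0))"
  define E where "E = (\<lambda>z. u z / v z)"
  have hu: "u holomorphic_on ?S" unfolding u_def
    by (intro pole_lemma_open holomorphic_on_subset[OF hol] strip_open_convex) auto
  have "e2 holomorphic_on ?S" using e2_holomorphic[of "\<lambda>z. z"] holomorphic_on_id
    by (simp add: holomorphic_on_ident)
  hence hv: "v holomorphic_on ?S" unfolding v_def
    by (intro pole_lemma_open strip_open_convex)
  have d0: "deriv e2 0 = 2 * of_real pi * \<i>"
    using DERIV_imp_deriv[OF e2_has_derivative[of 0 UNIV]] by simp
  have ne1: "e2 z \<noteq> 1" if "z \<in> ?S" "z \<noteq> 0" for z
    unfolding e2_eq_1_iff
  proof
    assume "z \<in> \<int>"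
    then obtain n where "z = of_int n" by (auto elim: Ints_cases)
    with that show False by auto
  qed
  have v_nz: "v z \<noteq> 0" if "z \<in> ?S" for z
    using ne1[OF that] d0 by (auto simp: v_def)
  have hE: "E holomorphic_on ?S" unfolding E_def
    by (intro holomorphic_on_divide hu hv v_nz)
  have eq: "E z * (e2 z - 1) = g z - g 0" if "z \<in> ?S" for z
    using ne1[OF that] by (cases "z = 0") (auto simp: E_def u_def v_def)
  have pE: "E (1/2) = E (- (1/2))"
  proof -
    have "e2 (1/2) = e2 (- (1/2))" using e2_add[of "-(1/2)" 1] by simp
    moreover have "g (1/2) = g (- (1/2))" using per[of "-(1/2)"] by simp
    moreover have "e2 (1/2) - 1 \<noteq> 0" using ne1[of "1/2"] by simp
    ultimately show ?thesis using eq[of "1/2"] eq[of "-(1/2)"]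
      by (metis (mono_tags, lifting) abs_minus_cancel mem_Collect_eq mult_right_cancel
          uminus_complex.simps(1) unit_seg_strip ends_in_segment subsetD)
  qed
  have intE: "(\<lambda>z. E z * e2 (- of_int l * z)) contour_integrable_on unit_seg" for l
    by (intro contour_integrable_continuous_linepath continuous_intros
        continuous_on_subset[OF holomorphic_on_imp_continuous_on[OF hE] unit_seg_strip])
  have intg: "(\<lambda>z. g z * e2 (- of_int l * z)) contour_integrable_on unit_seg" for l
    by (intro contour_integrable_continuous_linepath continuous_intros
        continuous_on_subset[OF holomorphic_on_imp_continuous_on[OF hol]]) auto
  have int1: "(\<lambda>z. e2 (- of_int l * z)) contour_integrable_on unit_seg" for l
    by (intro contour_integrable_continuous_linepath continuous_intros)
  have c1: "contour_integral unit_seg (\<lambda>z. e2 (- of_int l * z)) = (if l = 0 then 1 else 0)" for l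
  proof (cases "l = 0")
    case False
    have "fourier_coeff (deriv (\<lambda>z. 1)) l = 2 * of_real pi * \<i> * of_int l * fourier_coeff (\<lambda>z. 1) l"
      by (rule fourier_coeff_deriv) auto
    thus ?thesis using False by (simp add: fourier_coeff_def)
  next
    case True
    thus ?thesis by simp
  qed
  have tele: "fourier_coeff g l - g 0 * (if l = 0 then 1 else 0) = fourier_coeff E (l - 1) - fourier_coeff E l" for l
  proof -
    have "fourier_coeff g l - g 0 * (if l = 0 then 1 else 0)
       = contour_integral unit_seg (\<lambda>z. g z * e2 (- of_int l * z) - g 0 * e2 (- of_int l * z))"
      unfolding fourier_coeff_def c1[symmetric]
      by (simp only: contour_integral_diff[OF intg contour_integrable_lmul[OF int1]] contour_integral_lmul[OF int1])
    also have "\<dots> = contour_integral unit_seg (\<lambda>z. E z * e2 (- of_int (l - 1) * z) - E z * e2 (- of_int l * z))"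
    proof (rule contour_integral_eq)
      fix z assume "z \<in> path_image unit_seg"
      hence "z \<in> ?S" using unit_seg_strip by auto
      from eq[OF this] have "g z - g 0 = E z * (e2 z - 1)" by simp
      moreover have "e2 (- of_int (l - 1) * z) = e2 z * e2 (- of_int l * z)"
        by (simp add: e2_add[symmetric] algebra_simps)
      ultimately show "g z * e2 (- of_int l * z) - g 0 * e2 (- of_int l * z) =
          E z * e2 (- of_int (l - 1) * z) - E z * e2 (- of_int l * z)"
        by (metis (no_types, opaque_lifting) left_diff_distrib right_diff_distrib mult.assoc mult_1)
    qed
    also have "\<dots> = fourier_coeff E (l - 1) - fourier_coeff E l"
      unfolding fourier_coeff_def by (rule contour_integral_diff[OF intE intE])
    finally show ?thesis .
  qed
  have sum: "(\<Sum>l\<in>{- int N..int N}. fourier_coeff g l) = g 0 + (fourier_coeff E (- int (Suc N)) - fourier_coeff E (int N))" for N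
  proof (induction N)
    case 0
    show ?case using tele[of 0] by (simp add: algebra_simps)
  next
    case (Suc N)
    have "{- int (Suc N)..int (Suc N)} = insert (- int (Suc N)) (insert (int (Suc N)) {- int N..int N})" by auto
    hence "(\<Sum>l\<in>{- int (Suc N)..int (Suc N)}. fourier_coeff g l) =
        fourier_coeff g (- int (Suc N)) + (fourier_coeff g (int (Suc N)) + (\<Sum>l\<in>{- int N..int N}. fourier_coeff g l))"
      by (simp only: finite_insert finite_atLeastAtMost_int sum.insert) auto
    moreover have "fourier_coeff g (- int (Suc N)) = fourier_coeff E (- int (Suc (Suc N))) - fourier_coeff E (- int (Suc N))"
      using tele[of "- int (Suc N)"] by (simp add: algebra_simps)
    moreover have "fourier_coeff g (int (Suc N)) = fourier_coeff E (int N) - fourier_coeff E (int (Suc N))"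
      using tele[of "int (Suc N)"] by simp
    ultimately show ?case by (simp only: Suc) (simp only: diff_conv_add_uminus add_ac, simp)
  qed
  have "(\<lambda>N. g 0 + (fourier_coeff E (- int (Suc N)) - fourier_coeff E (int N))) \<longlonglongrightarrow> g 0 + (0 - 0)"
    by (intro tendsto_intros fourier_coeff_tendsto_0[OF hE pE]
        LIMSEQ_Suc[OF fourier_coeff_tendsto_0(2)[OF hE pE]])
  thus ?thesis by (simp add: sum)
qed

section \<open>Poisson summation for Gaussians in one variable\<close>

lemma gauss_summable:
  fixes c :: real
  assumes c: "c > 0"
  shows "(\<lambda>j::int. exp (- c * (of_int j)\<^sup>2)) summable_on UNIV"
proof -
  have nat: "(\<lambda>n::nat. exp (- c * (real n)\<^sup>2)) summable_on UNIV"
  proof (rule summable_nonneg_imp_summable_on)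
    show "summable (\<lambda>n. exp (- c * (real n)\<^sup>2))"
    proof (rule summable_comparison_test')
      show "summable (\<lambda>n. exp (- c) ^ n)" using c by (intro summable_geometric) auto
      fix n :: nat
      have "real n \<le> (real n)\<^sup>2" by (cases n) (auto simp: power2_eq_square)
      hence "c * real n \<le> c * (real n)\<^sup>2" using c by (intro mult_left_mono) auto
      thus "norm (exp (- c * (real n)\<^sup>2)) \<le> exp (- c) ^ n"
        by (simp add: exp_of_nat_mult[symmetric] mult_ac)
    qed
  qed auto
  have a: "(\<lambda>j::int. exp (- c * (of_int j)\<^sup>2)) summable_on {0..}"
    using nat by (subst summable_on_reindex_bij_witness[of _ int nat UNIV "\<lambda>n. exp (- c * (real n)\<^sup>2)"]) auto
  have b: "(\<lambda>j::int. exp (- c * (of_int j)\<^sup>2)) summable_on {..0}"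
    using nat by (subst summable_on_reindex_bij_witness[of _ "\<lambda>n. - int n" "\<lambda>j. nat (- j)" UNIV "\<lambda>n. exp (- c * (real n)\<^sup>2)"]) auto
  have "UNIV = {..0} \<union> {0::int..}" by auto
  thus ?thesis using summable_on_union[OF b a] by simp
qed

text \<open>The real shift \<open>a\<close> and the real frequency \<open>b\<close> are exchanged by Poisson summation. Writing the phase as
\<open>(j + a) * b\<close> instead of \<open>j * b\<close> makes the transform of a term again such a term, up to a constant factor.\<close>
definition gauss_term :: "complex \<Rightarrow> real \<Rightarrow> real \<Rightarrow> int \<Rightarrow> complex" where
  "gauss_term s a b j = exp (- (of_real pi * s * (of_int j + of_real a)\<^sup>2)
                             + 2 * of_real pi * \<i> * ((of_int j + of_real a) * of_real b))"

text \<open>A bound that makes the convergence of shifted Gaussian sums uniform for bounded shifts.\<close>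
lemma square_shift_bound: "(x + a)\<^sup>2 \<ge> x\<^sup>2 / 2 - (a::real)\<^sup>2"
proof -
  have "(x + a)\<^sup>2 - (x\<^sup>2 / 2 - a\<^sup>2) = (x + 2 * a)\<^sup>2 / 2" by (simp add: power2_eq_square field_simps)
  moreover have "\<dots> \<ge> 0" by simp
  ultimately show ?thesis by linarith
qed

lemma norm_gauss_term:
  "norm (gauss_term s a b j) = exp (- (pi * Re s * (of_int j + a)\<^sup>2))"
  unfolding gauss_term_def norm_exp_eq_Re by (simp add: power2_eq_square algebra_simps)

lemma norm_gauss_term_le:
  assumes "Re s \<ge> \<sigma>" "\<sigma> > 0"
  shows "norm (gauss_term s a b j) \<le> exp (pi * \<sigma> * a\<^sup>2) * exp (- (pi * \<sigma> / 2) * (of_int j)\<^sup>2)"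
proof -
  have "pi * Re s * (of_int j + a)\<^sup>2 \<ge> pi * \<sigma> * (of_int j + a)\<^sup>2"
    using assms by (intro mult_right_mono mult_left_mono) auto
  moreover have "pi * \<sigma> * (of_int j + a)\<^sup>2 \<ge> pi * \<sigma> * ((of_int j)\<^sup>2 / 2 - a\<^sup>2)"
    using assms by (intro mult_left_mono square_shift_bound) auto
  ultimately have "pi * Re s * (of_int j + a)\<^sup>2 \<ge> pi * \<sigma> * ((of_int j)\<^sup>2 / 2 - a\<^sup>2)"
    by (rule order_trans[rotated])
  moreover have "pi * \<sigma> * ((of_int j)\<^sup>2 / 2 - a\<^sup>2) = pi * \<sigma> / 2 * (of_int j)\<^sup>2 - pi * \<sigma> * a\<^sup>2"
    by (simp add: algebra_simps)
  ultimately have "- (pi * Re s * (of_int j + a)\<^sup>2) \<le> pi * \<sigma> * a\<^sup>2 + - (pi * \<sigma> / 2) * (of_int j)\<^sup>2"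
    by linarith
  thus ?thesis unfolding norm_gauss_term by (simp only: exp_add[symmetric] exp_le_cancel_iff)
qed

lemma gauss_term_abs_summable:
  assumes "Re s > 0"
  shows "(\<lambda>j. norm (gauss_term s a b j)) summable_on UNIV"
proof (rule summable_on_norm_bound)
  show "(\<lambda>j. exp (pi * Re s * a\<^sup>2) * exp (- (pi * Re s / 2) * (of_int j)\<^sup>2)) summable_on (UNIV::int set)"
    by (intro summable_on_cmult_right gauss_summable) (use assms in auto)
qed (use norm_gauss_term_le[of "Re s" s] assms in auto)

lemma gauss_term_summable:
  assumes "Re s > 0"
  shows "gauss_term s a b summable_on UNIV"
  using gauss_term_abs_summable[OF assms] Infinite_Sum.abs_summable_summable by blast

lemma gauss_sum_holomorphic:
  "(\<lambda>s. infsum (gauss_term s a b) UNIV) holomorphic_on {s. Re s > 0}"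
proof (rule holomorphic_on_infsum)
  show "(\<lambda>z. gauss_term z a b i) holomorphic_on {s. 0 < Re s}" for i
    unfolding gauss_term_def by (intro holomorphic_intros)
  show "open {s. 0 < Re s}" by (rule open_halfspace_Re_gt)
  fix s :: complex assume "s \<in> {s. 0 < Re s}"
  hence s: "Re s > 0" by simp
  have re: "Re y \<ge> Re s / 2" if "y \<in> cball s (Re s / 2)" for y
  proof -
    have "Re s - Re y \<le> cmod (s - y)" using complex_Re_le_cmod[of "s - y"] by simp
    with that show ?thesis by (simp add: dist_norm)
  qed
  show "\<exists>d>0. cball s d \<subseteq> {s. 0 < Re s} \<and> (\<exists>M. M summable_on UNIV \<and> (\<forall>i\<in>UNIV. \<forall>y\<in>cball s d. cmod (gauss_term y a b i) \<le> M i))"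
  proof (intro exI[of _ "Re s / 2"] conjI exI)
    show "(\<lambda>j. exp (pi * (Re s / 2) * a\<^sup>2) * exp (- (pi * (Re s / 2) / 2) * (of_int j)\<^sup>2)) summable_on (UNIV::int set)"
      by (intro summable_on_cmult_right gauss_summable) (use s in auto)
    show "\<forall>i\<in>UNIV. \<forall>y\<in>cball s (Re s / 2). cmod (gauss_term y a b i) \<le> exp (pi * (Re s / 2) * a\<^sup>2) * exp (- (pi * (Re s / 2) / 2) * (of_int i)\<^sup>2)"
      using s re by (intro ballI norm_gauss_term_le) auto
    show "cball s (Re s / 2) \<subseteq> {s. 0 < Re s}" using re s by fastforce
  qed (use s in auto)
qed

text \<open>The Gaussian sum with real width and complex shift. As an entire function of the shift it is determined up
to a factor by its two quasi-periods.\<close>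
definition gauss_shift :: "real \<Rightarrow> complex \<Rightarrow> complex" where
  "gauss_shift s z = (\<Sum>\<^sub>\<infinity>j::int. exp (- (of_real (pi * s) * (of_int j + z)\<^sup>2)))"

lemma norm_gauss_shift_term:
  "norm (exp (- (of_real (pi * s) * (of_int j + z)\<^sup>2))) = exp (- (pi * s * ((of_int j + Re z)\<^sup>2 - (Im z)\<^sup>2)))"
  by (simp add: power2_eq_square)

lemma norm_gauss_shift_term_le:
  fixes z :: complex
  assumes "s > 0" "norm z \<le> R"
  shows "norm (exp (- (of_real (pi * s) * (of_int j + z)\<^sup>2))) \<le> exp (pi * s * R\<^sup>2) * exp (- (pi * s / 2) * (of_int j)\<^sup>2)"
proof -
  have "(Re z)\<^sup>2 + (Im z)\<^sup>2 \<le> R\<^sup>2" using assms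
    by (metis cmod_power2 norm_ge_zero power_mono)
  hence "(of_int j + Re z)\<^sup>2 - (Im z)\<^sup>2 \<ge> (of_int j)\<^sup>2 / 2 - R\<^sup>2"
    using square_shift_bound[of "of_int j" "Re z"] by linarith
  hence "pi * s * ((of_int j + Re z)\<^sup>2 - (Im z)\<^sup>2) \<ge> pi * s * ((of_int j)\<^sup>2 / 2 - R\<^sup>2)"
    using assms by (intro mult_left_mono) auto
  moreover have "pi * s * ((of_int j)\<^sup>2 / 2 - R\<^sup>2) = pi * s / 2 * (of_int j)\<^sup>2 - pi * s * R\<^sup>2"
    by (simp add: algebra_simps)
  ultimately have "- (pi * s * ((of_int j + Re z)\<^sup>2 - (Im z)\<^sup>2)) \<le> pi * s * R\<^sup>2 + - (pi * s / 2) * (of_int j)\<^sup>2"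
    by linarith
  thus ?thesis unfolding norm_gauss_shift_term by (simp only: exp_add[symmetric] exp_le_cancel_iff)
qed

lemma gauss_shift_term_summable:
  fixes z :: complex
  assumes "s > 0"
  shows "(\<lambda>j::int. exp (- (of_real (pi * s) * (of_int j + z)\<^sup>2))) summable_on UNIV"
proof (rule summable_on_bound)
  show "(\<lambda>j. exp (pi * s * (norm z)\<^sup>2) * exp (- (pi * s / 2) * (of_int j)\<^sup>2)) summable_on (UNIV::int set)"
    by (intro summable_on_cmult_right gauss_summable) (use assms in auto)
qed (rule norm_gauss_shift_term_le, use assms in auto)

lemma gauss_shift_holomorphic:
  assumes "s > 0"
  shows "gauss_shift s holomorphic_on UNIV"
  unfolding gauss_shift_def
proof (rule holomorphic_on_infsum)
  fix x :: complex
  show "\<exists>d>0. cball x d \<subseteq> UNIV \<and> (\<exists>M. M summable_on UNIV \<and>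
     (\<forall>j\<in>UNIV. \<forall>z\<in>cball x d. cmod (exp (- (complex_of_real (pi * s) * (complex_of_int j + z)\<^sup>2))) \<le> M j))"
  proof (intro exI[of _ 1] conjI exI)
    show "(\<lambda>j. exp (pi * s * (norm x + 1)\<^sup>2) * exp (- (pi * s / 2) * (of_int j)\<^sup>2)) summable_on (UNIV::int set)"
      by (intro summable_on_cmult_right gauss_summable) (use assms in auto)
    have "norm z \<le> norm x + 1" if "z \<in> cball x 1" for z
      using that norm_triangle_ineq2[of z x] by (simp add: dist_norm norm_minus_commute)
    thus "\<forall>j\<in>UNIV. \<forall>z\<in>cball x 1. cmod (exp (- (complex_of_real (pi * s) * (complex_of_int j + z)\<^sup>2))) \<le>
       exp (pi * s * (norm x + 1)\<^sup>2) * exp (- (pi * s / 2) * (of_int j)\<^sup>2)"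
      using norm_gauss_shift_term_le[OF assms] by blast
  qed auto
qed (auto intro!: holomorphic_intros)

lemma gauss_shift_plus_1: "gauss_shift s (z + 1) = gauss_shift s z"
proof -
  have "gauss_shift s (z + 1) = (\<Sum>\<^sub>\<infinity>j\<in>UNIV. exp (- (of_real (pi * s) * (of_int (j + 1) + z)\<^sup>2)))"
    unfolding gauss_shift_def by (simp add: add_ac)
  also have "\<dots> = gauss_shift s z" unfolding gauss_shift_def
    by (rule infsum_reindex_bij_betw[where g = "\<lambda>j. j + 1" and A = UNIV and B = UNIV])
       (rule bij_betwI[of _ _ _ "\<lambda>j. j - 1"], auto)
  finally show ?thesis .
qed

text \<open>The imaginary quasi-period of a theta function: completing the square.\<close>
lemma gauss_shift_quasiperiod:
  assumes "s > 0"
  shows "gauss_shift s (z + \<i> / of_real s) = exp (of_real (pi / s)) * e2 (- z) * gauss_shift s z"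
proof -
  have "exp (- (of_real (pi * s) * (of_int j + (z + \<i> / of_real s))\<^sup>2)) =
        exp (of_real (pi / s)) * e2 (- z) * exp (- (of_real (pi * s) * (of_int j + z)\<^sup>2))" for j :: int
  proof -
    have "of_real (pi * s) * (of_int j + (z + \<i> / of_real s))\<^sup>2 =
          of_real (pi * s) * (of_int j + z)\<^sup>2 + 2 * of_real pi * \<i> * (of_int j + z) - of_real (pi / s)"
      using assms by (simp add: power2_eq_square field_simps)
    hence "exp (- (of_real (pi * s) * (of_int j + (z + \<i> / of_real s))\<^sup>2)) =
        exp (of_real (pi / s) + 2 * of_real pi * \<i> * (-z) + 2 * of_real pi * \<i> * (- of_int j) + - (of_real (pi * s) * (of_int j + z)\<^sup>2))"
      by (simp only:) (rule arg_cong[of _ _ exp], simp add: algebra_simps)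
    also have "\<dots> = exp (of_real (pi / s)) * e2 (- z) * e2 (of_int (- j)) * exp (- (of_real (pi * s) * (of_int j + z)\<^sup>2))"
      unfolding e2_def exp_add by simp
    finally show ?thesis by (simp only: e2_of_int mult_1_right)
  qed
  thus ?thesis unfolding gauss_shift_def by (simp only: infsum_cmult_right')
qed

text \<open>For a primitive \<open>P\<close> of a function with period one, \<open>P (w + 1/2) - P (w - 1/2)\<close> has derivative zero, so the
integral over a period is the same at every height and starting point.\<close>
lemma contour_integral_period_shift:
  assumes hol: "f holomorphic_on UNIV" and per: "\<And>z. f (z + 1) = f z"
  shows "contour_integral unit_seg (\<lambda>z. f (z + w)) = contour_integral unit_seg f"
proof -
  obtain P where P: "\<And>x. (P has_field_derivative f x) (at x)"
    using holomorphic_convex_primitive'[of UNIV f] hol by auto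
  have shift: "((\<lambda>z. P (z + w)) has_field_derivative f (x + w)) (at x)" for x w
  proof -
    have "((\<lambda>z. z + w) has_field_derivative 1) (at x)" by (auto intro!: derivative_eq_intros)
    from DERIV_chain2[OF P this] show ?thesis by simp
  qed
  have int: "contour_integral unit_seg (\<lambda>z. f (z + w)) = P (1/2 + w) - P (- (1/2) + w)" for w
    using contour_integral_unique[OF contour_integral_primitive[of UNIV "\<lambda>z. P (z + w)" "\<lambda>z. f (z + w)" unit_seg]] shift
    by auto
  have "((\<lambda>w. P (w + 1/2) - P (w + - (1/2))) has_field_derivative (f (x + 1/2) - f (x + - (1/2)))) (at x)" for x
    by (intro derivative_intros shift)
  moreover have "f (x + 1/2) - f (x + - (1/2)) = 0" for x
  proof -
    have "x + - (1/2) + 1 = x + 1/2" by simp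
    from per[of "x + - (1/2)", unfolded this] show ?thesis by simp
  qed
  ultimately have "\<And>x. ((\<lambda>w. P (w + 1/2) - P (w + - (1/2))) has_field_derivative 0) (at x)" by simp
  hence "P (w + 1/2) - P (w + - (1/2)) = P (0 + 1/2) - P (0 + - (1/2))"
    using has_field_derivative_zero_constant[of UNIV "\<lambda>w. P (w + 1/2) - P (w + - (1/2))"]
    by (metis UNIV_I convex_UNIV)
  thus ?thesis using int[of w] int[of 0] by (simp add: add_ac)
qed

text \<open>Moving the path of integration by \<open>\<i> / s\<close> compares the Fourier coefficients \<open>l\<close> and \<open>l + 1\<close>, by
quasi-periodicity; hence all of them are determined by the one with \<open>l = 0\<close>.\<close>
lemma gauss_shift_fourier:
  assumes s: "s > 0"
  defines "c0 \<equiv> fourier_coeff (gauss_shift s) 0"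
  shows "gauss_shift s a = c0 * (\<Sum>\<^sub>\<infinity>l::int. exp (- (of_real (pi / s) * (of_int l)\<^sup>2)) * e2 (of_int l * a))"
proof -
  define G where "G = (\<lambda>z. gauss_shift s (z + a))"
  have hG: "G holomorphic_on UNIV" unfolding G_def
    by (rule holomorphic_on_compose_gen[unfolded o_def, OF _ gauss_shift_holomorphic[OF s]]) (auto intro!: holomorphic_intros)
  have pG: "G (z + 1) = G z" for z
    using gauss_shift_plus_1[of s "z + a"] by (simp add: G_def add_ac)
  define c where "c = fourier_coeff G"
  have c0: "c 0 = c0"
    using contour_integral_period_shift[OF gauss_shift_holomorphic[OF s] gauss_shift_plus_1, of a]
    by (simp add: c_def c0_def G_def fourier_coeff_def)
  have rec: "c (l + 1) * exp (of_real (pi * (2 * of_int l + 1) / s)) = c l * e2 a" for l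
  proof -
    define F where "F = (\<lambda>z. G z * e2 (- of_int l * z))"
    have hF: "F holomorphic_on UNIV" unfolding F_def by (intro holomorphic_intros hG)
    have pF: "F (z + 1) = F z" for z
    proof -
      have "e2 (- of_int l * (z + 1)) = e2 (of_int (- l)) * e2 (- of_int l * z)"
        by (simp add: e2_add[symmetric] algebra_simps)
      thus ?thesis by (simp only: F_def pG e2_of_int mult_1)
    qed
    have Fs: "F (z + \<i> / of_real s) = (exp (of_real (pi * (2 * of_int l + 1) / s)) * e2 (- a)) * (G z * e2 (- of_int (l + 1) * z))" for z
    proof -
      have G': "G (z + \<i> / of_real s) = exp (of_real (pi / s)) * e2 (- (z + a)) * G z"
        using gauss_shift_quasiperiod[OF s, of "z + a"] by (simp add: G_def add_ac)
      have e1: "e2 (- of_int l * (z + \<i> / of_real s)) = e2 (- of_int l * z) * exp (of_real (pi * (2 * of_int l) / s))"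
        unfolding e2_def exp_add[symmetric] using s by (simp add: algebra_simps)
      have e2': "e2 (- (z + a)) * e2 (- of_int l * z) = e2 (- a) * e2 (- of_int (l + 1) * z)"
        unfolding e2_add[symmetric] by (simp add: algebra_simps)
      have e3: "exp (complex_of_real (pi * (2 * of_int l + 1) / s)) = exp (of_real (pi / s)) * exp (of_real (pi * (2 * of_int l) / s))"
        unfolding exp_add[symmetric] by (rule arg_cong[of _ _ exp]) (simp add: algebra_simps add_divide_distrib)
      have "F (z + \<i> / of_real s) = exp (of_real (pi / s)) * exp (of_real (pi * (2 * of_int l) / s)) * (e2 (- (z + a)) * e2 (- of_int l * z)) * G z"
        unfolding F_def G' e1 by (simp only: mult_ac)
      thus ?thesis unfolding e2' e3 by (simp only: mult_ac)
    qed
    have int: "(\<lambda>z. G z * e2 (- of_int m * z)) contour_integrable_on unit_seg" for m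
      by (intro contour_integrable_continuous_linepath continuous_intros
          continuous_on_subset[OF holomorphic_on_imp_continuous_on[OF hG]]) auto
    have "c l = contour_integral unit_seg (\<lambda>z. F (z + \<i> / of_real s))"
      unfolding contour_integral_period_shift[OF hF pF] by (simp add: c_def fourier_coeff_def F_def)
    also have "\<dots> = (exp (of_real (pi * (2 * of_int l + 1) / s)) * e2 (- a)) * c (l + 1)"
      unfolding Fs contour_integral_lmul[OF int] by (simp only: c_def fourier_coeff_def)
    finally have "c l * e2 a = c (l + 1) * exp (of_real (pi * (2 * of_int l + 1) / s)) * (e2 (- a) * e2 a)"
      by (simp only: mult_ac)
    thus ?thesis by (simp add: e2_add[symmetric])
  qed
  have E: "exp (- (complex_of_real (pi / s) * (of_int (l + 1))\<^sup>2)) * exp (of_real (pi * (2 * of_int l + 1) / s)) =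
        exp (- (of_real (pi / s) * (of_int l)\<^sup>2))" for l :: int
    unfolding exp_add[symmetric] by (rule arg_cong[of _ _ exp]) (use s in \<open>simp add: field_simps power2_eq_square\<close>)
  have ex: "c l = c0 * (exp (- (of_real (pi / s) * (of_int l)\<^sup>2)) * e2 (of_int l * a))" for l
  proof (induction l rule: int_induct[of _ 0])
    case base
    show ?case by (simp add: c0)
  next
    case (step1 i)
    have e: "e2 (of_int (i + 1) * a) = e2 (of_int i * a) * e2 a"
      by (simp add: e2_add[symmetric] algebra_simps)
    have "c (i + 1) * exp (of_real (pi * (2 * of_int i + 1) / s)) =
       c0 * (exp (- (complex_of_real (pi / s) * (of_int (i+1))\<^sup>2)) * e2 (of_int (i + 1) * a)) * exp (of_real (pi * (2 * of_int i + 1) / s))"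
      unfolding rec step1 E[of i, symmetric] e by (simp only: mult_ac)
    thus ?case by simp
  next
    case (step2 i)
    have r: "c i * exp (of_real (pi * (2 * of_int (i - 1) + 1) / s)) = c (i - 1) * e2 a"
      using rec[of "i - 1"] by simp
    have E': "exp (- (complex_of_real (pi / s) * (of_int i)\<^sup>2)) * exp (of_real (pi * (2 * of_int (i-1) + 1) / s)) =
        exp (- (of_real (pi / s) * (of_int (i - 1))\<^sup>2))" using E[of "i - 1"] by simp
    have e: "e2 (of_int i * a) = e2 (of_int (i - 1) * a) * e2 a"
      by (simp add: e2_add[symmetric] algebra_simps)
    have "c (i - 1) * e2 a = c0 * (exp (- (of_real (pi / s) * (of_int (i - 1))\<^sup>2)) * e2 (of_int (i - 1) * a)) * e2 a"
      unfolding r[symmetric] step2 E'[symmetric] e by (simp only: mult_ac)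
    thus ?case by simp
  qed
  define h where "h = (\<lambda>l::int. exp (- (complex_of_real (pi / s) * (of_int l)\<^sup>2)) * e2 (of_int l * a))"
  have hs: "h summable_on UNIV"
  proof (rule summable_on_bound)
    show "(\<lambda>l. exp (pi * s * (Im a)\<^sup>2 * 2) * exp (- (pi / s / 2) * (of_int l)\<^sup>2)) summable_on (UNIV::int set)"
      by (intro summable_on_cmult_right gauss_summable) (use s in auto)
    fix l :: int
    have "0 \<le> pi / (2 * s) * (of_int l + 2 * s * Im a)\<^sup>2" using s by simp
    moreover have "pi / (2 * s) * (of_int l + 2 * s * Im a)\<^sup>2 =
        (pi * s * (Im a)\<^sup>2 * 2 + - (pi / s / 2) * (of_int l)\<^sup>2) - (- (pi / s * (of_int l)\<^sup>2) - 2 * pi * (of_int l * Im a))"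
      using s by (simp add: field_simps power2_eq_square)
    ultimately have "- (pi / s * (of_int l)\<^sup>2) - 2 * pi * (of_int l * Im a) \<le> pi * s * (Im a)\<^sup>2 * 2 + - (pi / s / 2) * (of_int l)\<^sup>2"
      by linarith
    moreover have "norm (h l) = exp (- (pi / s * (of_int l)\<^sup>2) - 2 * pi * (of_int l * Im a))"
      by (simp add: h_def norm_mult norm_e2 exp_add[symmetric] power2_eq_square)
    ultimately show "norm (h l) \<le> exp (pi * s * (Im a)\<^sup>2 * 2) * exp (- (pi / s / 2) * (of_int l)\<^sup>2)"
      by (simp only: exp_add[symmetric] exp_le_cancel_iff)
  qed
  have lim1: "(\<lambda>N::nat. \<Sum>l\<in>{- int N..int N}. c l) \<longlonglongrightarrow> G 0"
    unfolding c_def by (rule fourier_inversion_at_0[OF hG pG])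
  have "(\<lambda>N::nat. \<Sum>l\<in>{- int N..int N}. h l) \<longlonglongrightarrow> infsum h UNIV"
    using infsum_tendsto[OF hs] filterlim_int_intervals by (rule filterlim_compose)
  hence "(\<lambda>N::nat. c0 * (\<Sum>l\<in>{- int N..int N}. h l)) \<longlonglongrightarrow> c0 * infsum h UNIV"
    by (intro tendsto_intros)
  moreover have "(\<Sum>l\<in>{- int N..int N}. c l) = c0 * (\<Sum>l\<in>{- int N..int N}. h l)" for N
    by (simp add: ex h_def sum_distrib_left)
  ultimately have "G 0 = c0 * infsum h UNIV"
    using lim1 LIMSEQ_unique by simp
  thus ?thesis by (simp add: G_def h_def)
qed

lemma sum_roots_of_unity:
  assumes N: "N > 0"
  shows "(\<Sum>i<N. e2 (of_int l * (of_nat i / of_nat N))) = (if int N dvd l then of_nat N else 0)"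
proof (cases "int N dvd l")
  case True
  then obtain k where k: "l = int N * k" by (elim dvdE)
  have "e2 (of_int l * (of_nat i / of_nat N)) = e2 (of_int (k * int i))" for i
    using N by (simp add: k)
  hence "e2 (of_int l * (of_nat i / of_nat N)) = 1" for i by (simp only: e2_of_int)
  thus ?thesis using True by simp
next
  case False
  define w where "w = e2 (of_int l / of_nat N)"
  have pow: "e2 (of_int l * (of_nat i / of_nat N)) = w ^ i" for i
    unfolding w_def e2_power by (simp add: mult_ac)
  have "w \<noteq> 1"
  proof
    assume "w = 1"
    then obtain k where "of_int l / of_nat N = (of_int k :: complex)"
      unfolding w_def e2_eq_1_iff by (elim Ints_cases)
    hence "(of_int l :: complex) = of_int (k * int N)" using N by (simp add: field_simps)
    hence "l = k * int N" by (simp only: of_int_eq_iff)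
    thus False using False by simp
  qed
  moreover have "w ^ N = 1"
    unfolding pow[symmetric] using N by simp
  ultimately have "(\<Sum>i<N. w ^ i) = 0" by (simp add: geometric_sum)
  thus ?thesis using False by (simp only: pow if_False)
qed

lemma gauss_shift_0_fourier:
  "s > 0 \<Longrightarrow> gauss_shift s 0 = fourier_coeff (gauss_shift s) 0 * gauss_shift (1 / s) 0"
  using gauss_shift_fourier[of s 0] by (simp add: gauss_shift_def)

lemma gauss_shift_real_pos: "s > 0 \<Longrightarrow> gauss_shift s 0 \<noteq> 0"
proof -
  assume s: "s > 0"
  define h where "h = (\<lambda>j::int. exp (- (pi * s * (of_int j)\<^sup>2)))"
  have hs: "h summable_on UNIV" using gauss_summable[of "pi * s"] s by (simp add: h_def)
  have "gauss_shift s 0 = infsum (\<lambda>j. of_real (h j)) UNIV"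
    unfolding gauss_shift_def h_def by (intro infsum_cong) (simp only: exp_of_real[symmetric], simp)
  also have "\<dots> = of_real (infsum h UNIV)"
    by (rule infsumI[OF has_sum_of_real[OF has_sum_infsum[OF hs]]])
  finally have eq: "gauss_shift s 0 = of_real (infsum h UNIV)" .
  have "infsum h UNIV \<ge> sum h {0}" by (intro finite_sum_le_infsum hs) (auto simp: h_def)
  thus ?thesis using eq by (auto simp: h_def)
qed

text \<open>Averaging the Gaussian sum of width \<open>N\<^sup>2 * s\<close> over the shifts \<open>i / N\<close> gives the one of width \<open>s\<close>, while
on the Fourier side it selects the frequencies divisible by \<open>N\<close>. This scaling law replaces the evaluation of the Gaussian
integral.\<close>
lemma fourier_coeff_gauss_shift_scale:
  assumes s: "s > 0" and N: "N > 0"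
  shows "fourier_coeff (gauss_shift s) 0 = of_nat N * fourier_coeff (gauss_shift ((real N)\<^sup>2 * s)) 0"
proof -
  define t where "t = (real N)\<^sup>2 * s"
  have t: "t > 0" using s N by (simp add: t_def)
  let ?c = "fourier_coeff (gauss_shift t) 0"
  define f where "f = (\<lambda>k::int. exp (- (complex_of_real (pi * s) * (of_int k)\<^sup>2)))"
  have fs: "f summable_on UNIV" using gauss_shift_term_summable[OF s, of 0] by (simp add: f_def)
  have trm: "exp (- (complex_of_real (pi * t) * (of_int j + of_nat i / of_nat N)\<^sup>2)) = f (int N * j + int i)" for j i
  proof -
    have "(of_int (int N * j + int i) :: complex) = of_nat N * (of_int j + of_nat i / of_nat N)"
      using N by (simp add: field_simps)
    thus ?thesis unfolding f_def by (simp add: t_def power_mult_distrib mult_ac)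
  qed
  have "gauss_shift s 0 = infsum f UNIV" by (simp add: gauss_shift_def f_def)
  also have "\<dots> = (\<Sum>i<N. infsum (\<lambda>j. f (int N * j + int i)) UNIV)"
    by (rule infsum_residue_classes[OF N fs])
  also have "\<dots> = (\<Sum>i<N. gauss_shift t (of_nat i / of_nat N))"
    unfolding gauss_shift_def trm ..
  also have "\<dots> = (\<Sum>i<N. ?c * (\<Sum>\<^sub>\<infinity>l::int. exp (- (of_real (pi / t) * (of_int l)\<^sup>2)) * e2 (of_int l * (of_nat i / of_nat N))))"
    by (intro sum.cong refl gauss_shift_fourier t)
  also have "\<dots> = ?c * (\<Sum>i<N. \<Sum>\<^sub>\<infinity>l::int. exp (- (of_real (pi / t) * (of_int l)\<^sup>2)) * e2 (of_int l * (of_nat i / of_nat N)))"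
    by (simp only: sum_distrib_left)
  also have "(\<Sum>i<N. \<Sum>\<^sub>\<infinity>l::int. exp (- (of_real (pi / t) * (of_int l)\<^sup>2)) * e2 (of_int l * (of_nat i / of_nat N)))
     = (\<Sum>\<^sub>\<infinity>l::int. \<Sum>i<N. exp (- (of_real (pi / t) * (of_int l)\<^sup>2)) * e2 (of_int l * (of_nat i / of_nat N)))"
  proof (rule infsum_finite_sum[symmetric])
    fix i
    have "(\<lambda>l::int. exp (- (complex_of_real (pi / t) * (of_int l)\<^sup>2))) summable_on UNIV"
      using gauss_shift_term_summable[of "1 / t" 0] t by simp
    hence "(\<lambda>l::int. norm (exp (- (complex_of_real (pi / t) * (of_int l)\<^sup>2)))) summable_on UNIV"
      by (simp only: summable_on_iff_abs_summable_on_complex)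
    thus "(\<lambda>l::int. exp (- (of_real (pi / t) * (of_int l)\<^sup>2)) * e2 (of_int l * (of_nat i / of_nat N))) summable_on UNIV"
      by (rule summable_on_bound)
         (simp add: norm_mult norm_e2)
  qed simp
  also have "\<dots> = (\<Sum>\<^sub>\<infinity>l::int. if int N dvd l then of_nat N * exp (- (of_real (pi / t) * (of_int l)\<^sup>2)) else 0)"
    by (intro infsum_cong) (simp only: sum_distrib_left[symmetric] sum_roots_of_unity[OF N], auto simp: mult_ac)
  also have "\<dots> = (\<Sum>\<^sub>\<infinity>l\<in>{l. int N dvd l}. of_nat N * exp (- (of_real (pi / t) * (of_int l)\<^sup>2)))"
    by (rule infsum_cong_neutral) auto
  also have "\<dots> = (\<Sum>\<^sub>\<infinity>m\<in>UNIV. of_nat N * exp (- (of_real (pi * (1 / s)) * (of_int m)\<^sup>2)))"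
    by (rule infsum_reindex_bij_witness[of _ "\<lambda>m. int N * m" "\<lambda>l. l div int N"])
       (use N s in \<open>auto simp: t_def power_mult_distrib elim!: dvdE\<close>)
  also have "\<dots> = of_nat N * gauss_shift (1 / s) 0"
    unfolding gauss_shift_def by (simp add: infsum_cmult_right')
  finally have "gauss_shift s 0 = of_nat N * ?c * gauss_shift (1 / s) 0" by (simp add: mult_ac)
  with gauss_shift_0_fourier[OF s] gauss_shift_real_pos[of "1 / s"] s show ?thesis
    by (simp add: t_def)
qed

lemma inverse_Re_pos: "Re s > 0 \<Longrightarrow> Re (1 / s) > 0"
  by (auto simp: Re_divide intro!: divide_pos_pos add_pos_nonneg)

lemma csqrt_holomorphic_right: "csqrt holomorphic_on {s. Re s > 0}"
proof -
  have "csqrt holomorphic_on - \<real>\<^sub>\<le>\<^sub>0"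
    by (rule holomorphic_on_csqrt)
  thus ?thesis by (rule holomorphic_on_subset) (auto simp: complex_nonpos_Reals_iff)
qed

lemma gauss_shift_eq_gauss: "gauss_shift s 0 = infsum (gauss_term (of_real s) 0 0) UNIV"
  unfolding gauss_shift_def by (intro infsum_cong) (simp add: gauss_term_def)

lemma gauss_inverse_holomorphic:
  "(\<lambda>s. infsum (gauss_term (1 / s) a b) UNIV) holomorphic_on {s. Re s > 0}"
  by (rule holomorphic_on_compose_gen[unfolded o_def, OF _ gauss_sum_holomorphic, where f = "\<lambda>s. 1 / s"])
     (auto intro!: holomorphic_intros simp: inverse_Re_pos)

text \<open>By the scaling law, the constant in \<open>gauss_shift_fourier\<close> is \<open>1 / sqrt s\<close> if \<open>s\<close> is the square of a rational
number. Such \<open>s\<close> accumulate at 1, and both sides are holomorphic in \<open>s\<close>.\<close>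
lemma gauss_poisson_unshifted:
  assumes s: "Re s > 0"
  shows "csqrt s * infsum (gauss_term s 0 0) UNIV - infsum (gauss_term (1 / s) 0 0) UNIV = 0"
proof -
  define U where "U = (\<lambda>n::nat. of_real ((1 + 1 / real (Suc n))\<^sup>2) :: complex) ` UNIV"
  \<comment> \<open>At \<open>s = 1\<close> the same nonzero sum stands on both sides.\<close>
  have c1: "fourier_coeff (gauss_shift 1) 0 = 1"
    using gauss_shift_0_fourier[of 1] gauss_shift_real_pos[of 1] by simp
  have zero: "csqrt z * infsum (gauss_term z 0 0) UNIV - infsum (gauss_term (1 / z) 0 0) UNIV = 0" if zU: "z \<in> U" for z
  proof -
    obtain n where n: "z = of_real ((1 + 1 / real (Suc n))\<^sup>2)" using zU unfolding U_def by blast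
    \<comment> \<open>\<open>z\<close> is the square of the rational number \<open>p / q\<close>; the scaling law is applied to \<open>1 / q\<^sup>2\<close> with the factors \<open>p\<close> and \<open>q\<close>.\<close>
    define p where "p = n + 2"
    define q where "q = n + 1"
    have pq: "p > 0" "q > 0" by (auto simp: p_def q_def)
    define r where "r = real p / real q"
    have r: "r > 0" using pq by (simp add: r_def)
    have z: "z = of_real (r\<^sup>2)" unfolding n r_def p_def q_def by (simp add: field_simps)
    have q1: "fourier_coeff (gauss_shift (1 / (real q)\<^sup>2)) 0 = of_nat q * fourier_coeff (gauss_shift 1) 0"
      using fourier_coeff_gauss_shift_scale[of "1 / (real q)\<^sup>2" q] pq by simp
    have p1: "fourier_coeff (gauss_shift (1 / (real q)\<^sup>2)) 0 = of_nat p * fourier_coeff (gauss_shift (r\<^sup>2)) 0"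
      using fourier_coeff_gauss_shift_scale[of "1 / (real q)\<^sup>2" p] pq by (simp add: r_def power_divide)
    have "fourier_coeff (gauss_shift (r\<^sup>2)) 0 = 1 / of_real r"
      using p1 q1 c1 pq by (simp add: r_def field_simps)
    hence "gauss_shift (r\<^sup>2) 0 = 1 / of_real r * gauss_shift (1 / r\<^sup>2) 0" using gauss_shift_0_fourier[of "r\<^sup>2"] r by simp
    hence "of_real r * gauss_shift (r\<^sup>2) 0 = gauss_shift (1 / r\<^sup>2) 0" using r by simp
    moreover have "csqrt (of_real (r\<^sup>2)) = of_real r" using r by (simp add: csqrt_of_real_nonneg)
    ultimately show ?thesis unfolding z by (simp only: gauss_shift_eq_gauss of_real_divide of_real_1) simp
  qed
  have lim: "1 islimpt U"
  proof -
    have "(\<lambda>n. of_real ((1 + 1 / real (Suc n))\<^sup>2) :: complex) \<longlonglongrightarrow> of_real 1"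
      by (rule tendsto_of_real) real_asymp
    moreover have "of_real ((1 + 1 / real (Suc n))\<^sup>2) \<in> U - {1::complex}" for n
    proof -
      have "(1 + 1 / real (Suc n))\<^sup>2 > 1" by (rule one_less_power) auto
      hence "(1 + 1 / real (Suc n))\<^sup>2 \<noteq> 1" by linarith
      hence "(of_real ((1 + 1 / real (Suc n))\<^sup>2) :: complex) \<noteq> 1" by (simp only: of_real_eq_1_iff) simp
      thus ?thesis by (simp only: U_def) blast
    qed
    ultimately show ?thesis unfolding islimpt_sequential
      by (intro exI[of _ "\<lambda>n. of_real ((1 + 1 / real (Suc n))\<^sup>2)"]) auto
  qed
  show ?thesis
  proof (rule analytic_continuation[of "\<lambda>s. csqrt s * infsum (gauss_term s 0 0) UNIV - infsum (gauss_term (1 / s) 0 0) UNIV" "{s. Re s > 0}" U 1 s])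
    show "(\<lambda>s. csqrt s * infsum (gauss_term s 0 0) UNIV - infsum (gauss_term (1 / s) 0 0) UNIV) holomorphic_on {s. 0 < Re s}"
      by (intro holomorphic_intros csqrt_holomorphic_right gauss_sum_holomorphic gauss_inverse_holomorphic)
    have "(1 + 1 / real (Suc n))\<^sup>2 > 0" for n
      by (rule zero_less_power, rule add_pos_nonneg) auto
    thus "U \<subseteq> {s. 0 < Re s}" unfolding U_def by (auto simp del: of_real_power)
    show "connected {s. 0 < Re s}" by (intro convex_connected convex_halfspace_Re_gt)
    show "csqrt z * infsum (gauss_term z 0 0) UNIV - infsum (gauss_term (1 / z) 0 0) UNIV = 0" if "z \<in> U" for z
      using zero[OF that] .
  qed (use lim s in \<open>auto intro!: open_halfspace_Re_gt\<close>)
qed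

lemma fourier_coeff_gauss_shift: "s > 0 \<Longrightarrow> fourier_coeff (gauss_shift s) 0 = 1 / csqrt (of_real s)"
proof -
  assume s: "s > 0"
  have "csqrt (of_real s) * gauss_shift s 0 = gauss_shift (1 / s) 0"
    using gauss_poisson_unshifted[of "of_real s"] s by (simp add: gauss_shift_eq_gauss)
  moreover have "csqrt (of_real s) \<noteq> 0" using s by simp
  ultimately show ?thesis using gauss_shift_0_fourier[OF s] gauss_shift_real_pos[OF s] gauss_shift_real_pos[of "1/s"] s
    by (simp add: field_simps)
qed

lemma gauss_poisson_real:
  assumes s: "s > 0"
  shows "infsum (gauss_term (of_real s) a b) UNIV =
          e2 (of_real (a * b)) / csqrt (of_real s) * infsum (gauss_term (1 / of_real s) (- b) a) UNIV"
proof -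
  define z where "z = of_real a - \<i> * of_real b / of_real s"
  have 1: "gauss_term (of_real s) a b j = exp (- of_real (pi * b\<^sup>2 / s)) * exp (- (of_real (pi * s) * (of_int j + z)\<^sup>2))" for j
    unfolding gauss_term_def exp_add[symmetric] z_def
    by (rule arg_cong[of _ _ exp]) (use s in \<open>simp add: field_simps power2_eq_square\<close>)
  have 2: "exp (- of_real (pi * b\<^sup>2 / s)) * (exp (- (of_real (pi / s) * (of_int l)\<^sup>2)) * e2 (of_int l * z)) =
           e2 (of_real (a * b)) * gauss_term (1 / of_real s) (- b) a l" for l
    unfolding gauss_term_def e2_def exp_add[symmetric] z_def
    by (rule arg_cong[of _ _ exp]) (use s in \<open>simp add: field_simps power2_eq_square\<close>)
  have "infsum (gauss_term (of_real s) a b) UNIV = exp (- of_real (pi * b\<^sup>2 / s)) * gauss_shift s z"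
    unfolding 1 gauss_shift_def by (simp only: infsum_cmult_right')
  also have "\<dots> = 1 / csqrt (of_real s) * (\<Sum>\<^sub>\<infinity>l. exp (- of_real (pi * b\<^sup>2 / s)) * (exp (- (of_real (pi / s) * (of_int l)\<^sup>2)) * e2 (of_int l * z)))"
    unfolding gauss_shift_fourier[OF s] fourier_coeff_gauss_shift[OF s] infsum_cmult_right' by (simp only: mult_ac)
  also have "\<dots> = e2 (of_real (a * b)) / csqrt (of_real s) * infsum (gauss_term (1 / of_real s) (- b) a) UNIV"
    unfolding 2 by (simp only: infsum_cmult_right') simp
  finally show ?thesis .
qed

text \<open>For real \<open>s\<close> the frequency \<open>b\<close> is absorbed in the complex shift \<open>a - \<i> * b / s\<close>. The identity theorem
extends the formula to complex \<open>s\<close>.\<close>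
theorem gauss_poisson:
  assumes s: "Re s > 0"
  shows "infsum (gauss_term s a b) UNIV =
          e2 (of_real (a * b)) / csqrt s * infsum (gauss_term (1 / s) (- b) a) UNIV"
proof -
  have nz: "csqrt z \<noteq> 0" if "z \<in> {s. Re s > 0}" for z using that by auto
  have "infsum (gauss_term s a b) UNIV -
          e2 (of_real (a * b)) / csqrt s * infsum (gauss_term (1 / s) (- b) a) UNIV = 0"
  proof (rule analytic_continuation[of "\<lambda>s. infsum (gauss_term s a b) UNIV - e2 (of_real (a * b)) / csqrt s * infsum (gauss_term (1 / s) (- b) a) UNIV" "{s. Re s > 0}" "complex_of_real ` {0<..}" 1 s])
    show "(\<lambda>s. infsum (gauss_term s a b) UNIV - e2 (of_real (a * b)) / csqrt s * infsum (gauss_term (1 / s) (- b) a) UNIV)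
             holomorphic_on {s. Re s > 0}"
      by (intro holomorphic_intros csqrt_holomorphic_right gauss_sum_holomorphic gauss_inverse_holomorphic nz)
    have mem: "of_real (1 + 1 / real (Suc n)) \<in> complex_of_real ` {0<..} - {1}" for n
    proof -
      have *: "1 + 1 / real (Suc n) \<noteq> 1" "1 + 1 / real (Suc n) \<in> {0<..}" by (auto intro: add_pos_nonneg)
      have "complex_of_real (1 + 1 / real (Suc n)) \<noteq> 1" using *(1) by (simp only: of_real_eq_1_iff not_False_eq_True)
      thus ?thesis using imageI[OF *(2), of complex_of_real] by (simp only: Diff_iff singleton_iff simp_thms)
    qed
    have "(\<lambda>n. of_real (1 + 1 / real (Suc n)) :: complex) \<longlonglongrightarrow> of_real 1"
      by (rule tendsto_of_real) real_asymp
    thus "1 islimpt complex_of_real ` {0<..}"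
      unfolding islimpt_sequential of_real_1 using mem
      by (intro exI[of _ "\<lambda>n. of_real (1 + 1 / real (Suc n))"] conjI allI)
    show "connected {s. 0 < Re s}" by (intro convex_connected convex_halfspace_Re_gt)
    show "infsum (gauss_term z a b) UNIV - e2 (of_real (a * b)) / csqrt z * infsum (gauss_term (1 / z) (- b) a) UNIV = 0"
      if "z \<in> complex_of_real ` {0<..}" for z
    proof -
      obtain x where x: "x > 0" "z = of_real x" using \<open>z \<in> _\<close> by auto
      show ?thesis unfolding x(2) right_minus_eq by (rule gauss_poisson_real[OF x(1)])
    qed
  qed (use s in \<open>auto intro!: open_halfspace_Re_gt\<close>)
  thus ?thesis by simp
qed

section \<open>Poisson summation over lattices\<close>

text \<open>The ambient space may have infinite dimension; the projection to the span of a finite set is built by adding one vector at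
a time, as in the Gram-Schmidt process.\<close>
lemma orthogonal_projection_exists:
  fixes B :: "'a::real_inner set"
  assumes "finite B"
  shows "\<exists>p\<in>span B. \<forall>x\<in>span B. x \<bullet> (v - p) = 0"
  using assms
proof (induction B arbitrary: v rule: finite_induct)
  case empty
  thus ?case by auto
next
  case (insert b B)
  obtain pb where pb: "pb \<in> span B" "\<And>x. x \<in> span B \<Longrightarrow> x \<bullet> (b - pb) = 0"
    using insert.IH[of b] by blast
  obtain pv where pv: "pv \<in> span B" "\<And>x. x \<in> span B \<Longrightarrow> x \<bullet> (v - pv) = 0"
    using insert.IH[of v] by blast
  define h where "h = b - pb"
  define p where "p = pv + ((v \<bullet> h) / (h \<bullet> h)) *\<^sub>R h"
  have sub: "span B \<subseteq> span (insert b B)" by (rule span_mono) auto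
  have "b \<in> span (insert b B)" by (simp add: span_base)
  hence h: "h \<in> span (insert b B)" unfolding h_def using pb sub by (auto intro: span_diff)
  have p: "p \<in> span (insert b B)"
    unfolding p_def using pv sub h by (auto intro!: span_add span_scale)
  have B: "x \<bullet> (v - p) = 0" if "x \<in> span B" for x
    using pv(2)[OF that] pb(2)[OF that] by (simp add: p_def h_def inner_diff_right inner_add_right)
  have hh: "h \<bullet> (v - p) = 0"
  proof (cases "h = 0")
    case False
    have "h \<bullet> pv = 0" using pb(2)[OF pv(1)] by (simp add: h_def inner_commute)
    thus ?thesis using False by (simp add: p_def inner_diff_right inner_add_right inner_commute)
  qed auto
  have "x \<bullet> (v - p) = 0" if "x \<in> span (insert b B)" for x
  proof -
    obtain k where k: "x - k *\<^sub>R b \<in> span B" using \<open>x \<in> _\<close> span_breakdown_eq by blast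
    have "x = (x - k *\<^sub>R b) + k *\<^sub>R pb + k *\<^sub>R h" by (simp add: h_def algebra_simps)
    hence "x \<bullet> (v - p) = (x - k *\<^sub>R b) \<bullet> (v - p) + k * (pb \<bullet> (v - p)) + k * (h \<bullet> (v - p))"
      by (metis inner_add_left inner_scaleR_left)
    thus ?thesis using B[OF k] B[OF pb(1)] hh by simp
  qed
  with p show ?case by blast
qed

definition zspan :: "'a::real_inner set \<Rightarrow> 'a set" where
  "zspan B = {(\<Sum>b\<in>B. of_int (c b) *\<^sub>R b) | c :: 'a \<Rightarrow> int. True}"

text \<open>The dual of the lattice spanned by \<open>B\<close>: integrality needs to be tested on the basis only.\<close>
definition zdual :: "'a::real_inner set \<Rightarrow> 'a set" where
  "zdual B = {y \<in> span B. \<forall>b\<in>B. y \<bullet> b \<in> \<int>}"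

lemma zspan_subset_span: "zspan B \<subseteq> span B"
  unfolding zspan_def by (auto intro: span_sum span_scale span_base)

lemma zdual_subset_span: "zdual B \<subseteq> span B"
  unfolding zdual_def by auto

lemma zspan_base: "finite B \<Longrightarrow> b \<in> B \<Longrightarrow> b \<in> zspan B"
  unfolding zspan_def
  by (rule CollectI, rule exI[of _ "\<lambda>x. if x = b then 1 else 0"]) (simp add: if_distrib if_distribR cong: if_cong)

lemma span_zspan: "finite B \<Longrightarrow> span (zspan B) = span B"
proof
  assume "finite B"
  thus "span B \<subseteq> span (zspan B)" by (intro span_mono) (auto intro: zspan_base)
  show "span (zspan B) \<subseteq> span B" using zspan_subset_span span_minimal[of "zspan B" "span B"] by blast
qed

lemma dual_lattice_zspan:
  assumes "finite B"
  shows "dual_lattice (zspan B) = zdual B"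
proof (intro equalityI subsetI)
  fix y assume "y \<in> dual_lattice (zspan B)"
  thus "y \<in> zdual B" using assms zspan_base[OF assms]
    by (auto simp: dual_lattice_def zdual_def span_zspan inner_commute)
next
  fix y assume y: "y \<in> zdual B"
  have "x \<bullet> y \<in> \<int>" if "x \<in> zspan B" for x
  proof -
    obtain c where "x = (\<Sum>b\<in>B. of_int (c b) *\<^sub>R b)" using \<open>x \<in> _\<close> by (auto simp: zspan_def)
    hence "x \<bullet> y = (\<Sum>b\<in>B. of_int (c b) * (b \<bullet> y))" by (simp add: inner_sum_left)
    moreover have "\<dots> \<in> \<int>" using y by (intro Ints_sum Ints_mult) (auto simp: zdual_def inner_commute)
    ultimately show ?thesis by simp
  qed
  with y show "y \<in> dual_lattice (zspan B)" using assms
    by (auto simp: dual_lattice_def zdual_def span_zspan)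
qed

lemma bij_betw_zspan_insert:
  assumes fin: "finite B" and b: "b \<notin> span B"
  shows "bij_betw (\<lambda>(y, j::int). y + of_int j *\<^sub>R b) (zspan B \<times> UNIV) (zspan (insert b B))"
proof -
  have bB: "b \<notin> B" using b span_base by blast
  show ?thesis
  proof (rule bij_betw_imageI)
    show "inj_on (\<lambda>(y, j::int). y + of_int j *\<^sub>R b) (zspan B \<times> UNIV)"
    proof (rule inj_onI, clarify)
      fix y j y' and j' :: int
      assume y: "y \<in> zspan B" "y' \<in> zspan B" and eq: "y + of_int j *\<^sub>R b = y' + of_int j' *\<^sub>R b"
      have "j = j'"
      proof (rule ccontr)
        assume "j \<noteq> j'"
        have "of_int (j - j') *\<^sub>R b = y' - y" using eq by (simp add: algebra_simps)
        moreover have "y' - y \<in> span B" using y zspan_subset_span by (blast intro: span_diff)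
        ultimately have "(1 / of_int (j - j')) *\<^sub>R (of_int (j - j') *\<^sub>R b) \<in> span B" by (metis span_scale)
        thus False using b \<open>j \<noteq> j'\<close> by simp
      qed
      with eq show "y = y' \<and> j = j'" by simp
    qed
    show "(\<lambda>(y, j::int). y + of_int j *\<^sub>R b) ` (zspan B \<times> UNIV) = zspan (insert b B)"
    proof (intro equalityI subsetI)
      fix x assume "x \<in> (\<lambda>(y, j::int). y + of_int j *\<^sub>R b) ` (zspan B \<times> UNIV)"
      then obtain c j where x: "x = (\<Sum>b\<in>B. of_int (c b) *\<^sub>R b) + of_int j *\<^sub>R b"
        by (auto simp: zspan_def)
      have "(\<Sum>b\<in>B. of_int (c b) *\<^sub>R b) = (\<Sum>x\<in>B. of_int ((c(b := j)) x) *\<^sub>R x)"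
        using bB by (intro sum.cong) auto
      hence "x = (\<Sum>x\<in>insert b B. of_int ((c(b := j)) x) *\<^sub>R x)" using fin bB x by simp
      thus "x \<in> zspan (insert b B)" unfolding zspan_def by blast
    next
      fix x assume "x \<in> zspan (insert b B)"
      then obtain c :: "'a \<Rightarrow> int" where "x = (\<Sum>x\<in>insert b B. of_int (c x) *\<^sub>R x)"
        by (auto simp: zspan_def)
      hence "x = (\<Sum>b\<in>B. of_int (c b) *\<^sub>R b) + of_int (c b) *\<^sub>R b" using fin bB by simp
      moreover have "(\<Sum>b\<in>B. of_int (c b) *\<^sub>R b) \<in> zspan B" by (auto simp: zspan_def)
      ultimately show "x \<in> (\<lambda>(y, j::int). y + of_int j *\<^sub>R b) ` (zspan B \<times> UNIV)" by force
    qed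
  qed
qed

text \<open>Let \<open>b = p + h\<close> with \<open>p\<close> in the span of \<open>B\<close> and \<open>h\<close> orthogonal to it. The projection of a dual vector to the span
of \<open>B\<close> is an element \<open>m\<close> of the old dual lattice, and its pairing \<open>l\<close> with \<open>b\<close> then fixes the component along \<open>h\<close>.\<close>
lemma bij_betw_zdual_insert:
  assumes b: "b = p + h" "p \<in> span B" "\<And>x. x \<in> span B \<Longrightarrow> x \<bullet> h = 0" and h: "h \<noteq> 0"
  shows "bij_betw (\<lambda>(m, l::int). m + ((of_int l - m \<bullet> p) / (h \<bullet> h)) *\<^sub>R h) (zdual B \<times> UNIV) (zdual (insert b B))"
proof (rule bij_betwI[of _ _ _ "\<lambda>y. (y - ((y \<bullet> h) / (h \<bullet> h)) *\<^sub>R h, \<lfloor>y \<bullet> b\<rfloor>)"])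
  have sub: "span B \<subseteq> span (insert b B)" by (rule span_mono) auto
  have "b \<in> span (insert b B)" by (simp add: span_base)
  hence "b - p \<in> span (insert b B)" by (rule span_diff) (use b(2) sub in blast)
  moreover have "b - p = h" using b(1) by simp
  ultimately have hs: "h \<in> span (insert b B)" by (simp only:)
  have ph: "p \<bullet> h = 0" by (rule b(3)[OF b(2)])
  have hB: "h \<bullet> x = 0" if "x \<in> B" for x using b(3)[OF span_base[OF that]] by (simp add: inner_commute)
  have hh: "h \<bullet> h \<noteq> 0" using h by simp
  have inb: "(m + ((of_int l - m \<bullet> p) / (h \<bullet> h)) *\<^sub>R h) \<bullet> b = of_int l" if "m \<in> span B" for m and l :: int
  proof -
    have "m \<bullet> h = 0" by (rule b(3)[OF that])
    moreover have "h \<bullet> p = 0" using ph by (simp only: inner_commute)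
    ultimately show ?thesis using hh unfolding b(1) inner_add_left inner_add_right inner_scaleR_left by simp
  qed
  show "(\<lambda>(m, l::int). m + ((of_int l - m \<bullet> p) / (h \<bullet> h)) *\<^sub>R h) \<in> zdual B \<times> UNIV \<rightarrow> zdual (insert b B)"
  proof clarify
    fix m and l :: int assume m: "m \<in> zdual B"
    have ms: "m \<in> span B" using m zdual_subset_span by blast
    have "m + ((of_int l - m \<bullet> p) / (h \<bullet> h)) *\<^sub>R h \<in> span (insert b B)"
      by (rule span_add[OF _ span_scale[OF hs]]) (use ms sub in blast)
    moreover have "(m + ((of_int l - m \<bullet> p) / (h \<bullet> h)) *\<^sub>R h) \<bullet> x \<in> \<int>" if "x \<in> B" for x
      using m hB[OF that] that by (simp add: zdual_def inner_add_left)
    ultimately show "m + ((of_int l - m \<bullet> p) / (h \<bullet> h)) *\<^sub>R h \<in> zdual (insert b B)"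
      using inb[OF ms] by (simp add: zdual_def)
  qed
  show "(\<lambda>y. (y - ((y \<bullet> h) / (h \<bullet> h)) *\<^sub>R h, \<lfloor>y \<bullet> b\<rfloor>)) \<in> zdual (insert b B) \<rightarrow> zdual B \<times> UNIV"
  proof
    fix y assume y: "y \<in> zdual (insert b B)"
    hence "y \<in> span (insert b B)" by (simp add: zdual_def)
    then obtain k where k: "y - k *\<^sub>R b \<in> span B" using span_breakdown_eq by blast
    have "(y - k *\<^sub>R b) \<bullet> h = 0" by (rule b(3)[OF k])
    hence "y \<bullet> h = k * (h \<bullet> h)" using ph unfolding b(1) inner_diff_left inner_add_left inner_scaleR_left by simp
    hence "y - ((y \<bullet> h) / (h \<bullet> h)) *\<^sub>R h = y - k *\<^sub>R h" using hh by simp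
    also have "\<dots> = (y - k *\<^sub>R b) + k *\<^sub>R p" unfolding b(1) by (simp only: scaleR_add_right) simp
    finally have "y - ((y \<bullet> h) / (h \<bullet> h)) *\<^sub>R h \<in> span B" using span_add[OF k span_scale[OF b(2)]] by metis
    moreover have "(y - ((y \<bullet> h) / (h \<bullet> h)) *\<^sub>R h) \<bullet> x \<in> \<int>" if "x \<in> B" for x
      using y hB[OF that] that by (simp add: zdual_def inner_diff_left)
    ultimately show "(y - ((y \<bullet> h) / (h \<bullet> h)) *\<^sub>R h, \<lfloor>y \<bullet> b\<rfloor>) \<in> zdual B \<times> UNIV"
      by (simp add: zdual_def)
  qed
  fix z assume "z \<in> zdual B \<times> (UNIV::int set)"
  then obtain m l where z: "z = (m, l)" and m: "m \<in> span B" using zdual_subset_span by blast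
  have "(m + ((of_int l - m \<bullet> p) / (h \<bullet> h)) *\<^sub>R h) \<bullet> h / (h \<bullet> h) = (of_int l - m \<bullet> p) / (h \<bullet> h)"
    using b(3)[OF m] hh unfolding inner_add_left inner_scaleR_left by simp
  thus "(\<lambda>y. (y - ((y \<bullet> h) / (h \<bullet> h)) *\<^sub>R h, \<lfloor>y \<bullet> b\<rfloor>)) ((\<lambda>(m, l::int). m + ((of_int l - m \<bullet> p) / (h \<bullet> h)) *\<^sub>R h) z) = z"
    using inb[OF m, of l] hh by (auto simp add: z)
next
  fix y assume y: "y \<in> zdual (insert b B)"
  have hh: "h \<bullet> h \<noteq> 0" using h by simp
  have ph: "p \<bullet> h = 0" by (rule b(3)[OF b(2)])
  have "y \<bullet> b \<in> \<int>" using y by (simp add: zdual_def)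
  hence 1: "of_int \<lfloor>y \<bullet> b\<rfloor> = y \<bullet> b" by (auto elim: Ints_cases)
  have "h \<bullet> p = 0" using ph by (simp only: inner_commute)
  hence "(y \<bullet> b - (y - ((y \<bullet> h) / (h \<bullet> h)) *\<^sub>R h) \<bullet> p) = y \<bullet> h"
    unfolding b(1) inner_diff_left inner_add_right inner_scaleR_left by simp
  thus "(\<lambda>(m, l::int). m + ((of_int l - m \<bullet> p) / (h \<bullet> h)) *\<^sub>R h) ((\<lambda>y. (y - ((y \<bullet> h) / (h \<bullet> h)) *\<^sub>R h, \<lfloor>y \<bullet> b\<rfloor>)) y) = y"
    by (simp add: 1)
qed

text \<open>The analogue of \<open>gauss_term\<close> for a lattice, with real shift \<open>u\<close> and frequency \<open>w\<close>. With \<open>s = - \<i> * \<tau>\<close>, \<open>u = 0\<close> and \<open>w\<close> a real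
multiple of a lattice vector it is a term of a theta series.\<close>
definition lattice_term :: "complex \<Rightarrow> 'a::real_inner \<Rightarrow> 'a \<Rightarrow> 'a \<Rightarrow> complex" where
  "lattice_term s u w y = exp (- (of_real pi * s * of_real ((y + u) \<bullet> (y + u)))) * e2 (of_real ((y + u) \<bullet> w))"

lemma norm_lattice_term: "norm (lattice_term s u w y) = exp (- (pi * Re s * ((y + u) \<bullet> (y + u))))"
  by (simp add: lattice_term_def norm_mult norm_e2)

text \<open>Gaussians and characters factor along orthogonal decompositions.\<close>
lemma lattice_term_orthogonal:
  assumes "y0 \<bullet> h = 0" "u0 \<bullet> h = 0" "w0 \<bullet> h = 0"
  shows "lattice_term s (u0 + \<beta> *\<^sub>R h) (w0 + \<gamma> *\<^sub>R h) (y0 + c *\<^sub>R h) =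
         lattice_term s u0 w0 y0 * (exp (- (of_real pi * s * of_real ((h \<bullet> h) * (c + \<beta>)\<^sup>2))) * e2 (of_real ((c + \<beta>) * (\<gamma> * (h \<bullet> h)))))"
proof -
  have sum: "y0 + c *\<^sub>R h + (u0 + \<beta> *\<^sub>R h) = (y0 + u0) + (c + \<beta>) *\<^sub>R h" by (simp add: algebra_simps)
  have z: "h \<bullet> y0 = 0" "h \<bullet> u0 = 0" "h \<bullet> w0 = 0" using assms by (simp_all add: inner_commute)
  have sq: "((y0 + u0) + (c + \<beta>) *\<^sub>R h) \<bullet> ((y0 + u0) + (c + \<beta>) *\<^sub>R h) = (y0 + u0) \<bullet> (y0 + u0) + (h \<bullet> h) * (c + \<beta>)\<^sup>2"
    using assms z by (simp add: inner_add_left inner_add_right power2_eq_square algebra_simps)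
  have li: "((y0 + u0) + (c + \<beta>) *\<^sub>R h) \<bullet> (w0 + \<gamma> *\<^sub>R h) = (y0 + u0) \<bullet> w0 + (c + \<beta>) * (\<gamma> * (h \<bullet> h))"
    using assms z by (simp add: inner_add_left inner_add_right algebra_simps)
  show ?thesis unfolding lattice_term_def sum sq li of_real_add e2_add ring_distribs minus_add_distrib exp_add by (simp only: mult_ac)
qed

lemma gauss_term_e2: "gauss_term s a b j = exp (- (of_real pi * s * of_real ((of_int j + a)\<^sup>2))) * e2 (of_real ((of_int j + a) * b))"
  unfolding gauss_term_def exp_add e2_def by simp

text \<open>The absolute values form a Gaussian sum with real width; on its transformed side the shift enters through phases only.\<close>
lemma gauss_norm_sum_bound:
  assumes "Re s > 0"
  shows "\<exists>K. \<forall>a b. infsum (\<lambda>j. norm (gauss_term s a b j)) UNIV \<le> K"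
proof (intro exI allI)
  fix a b
  let ?\<sigma> = "of_real (Re s) :: complex"
  have r: "Re (1 / ?\<sigma>) > 0" using assms by (simp add: Re_divide)
  have eq: "gauss_term ?\<sigma> a 0 j = of_real (norm (gauss_term s a b j))" for j
    unfolding norm_gauss_term by (simp add: gauss_term_e2 exp_of_real[symmetric])
  have "of_real (infsum (\<lambda>j. norm (gauss_term s a b j)) UNIV) = infsum (gauss_term ?\<sigma> a 0) UNIV"
    unfolding eq by (rule infsumI[OF has_sum_of_real[OF has_sum_infsum], symmetric]) (rule gauss_term_abs_summable[OF assms])
  also have "\<dots> = 1 / csqrt ?\<sigma> * infsum (gauss_term (1 / ?\<sigma>) 0 a) UNIV"
    using gauss_poisson[of ?\<sigma> a 0] assms by simp
  finally have "norm (of_real (infsum (\<lambda>j. norm (gauss_term s a b j)) UNIV) :: complex) \<le> norm (1 / csqrt ?\<sigma>) * infsum (\<lambda>l. norm (gauss_term (1 / ?\<sigma>) 0 a l)) UNIV"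
    using infsum_complex_norm[OF gauss_term_summable[OF r, of 0 a]] by (simp only: norm_mult) (rule mult_left_mono, auto)
  also have "(\<lambda>l. norm (gauss_term (1 / ?\<sigma>) 0 a l)) = (\<lambda>l. norm (gauss_term (1 / ?\<sigma>) 0 0 l))"
    unfolding norm_gauss_term ..
  finally show "infsum (\<lambda>j. norm (gauss_term s a b j)) UNIV \<le> norm (1 / csqrt ?\<sigma>) * infsum (\<lambda>l. norm (gauss_term (1 / ?\<sigma>) 0 0 l)) UNIV"
    by (simp add: infsum_nonneg)
qed

text \<open>Poisson summation for the lattice spanned by \<open>B\<close>, where \<open>V\<close> is its covolume. Summability is part of the statement, because
the induction on \<open>B\<close> exchanges sums.\<close>
definition lattice_poisson :: "'a::real_inner set \<Rightarrow> real \<Rightarrow> bool" where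
  "lattice_poisson B V \<longleftrightarrow> V > 0 \<and> (\<forall>s. Re s > 0 \<longrightarrow> (\<forall>u\<in>span B. \<forall>w\<in>span B.
      lattice_term s u w summable_on zspan B \<and> lattice_term s u w summable_on zdual B \<and>
      infsum (lattice_term s u w) (zspan B) =
        e2 (of_real (u \<bullet> w)) / (of_real V * csqrt s ^ card B) * infsum (lattice_term (1 / s) (- w) u) (zdual B)))"

lemma lattice_poissonD:
  assumes "lattice_poisson B V" "Re s > 0" "u \<in> span B" "w \<in> span B"
  shows "lattice_term s u w summable_on zspan B" "lattice_term s u w summable_on zdual B"
      "infsum (lattice_term s u w) (zspan B) =
        e2 (of_real (u \<bullet> w)) / (of_real V * csqrt s ^ card B) * infsum (lattice_term (1 / s) (- w) u) (zdual B)"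
  using assms unfolding lattice_poisson_def by blast+

text \<open>As for \<open>gauss_norm_sum_bound\<close>, the bound is read off the transformed side.\<close>
lemma lattice_norm_sum_bound:
  assumes P: "lattice_poisson B V" and s: "Re s > 0"
  shows "\<exists>K. \<forall>u\<in>span B. \<forall>w\<in>span B. infsum (\<lambda>y. norm (lattice_term s u w y)) (zspan B) \<le> K"
proof (intro exI ballI)
  fix u w assume u: "u \<in> span B" and w: "w \<in> span B"
  let ?\<sigma> = "of_real (Re s) :: complex"
  have s': "Re ?\<sigma> > 0" using s by simp
  have r: "Re (1 / ?\<sigma>) > 0" by (rule inverse_Re_pos[OF s'])
  have eq: "lattice_term ?\<sigma> u 0 y = of_real (norm (lattice_term s u w y))" for y
    unfolding norm_lattice_term by (simp add: lattice_term_def exp_of_real[symmetric])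
  have ns: "(\<lambda>y. norm (lattice_term s u w y)) summable_on zspan B"
    using lattice_poissonD(1)[OF P s u w] by (simp only: summable_on_iff_abs_summable_on_complex)
  have "of_real (infsum (\<lambda>y. norm (lattice_term s u w y)) (zspan B)) = infsum (lattice_term ?\<sigma> u 0) (zspan B)"
    unfolding eq by (rule infsumI[OF has_sum_of_real[OF has_sum_infsum[OF ns]], symmetric])
  also have "\<dots> = 1 / (of_real V * csqrt ?\<sigma> ^ card B) * infsum (lattice_term (1 / ?\<sigma>) 0 u) (zdual B)"
    using lattice_poissonD(3)[OF P s' u span_zero] by simp
  finally have "norm (of_real (infsum (\<lambda>y. norm (lattice_term s u w y)) (zspan B)) :: complex) \<le>
      norm (1 / (of_real V * csqrt ?\<sigma> ^ card B)) * infsum (\<lambda>l. norm (lattice_term (1 / ?\<sigma>) 0 u l)) (zdual B)"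
    using infsum_complex_norm[OF lattice_poissonD(2)[OF P r span_zero u]] by (simp only: norm_mult) (rule mult_left_mono, auto)
  also have "(\<lambda>l. norm (lattice_term (1 / ?\<sigma>) 0 u l)) = (\<lambda>l. norm (lattice_term (1 / ?\<sigma>) 0 0 l))"
    unfolding norm_lattice_term ..
  finally show "infsum (\<lambda>y. norm (lattice_term s u w y)) (zspan B) \<le>
      norm (1 / (of_real V * csqrt ?\<sigma> ^ card B)) * infsum (\<lambda>l. norm (lattice_term (1 / ?\<sigma>) 0 0 l)) (zdual B)"
    by (simp add: infsum_nonneg)
qed

lemma gauss_term_shift_b: "gauss_term s a b j * e2 (of_real (of_int j * \<mu>)) = e2 (of_real (- (a * \<mu>))) * gauss_term s a (b + \<mu>) j"
proof -
  have "e2 (of_real ((of_int j + a) * b)) * e2 (of_real (of_int j * \<mu>)) = e2 (of_real (- (a * \<mu>))) * e2 (of_real ((of_int j + a) * (b + \<mu>)))"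
    unfolding e2_add[symmetric] of_real_add[symmetric] by (rule arg_cong[of _ _ "\<lambda>x. e2 (of_real x)"]) (simp add: algebra_simps)
  thus ?thesis unfolding gauss_term_e2 by (simp add: mult_ac)
qed

lemma csqrt_mult_pos: "H > 0 \<Longrightarrow> Re s > 0 \<Longrightarrow> csqrt (s * of_real H) = csqrt s * of_real (sqrt H)"
proof (rule csqrt_unique)
  assume "H > 0" "Re s > 0"
  have r: "Re (csqrt s) > 0" using \<open>Re s > 0\<close> csqrt_principal[of s]
    by (smt (verit) csqrt_of_real_nonpos complex_eq_iff Re_csqrt power2_csqrt power2_eq_square times_complex.simps(1) mult_nonneg_nonneg zero_le_square mult_eq_0_iff)
  show "(csqrt s * of_real (sqrt H))\<^sup>2 = s * of_real H"
    using \<open>H > 0\<close> by (simp add: power_mult_distrib flip: of_real_power)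
  show "0 < Re (csqrt s * of_real (sqrt H)) \<or> Re (csqrt s * of_real (sqrt H)) = 0 \<and> 0 \<le> Im (csqrt s * of_real (sqrt H))"
    using r \<open>H > 0\<close> by simp
qed

text \<open>Write \<open>b = p + h\<close> with \<open>h\<close> orthogonal to the span of \<open>B\<close>. For fixed multiple \<open>j * b\<close>, the sum over the old lattice is shifted by
\<open>j * p\<close> and is transformed by the hypothesis; the shift becomes a character in \<open>j\<close>. The
remaining sum over \<open>j\<close> is a one-dimensional Gaussian sum with width \<open>s * (h \<bullet> h)\<close>, whose frequency depends on the
dual vector \<open>m\<close> through \<open>m \<bullet> p\<close>. The covolume is multiplied by the length of \<open>h\<close>.\<close>
lemma lattice_poisson_insert:
  fixes B :: "'a::real_inner set"
  assumes P: "lattice_poisson B V" and fin: "finite B" and b: "b \<notin> span B"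
  shows "\<exists>V'. lattice_poisson (insert b B) V'"
proof -
  obtain p where p: "p \<in> span B" "\<And>x. x \<in> span B \<Longrightarrow> x \<bullet> (b - p) = 0"
    using orthogonal_projection_exists[OF fin, of b] by blast
  define h where "h = b - p"
  have bph: "b = p + h" by (simp add: h_def)
  have orth: "x \<bullet> h = 0" if "x \<in> span B" for x using p(2)[OF that] by (simp add: h_def)
  have h0: "h \<noteq> 0" using b p(1) by (auto simp: h_def)
  define H where "H = h \<bullet> h"
  have H: "H > 0" using h0 by (simp add: H_def)
  have V: "V > 0" using P by (simp add: lattice_poisson_def)
  have bB: "b \<notin> B" using b span_base by blast
  have dec: "\<exists>x0 k. x0 \<in> span B \<and> x = x0 + k *\<^sub>R h" if "x \<in> span (insert b B)" for x
  proof -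
    obtain k where k: "x - k *\<^sub>R b \<in> span B" using \<open>x \<in> _\<close> span_breakdown_eq by blast
    have "x = (x - k *\<^sub>R b + k *\<^sub>R p) + k *\<^sub>R h" by (simp add: h_def algebra_simps)
    moreover have "x - k *\<^sub>R b + k *\<^sub>R p \<in> span B" by (rule span_add[OF k span_scale[OF p(1)]])
    ultimately show ?thesis by blast
  qed
  have dual_term: "lattice_term t (u0 + \<beta> *\<^sub>R h) (w0 + \<gamma> *\<^sub>R h) (m + ((of_int l - m \<bullet> p) / (h \<bullet> h)) *\<^sub>R h) =
          lattice_term t u0 w0 m * gauss_term (t / of_real H) (\<beta> * H - m \<bullet> p) \<gamma> l"
    if "m \<in> span B" "u0 \<in> span B" "w0 \<in> span B" for t u0 w0 \<beta> \<gamma> m and l :: int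
  proof -
    have hh: "h \<bullet> h = H" by (simp add: H_def)
    have a: "(of_int l - m \<bullet> p) / H + \<beta> = (of_int l + (\<beta> * H - m \<bullet> p)) / H"
      using H by (simp add: field_simps)
    have 1: "H * ((of_int l - m \<bullet> p) / H + \<beta>)\<^sup>2 = (of_int l + (\<beta> * H - m \<bullet> p))\<^sup>2 / H"
      unfolding a using H by (simp add: power_divide power2_eq_square)
    have 2: "((of_int l - m \<bullet> p) / H + \<beta>) * (\<gamma> * H) = (of_int l + (\<beta> * H - m \<bullet> p)) * \<gamma>"
      unfolding a using H by simp
    show ?thesis
      unfolding lattice_term_orthogonal[OF orth[OF that(1)] orth[OF that(2)] orth[OF that(3)]] gauss_term_e2 hh 1 2
      by (simp add: of_real_divide)
  qed
  have bijd: "bij_betw (\<lambda>(m, l::int). m + ((of_int l - m \<bullet> p) / (h \<bullet> h)) *\<^sub>R h) (zdual B \<times> UNIV) (zdual (insert b B))"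
    by (rule bij_betw_zdual_insert[OF bph p(1) orth h0])
  have dual_summable: "lattice_term t u w summable_on zdual (insert b B)"
    if t: "Re t > 0" and "u \<in> span (insert b B)" and "w \<in> span (insert b B)" for t u w
  proof -
    obtain u0 \<beta> where u: "u0 \<in> span B" "u = u0 + \<beta> *\<^sub>R h" using dec[OF \<open>u \<in> _\<close>] by blast
    obtain w0 \<gamma> where w: "w0 \<in> span B" "w = w0 + \<gamma> *\<^sub>R h" using dec[OF \<open>w \<in> _\<close>] by blast
    have tH: "Re (t / of_real H) > 0" using t H by simp
    obtain K where K: "\<And>a b. infsum (\<lambda>j. norm (gauss_term (t / of_real H) a b j)) UNIV \<le> K"
      using gauss_norm_sum_bound[OF tH] by blast
    define F where "F = (\<lambda>(m, l). lattice_term t u0 w0 m * gauss_term (t / of_real H) (\<beta> * H - m \<bullet> p) \<gamma> l)"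
    have n: "(\<lambda>m. norm (lattice_term t u0 w0 m)) summable_on zdual B"
      using lattice_poissonD(2)[OF P t u(1) w(1)] by (simp only: summable_on_iff_abs_summable_on_complex)
    have "F summable_on zdual B \<times> UNIV"
    proof (rule summable_on_times_bound)
      show "(\<lambda>m. norm (lattice_term t u0 w0 m) * K) summable_on zdual B"
        by (intro summable_on_cmult_left n)
      fix m
      show "(\<lambda>l. norm (F (m, l))) summable_on UNIV"
        unfolding F_def prod.case norm_mult by (intro summable_on_cmult_right gauss_term_abs_summable tH)
      show "infsum (\<lambda>l. norm (F (m, l))) UNIV \<le> norm (lattice_term t u0 w0 m) * K"
        unfolding F_def prod.case norm_mult infsum_cmult_right' by (intro mult_left_mono K) auto
    qed
    moreover have "lattice_term t u w ((\<lambda>(m, l::int). m + ((of_int l - m \<bullet> p) / (h \<bullet> h)) *\<^sub>R h) z) = F z"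
      if zz: "z \<in> zdual B \<times> UNIV" for z
    proof -
      obtain m l where z: "z = (m, l)" "m \<in> span B" using zz zdual_subset_span by blast
      show ?thesis unfolding z prod.case F_def u(2) w(2) by (rule dual_term[OF z(2) u(1) w(1)])
    qed
    ultimately show ?thesis
      using summable_on_reindex_bij_betw[OF bijd, of "lattice_term t u w"] by (metis (mono_tags, lifting) summable_on_cong)
  qed
  have main: "lattice_term s u w summable_on zspan (insert b B) \<and> lattice_term s u w summable_on zdual (insert b B) \<and>
      infsum (lattice_term s u w) (zspan (insert b B)) =
        e2 (of_real (u \<bullet> w)) / (of_real (V * sqrt H) * csqrt s ^ card (insert b B)) * infsum (lattice_term (1 / s) (- w) u) (zdual (insert b B))"
    if s: "Re s > 0" and "u \<in> span (insert b B)" and "w \<in> span (insert b B)" for s u w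
  proof -
    obtain u0 \<beta> where u: "u0 \<in> span B" "u = u0 + \<beta> *\<^sub>R h" using dec[OF \<open>u \<in> _\<close>] by blast
    obtain w0 \<gamma> where w: "w0 \<in> span B" "w = w0 + \<gamma> *\<^sub>R h" using dec[OF \<open>w \<in> _\<close>] by blast
    have mw0: "- w0 \<in> span B" by (rule span_neg[OF w(1)])
    define S where "S = s * of_real H"
    have S: "Re S > 0" using s H by (simp add: S_def)
    have s': "Re (1 / s) > 0" by (rule inverse_Re_pos[OF s])
    have S': "Re (1 / S) > 0" by (rule inverse_Re_pos[OF S])
    obtain K where K: "\<And>u w. u \<in> span B \<Longrightarrow> w \<in> span B \<Longrightarrow> infsum (\<lambda>y. norm (lattice_term s u w y)) (zspan B) \<le> K"
      using lattice_norm_sum_bound[OF P s] by blast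

    have prim: "lattice_term s u w (y + of_int j *\<^sub>R b) = lattice_term s (of_int j *\<^sub>R p + u0) w0 y * gauss_term S \<beta> (\<gamma> * H) j"
      if y: "y \<in> zspan B" for y and j :: int
    proof -
      have ys: "y + of_int j *\<^sub>R p \<in> span B"
        using y zspan_subset_span by (intro span_add span_scale p(1)) blast
      have e: "y + of_int j *\<^sub>R b = (y + of_int j *\<^sub>R p) + of_int j *\<^sub>R h" by (simp add: bph algebra_simps)
      show ?thesis unfolding e u(2) w(2) lattice_term_orthogonal[OF orth[OF ys] orth[OF u(1)] orth[OF w(1)]]
        by (simp add: lattice_term_def gauss_term_e2 S_def H_def add_ac mult_ac)
    qed
    define F where "F = (\<lambda>(j::int, y). lattice_term s (of_int j *\<^sub>R p + u0) w0 y * gauss_term S \<beta> (\<gamma> * H) j)"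
    have jp: "of_int j *\<^sub>R p + u0 \<in> span B" for j :: int by (intro span_add span_scale p(1) u(1))
    have Fs: "F summable_on UNIV \<times> zspan B"
    proof (rule summable_on_times_bound)
      show "(\<lambda>j. K * norm (gauss_term S \<beta> (\<gamma> * H) j)) summable_on UNIV"
        by (intro summable_on_cmult_right gauss_term_abs_summable S)
      fix j :: int
      have n: "(\<lambda>y. norm (lattice_term s (of_int j *\<^sub>R p + u0) w0 y)) summable_on zspan B"
        using lattice_poissonD(1)[OF P s jp w(1)] by (simp only: summable_on_iff_abs_summable_on_complex)
      show "(\<lambda>y. norm (F (j, y))) summable_on zspan B"
        unfolding F_def prod.case norm_mult by (intro summable_on_cmult_left n)
      show "infsum (\<lambda>y. norm (F (j, y))) (zspan B) \<le> K * norm (gauss_term S \<beta> (\<gamma> * H) j)"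
        unfolding F_def prod.case norm_mult infsum_cmult_left' by (intro mult_right_mono K jp w(1)) auto
    qed
    have bij: "bij_betw (\<lambda>(j, y). y + of_int j *\<^sub>R b) (UNIV \<times> zspan B) (zspan (insert b B))"
    proof -
      have "bij_betw prod.swap (UNIV \<times> zspan B) (zspan B \<times> (UNIV :: int set))"
        by (rule bij_betwI[of _ _ _ prod.swap]) auto
      from bij_betw_trans[OF this bij_betw_zspan_insert[OF fin b]] show ?thesis
        by (simp add: o_def case_prod_unfold)
    qed
    have Feq: "lattice_term s u w ((\<lambda>(j, y). y + of_int j *\<^sub>R b) z) = F z" if "z \<in> UNIV \<times> zspan B" for z
      using that prim by (auto simp: F_def)
    have sum1: "lattice_term s u w summable_on zspan (insert b B)"
      using Fs summable_on_reindex_bij_betw[OF bij, of "lattice_term s u w"] Feq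
      by (metis (mono_tags, lifting) summable_on_cong)
    have "infsum (lattice_term s u w) (zspan (insert b B)) = infsum F (UNIV \<times> zspan B)"
      unfolding infsum_reindex_bij_betw[OF bij, symmetric] by (intro infsum_cong Feq)
    also have "\<dots> = infsum (\<lambda>j. infsum (\<lambda>y. F (j, y)) (zspan B)) UNIV"
      by (rule infsum_Sigma_banach[OF Fs, symmetric])
    also have "\<dots> = infsum (\<lambda>j. infsum (\<lambda>m. e2 (of_real (u0 \<bullet> w0)) / (of_real V * csqrt s ^ card B) *
        (lattice_term (1 / s) (- w0) u0 m * (gauss_term S \<beta> (\<gamma> * H) j * e2 (of_real (of_int j * (m \<bullet> p)))))) (zdual B)) UNIV"
    proof (rule infsum_cong)
      fix j :: int
      have e: "e2 (of_real ((of_int j *\<^sub>R p + u0) \<bullet> w0)) * lattice_term (1 / s) (- w0) (of_int j *\<^sub>R p + u0) m =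
          e2 (of_real (u0 \<bullet> w0)) * (lattice_term (1 / s) (- w0) u0 m * e2 (of_real (of_int j * (m \<bullet> p))))" for m
      proof -
        have "e2 (of_real ((of_int j *\<^sub>R p + u0) \<bullet> w0)) * e2 (of_real ((m + - w0) \<bullet> (of_int j *\<^sub>R p + u0))) =
             e2 (of_real (u0 \<bullet> w0)) * (e2 (of_real ((m + - w0) \<bullet> u0)) * e2 (of_real (of_int j * (m \<bullet> p))))"
          unfolding e2_add[symmetric] of_real_add[symmetric]
          by (rule arg_cong[of _ _ "\<lambda>x. e2 (of_real x)"])
             (simp add: inner_add_left inner_add_right inner_diff_left algebra_simps inner_commute[of w0 p])
        moreover have "x1 * (g * x2) = x3 * ((g * x4) * x5)" if "x1 * x2 = x3 * (x4 * x5)" for x1 x2 x3 x4 x5 g :: complex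
          using that by algebra
        ultimately show ?thesis unfolding lattice_term_def by blast
      qed
      have "infsum (\<lambda>y. F (j, y)) (zspan B) = infsum (lattice_term s (of_int j *\<^sub>R p + u0) w0) (zspan B) * gauss_term S \<beta> (\<gamma> * H) j"
        unfolding F_def prod.case infsum_cmult_left' ..
      also have "\<dots> = infsum (\<lambda>m. 1 / (of_real V * csqrt s ^ card B) *
          (e2 (of_real ((of_int j *\<^sub>R p + u0) \<bullet> w0)) * lattice_term (1 / s) (- w0) (of_int j *\<^sub>R p + u0) m) * gauss_term S \<beta> (\<gamma> * H) j) (zdual B)"
        unfolding lattice_poissonD(3)[OF P s jp w(1)] infsum_cmult_left' infsum_cmult_right' by simp
      also have "\<dots> = infsum (\<lambda>m. e2 (of_real (u0 \<bullet> w0)) / (of_real V * csqrt s ^ card B) *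
        (lattice_term (1 / s) (- w0) u0 m * (gauss_term S \<beta> (\<gamma> * H) j * e2 (of_real (of_int j * (m \<bullet> p)))))) (zdual B)"
        unfolding e by (simp add: mult_ac)
      finally show "infsum (\<lambda>y. F (j, y)) (zspan B) = \<dots>" .
    qed
    also have "\<dots> = infsum (\<lambda>m. infsum (\<lambda>j. e2 (of_real (u0 \<bullet> w0)) / (of_real V * csqrt s ^ card B) *
        (lattice_term (1 / s) (- w0) u0 m * (gauss_term S \<beta> (\<gamma> * H) j * e2 (of_real (of_int j * (m \<bullet> p)))))) UNIV) (zdual B)"
    proof (rule infsum_swap_banach)
      let ?f = "\<lambda>(j::int, m). e2 (of_real (u0 \<bullet> w0)) / (of_real V * csqrt s ^ card B) *
        (lattice_term (1 / s) (- w0) u0 m * (gauss_term S \<beta> (\<gamma> * H) j * e2 (of_real (of_int j * (m \<bullet> p)))))"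
      have n: "(\<lambda>m. norm (lattice_term (1 / s) (- w0) u0 m)) summable_on zdual B"
        using lattice_poissonD(2)[OF P s' mw0 u(1)] by (simp only: summable_on_iff_abs_summable_on_complex)
      have nf: "norm (?f (j, m)) = norm (e2 (of_real (u0 \<bullet> w0)) / (of_real V * csqrt s ^ card B)) *
          (norm (lattice_term (1 / s) (- w0) u0 m) * norm (gauss_term S \<beta> (\<gamma> * H) j))" for j m
        by (simp only: prod.case norm_mult[of "gauss_term S \<beta> (\<gamma> * H) j"] norm_mult[of _ "_ * (_ * _)"] norm_mult[of "lattice_term (1 / s) (- w0) u0 m"]
            norm_e2 Im_complex_of_real mult_zero_right minus_zero exp_zero mult_1_right)
      show "?f summable_on UNIV \<times> zdual B"
      proof (rule summable_on_times_bound)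
        show "(\<lambda>j. norm (e2 (of_real (u0 \<bullet> w0)) / (of_real V * csqrt s ^ card B)) *
            (infsum (\<lambda>m. norm (lattice_term (1 / s) (- w0) u0 m)) (zdual B) * norm (gauss_term S \<beta> (\<gamma> * H) j))) summable_on UNIV"
          by (intro summable_on_cmult_right gauss_term_abs_summable S)
        fix j :: int
        show "(\<lambda>m. norm (?f (j, m))) summable_on zdual B" unfolding nf
          by (intro summable_on_cmult_right summable_on_cmult_left n)
        show "infsum (\<lambda>m. norm (?f (j, m))) (zdual B) \<le> norm (e2 (of_real (u0 \<bullet> w0)) / (of_real V * csqrt s ^ card B)) *
            (infsum (\<lambda>m. norm (lattice_term (1 / s) (- w0) u0 m)) (zdual B) * norm (gauss_term S \<beta> (\<gamma> * H) j))"
          unfolding nf infsum_cmult_left' infsum_cmult_right' ..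
      qed
    qed
    also have "\<dots> = infsum (\<lambda>m. infsum (\<lambda>l::int. e2 (of_real (u \<bullet> w)) / (of_real (V * sqrt H) * csqrt s ^ card (insert b B)) *
        lattice_term (1 / s) (- w) u (m + ((of_int l - m \<bullet> p) / (h \<bullet> h)) *\<^sub>R h)) UNIV) (zdual B)"
    proof (rule infsum_cong)
      fix m assume m: "m \<in> zdual B"
      define \<mu> where "\<mu> = m \<bullet> p"
      have ms: "m \<in> span B" using m zdual_subset_span by blast
      have uw: "u \<bullet> w = u0 \<bullet> w0 + \<beta> * (\<gamma> * H)"
        using orth[OF u(1)] orth[OF w(1)] by (simp add: u(2) w(2) H_def inner_add_left inner_add_right inner_commute)
      have dual: "lattice_term (1 / s) (- w) u (m + ((of_int l - \<mu>) / (h \<bullet> h)) *\<^sub>R h) =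
          lattice_term (1 / s) (- w0) u0 m * gauss_term (1 / S) (- (\<gamma> * H + \<mu>)) \<beta> l" for l :: int
      proof -
        have mw: "- w = - w0 + (- \<gamma>) *\<^sub>R h" by (simp add: w(2))
        have S1: "1 / s / of_real H = 1 / S" by (simp add: S_def)
        have ar: "- \<gamma> * H - m \<bullet> p = - (\<gamma> * H + \<mu>)" by (simp add: \<mu>_def)
        show ?thesis
          using dual_term[OF ms mw0 u(1), of "1 / s" "- \<gamma>" \<beta> l] unfolding mw u(2) S1 ar \<mu>_def .
      qed
      have g: "infsum (\<lambda>j. gauss_term S \<beta> (\<gamma> * H) j * e2 (of_real (of_int j * \<mu>))) UNIV =
          e2 (of_real (\<beta> * (\<gamma> * H))) / csqrt S * infsum (gauss_term (1 / S) (- (\<gamma> * H + \<mu>)) \<beta>) UNIV"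
      proof -
        have "e2 (of_real (- (\<beta> * \<mu>))) * e2 (of_real (\<beta> * (\<gamma> * H + \<mu>))) = e2 (of_real (\<beta> * (\<gamma> * H)))"
          unfolding e2_add[symmetric] of_real_add[symmetric]
          by (rule arg_cong[of _ _ "\<lambda>x. e2 (of_real x)"]) (simp add: algebra_simps)
        moreover have "x1 * (x2 / c * y) = x3 / c * y" if "x1 * x2 = x3" for x1 x2 x3 c y :: complex
          unfolding that[symmetric] by simp
        ultimately show ?thesis unfolding gauss_term_shift_b infsum_cmult_right' gauss_poisson[OF S] by blast
      qed
      have c: "of_real (V * sqrt H) * csqrt s ^ card (insert b B) = of_real V * csqrt s ^ card B * csqrt S"
        unfolding S_def csqrt_mult_pos[OF H s] using fin bB by simp
      have "infsum (\<lambda>j. e2 (of_real (u0 \<bullet> w0)) / (of_real V * csqrt s ^ card B) *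
        (lattice_term (1 / s) (- w0) u0 m * (gauss_term S \<beta> (\<gamma> * H) j * e2 (of_real (of_int j * \<mu>))))) UNIV =
        e2 (of_real (u0 \<bullet> w0)) / (of_real V * csqrt s ^ card B) * (lattice_term (1 / s) (- w0) u0 m *
          (e2 (of_real (\<beta> * (\<gamma> * H))) / csqrt S * infsum (gauss_term (1 / S) (- (\<gamma> * H + \<mu>)) \<beta>) UNIV))"
        by (simp only: infsum_cmult_right' g)
      also have "\<dots> = e2 (of_real (u \<bullet> w)) / (of_real V * csqrt s ^ card B * csqrt S) * (lattice_term (1 / s) (- w0) u0 m *
          infsum (gauss_term (1 / S) (- (\<gamma> * H + \<mu>)) \<beta>) UNIV)"
        unfolding uw of_real_add e2_add by simp
      finally show "infsum (\<lambda>j. e2 (of_real (u0 \<bullet> w0)) / (of_real V * csqrt s ^ card B) *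
        (lattice_term (1 / s) (- w0) u0 m * (gauss_term S \<beta> (\<gamma> * H) j * e2 (of_real (of_int j * (m \<bullet> p)))))) UNIV =
         infsum (\<lambda>l::int. e2 (of_real (u \<bullet> w)) / (of_real (V * sqrt H) * csqrt s ^ card (insert b B)) *
        lattice_term (1 / s) (- w) u (m + ((of_int l - m \<bullet> p) / (h \<bullet> h)) *\<^sub>R h)) UNIV"
        unfolding c \<mu>_def[symmetric] dual infsum_cmult_right' .
    qed
    also have "\<dots> = e2 (of_real (u \<bullet> w)) / (of_real (V * sqrt H) * csqrt s ^ card (insert b B)) *
        infsum (\<lambda>m. infsum (\<lambda>l::int. lattice_term (1 / s) (- w) u (m + ((of_int l - m \<bullet> p) / (h \<bullet> h)) *\<^sub>R h)) UNIV) (zdual B)"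
      unfolding infsum_cmult_right' ..
    finally have A: "infsum (lattice_term s u w) (zspan (insert b B)) = \<dots>" .

    have mws: "- w \<in> span (insert b B)" by (rule span_neg[OF \<open>w \<in> span (insert b B)\<close>])
    have "infsum (lattice_term (1 / s) (- w) u) (zdual (insert b B)) =
        infsum (\<lambda>z. lattice_term (1 / s) (- w) u ((\<lambda>(m, l::int). m + ((of_int l - m \<bullet> p) / (h \<bullet> h)) *\<^sub>R h) z)) (zdual B \<times> UNIV)"
      by (rule infsum_reindex_bij_betw[OF bijd, symmetric])
    also have "\<dots> = infsum (\<lambda>m. infsum (\<lambda>l::int. lattice_term (1 / s) (- w) u (m + ((of_int l - m \<bullet> p) / (h \<bullet> h)) *\<^sub>R h)) UNIV) (zdual B)"
      using summable_on_reindex_bij_betw[OF bijd, of "lattice_term (1 / s) (- w) u"] dual_summable[OF s' mws \<open>u \<in> span (insert b B)\<close>]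
      by (subst infsum_Sigma_banach[symmetric]) auto
    finally have B: "infsum (lattice_term (1 / s) (- w) u) (zdual (insert b B)) = \<dots>" .
    show ?thesis using sum1 dual_summable[OF s \<open>u \<in> span (insert b B)\<close> \<open>w \<in> span (insert b B)\<close>] A unfolding B by blast
  qed
  have "V * sqrt H > 0" using V H by simp
  hence "lattice_poisson (insert b B) (V * sqrt H)" unfolding lattice_poisson_def using main by blast
  thus ?thesis ..
qed

lemma lattice_poisson_exists:
  fixes B :: "'a::real_inner set"
  assumes "finite B" "independent B"
  shows "\<exists>V. lattice_poisson B V"
  using assms
proof (induction B rule: finite_induct)
  case empty
  have "zspan {} = {0::'a}" "zdual {} = {0::'a}" by (auto simp: zspan_def zdual_def)
  hence "lattice_poisson ({}::'a set) 1" by (simp add: lattice_poisson_def lattice_term_def)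
  thus ?case ..
next
  case (insert b B)
  have "independent B" "b \<notin> span B" using insert.prems insert.hyps
    by (auto simp: independent_insert)
  with insert.IH insert.hyps lattice_poisson_insert show ?case by blast
qed

text \<open>For a self-dual lattice the covolume is 1: at \<open>s = 1\<close> both sides of the formula contain the same positive sum. The last part
bounds the sum of the absolute values uniformly in the shift and the frequency.\<close>
theorem unimodular_poisson:
  fixes L :: "'a::real_inner set"
  assumes L: "even_unimodular n L"
  shows "Re s > 0 \<Longrightarrow> u \<in> L \<Longrightarrow> w \<in> L \<Longrightarrow> lattice_term s (a *\<^sub>R u) (c *\<^sub>R w) summable_on L"
    and "Re s > 0 \<Longrightarrow> w \<in> L \<Longrightarrow>
           infsum (lattice_term s 0 (c *\<^sub>R w)) L = 1 / csqrt s ^ n * infsum (lattice_term (1 / s) (- (c *\<^sub>R w)) 0) L"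
    and "0 \<in> L"
    and "Re s > 0 \<Longrightarrow> \<exists>K. \<forall>u\<in>L. \<forall>w\<in>L. \<forall>a c. infsum (\<lambda>y. norm (lattice_term s (a *\<^sub>R u) (c *\<^sub>R w) y)) L \<le> K"
proof -
  obtain B where B: "finite B" "card B = n" "independent B" "L = zspan B"
    using L unfolding even_unimodular_def lattice_of_rank_def zspan_def by blast
  have dual: "zdual B = L" using L dual_lattice_zspan[OF B(1)] B(4) by (simp add: even_unimodular_def)
  obtain V where V: "lattice_poisson B V" using lattice_poisson_exists[OF B(1,3)] by blast
  have sub: "L \<subseteq> span B" using zspan_subset_span B(4) by blast
  show 0: "0 \<in> L" unfolding B(4) zspan_def by (rule CollectI, rule exI[of _ "\<lambda>_. 0"]) simp
  have "(infsum (lattice_term 1 0 0) L :: complex) = 1 / of_real V * infsum (lattice_term 1 0 0) L"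
    using lattice_poissonD(3)[OF V, of 1 0 0] dual B(4) by (simp add: span_zero)
  moreover have "infsum (lattice_term 1 0 0) L \<noteq> 0"
  proof -
    define f where "f = (\<lambda>y::'a. exp (- (pi * (y \<bullet> y))))"
    have eq: "lattice_term 1 0 0 y = of_real (f y)" for y by (simp add: lattice_term_def f_def exp_of_real[symmetric])
    have "lattice_term 1 0 0 summable_on L" using lattice_poissonD(1)[OF V, of 1 0 0] B(4) by (simp add: span_zero)
    hence fs: "f summable_on L" unfolding eq by (simp add: summable_on_iff_abs_summable_on_complex f_def)
    have "sum f {0} \<le> infsum f L" using fs 0 by (intro finite_sum_le_infsum) (auto simp: f_def)
    moreover have "infsum (lattice_term 1 0 0) L = of_real (infsum f L)"
      unfolding eq by (rule infsumI[OF has_sum_of_real[OF has_sum_infsum[OF fs]]])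
    ultimately show ?thesis by (auto simp: f_def)
  qed
  moreover have "V > 0" using V by (simp add: lattice_poisson_def)
  ultimately have "of_real V = (1::complex)" by (auto simp: field_simps)
  hence "V = 1" by (simp only: of_real_eq_1_iff)
  thus "infsum (lattice_term s 0 (c *\<^sub>R w)) L = 1 / csqrt s ^ n * infsum (lattice_term (1 / s) (- (c *\<^sub>R w)) 0) L"
    if "Re s > 0" "w \<in> L"
    using lattice_poissonD(3)[OF V that(1) span_zero span_scale] that(2) sub dual B by auto
  show "lattice_term s (a *\<^sub>R u) (c *\<^sub>R w) summable_on L" if "Re s > 0" "u \<in> L" "w \<in> L"
    using lattice_poissonD(1)[OF V that(1) span_scale span_scale] that sub B(4) by blast
  show "\<exists>K. \<forall>u\<in>L. \<forall>w\<in>L. \<forall>a c. infsum (\<lambda>y. norm (lattice_term s (a *\<^sub>R u) (c *\<^sub>R w) y)) L \<le> K" if "Re s > 0"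
    using lattice_norm_sum_bound[OF V that] span_scale sub unfolding B(4)[symmetric] by (meson subsetD)
qed

section \<open>Euler's pentagonal number theorem\<close>

definition tri :: "nat \<Rightarrow> nat" where "tri s = s * (s + 1) div 2"

lemma tri_0 [simp]: "tri 0 = 0" by (simp add: tri_def)

lemma tri_Suc: "tri (Suc s) = tri s + Suc s"
proof -
  have "Suc s * (Suc s + 1) = s * (s + 1) + 2 * Suc s" by simp
  thus ?thesis unfolding tri_def by (simp only: div_mult_self2[of 2, simplified])
qed

definition qprod :: "complex \<Rightarrow> nat \<Rightarrow> nat \<Rightarrow> complex" where
  "qprod q s n = (\<Prod>k\<in>{s<..n}. 1 - q ^ k)"

lemma qprod_Suc_right: "s \<le> n \<Longrightarrow> qprod q s (Suc n) = qprod q s n * (1 - q ^ Suc n)"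
proof -
  assume "s \<le> n"
  hence "{s<..Suc n} = insert (Suc n) {s<..n}" by auto
  thus ?thesis by (simp add: qprod_def mult.commute)
qed

lemma qprod_Suc_left: "s < n \<Longrightarrow> qprod q s n = (1 - q ^ Suc s) * qprod q (Suc s) n"
proof -
  assume "s < n"
  hence "{s<..n} = insert (Suc s) {Suc s<..n}" by auto
  thus ?thesis by (simp add: qprod_def)
qed

lemma qprod_refl [simp]: "qprod q n n = 1"
  by (simp add: qprod_def)

text \<open>Shanks' finite form of the pentagonal number series. Its term \<open>s = 0\<close> is the partial product of Euler's function, and the other
terms disappear in the limit.\<close>
definition shanks_sum :: "complex \<Rightarrow> nat \<Rightarrow> complex" where
  "shanks_sum q n = (\<Sum>s\<le>n. (-1) ^ s * qprod q s n * q ^ (s * n + tri s))"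

text \<open>In the difference of consecutive sums, \<open>qprod_Suc_left\<close> makes the contributions of neighbouring \<open>s\<close> cancel
in pairs, so that only the two pentagonal powers remain.\<close>
lemma shanks_step:
  "shanks_sum q (Suc n) = shanks_sum q n + (-1) ^ Suc n * (q ^ (Suc n * Suc n + tri (Suc n)) + q ^ (Suc n * Suc n + tri n))"
proof -
  define D where "D = (\<lambda>s. (-1) ^ s * qprod q s (Suc n) * q ^ (s * Suc n + tri s) - (-1) ^ s * qprod q s n * q ^ (s * n + tri s))"
  have tele: "(\<Sum>s\<le>m. D s) = - ((-1) ^ m * qprod q m n * q ^ (m * Suc n + Suc n + tri m))" if "m \<le> n" for m
    using that
  proof (induction m)
    case 0
    thus ?case by (simp add: D_def qprod_Suc_right algebra_simps)
  next
    case (Suc m)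
    have m: "m < n" using Suc.prems by simp
    have e1: "q ^ (Suc m * Suc n + tri (Suc m)) = q ^ (Suc m * n + tri (Suc m)) * q ^ Suc m"
      by (simp add: power_add[symmetric] algebra_simps)
    have e2: "q ^ (m * Suc n + Suc n + tri m) = q ^ (Suc m * n + tri (Suc m))"
      by (rule arg_cong[of _ _ "\<lambda>k. q ^ k"]) (simp add: tri_Suc)
    have e3: "q ^ (Suc m * Suc n + Suc n + tri (Suc m)) = q ^ (Suc m * n + tri (Suc m)) * q ^ Suc m * q ^ Suc n"
      by (simp add: power_add[symmetric] algebra_simps)
    define X where "X = q ^ (Suc m * n + tri (Suc m))"
    have "(\<Sum>s\<le>Suc m. D s) = - ((-1) ^ m * ((1 - q ^ Suc m) * qprod q (Suc m) n) * X) +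
       ((-1) ^ Suc m * (qprod q (Suc m) n * (1 - q ^ Suc n)) * (X * q ^ Suc m) - (-1) ^ Suc m * qprod q (Suc m) n * X)"
      using Suc m by (simp only: sum.atMost_Suc) (simp only: D_def e1 e2 X_def[symmetric] qprod_Suc_right[OF Suc.prems] qprod_Suc_left[OF m])
    also have "\<dots> = - ((-1) ^ Suc m * qprod q (Suc m) n * (X * q ^ Suc m * q ^ Suc n))"
      by (simp add: algebra_simps del: power_Suc) (simp add: algebra_simps)
    finally show ?case unfolding e3 X_def .
  qed
  have "shanks_sum q (Suc n) = (-1) ^ Suc n * q ^ (Suc n * Suc n + tri (Suc n)) + (\<Sum>s\<le>n. (-1) ^ s * qprod q s (Suc n) * q ^ (s * Suc n + tri s))"
    unfolding shanks_sum_def sum.atMost_Suc by (simp add: add.commute)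
  also have "(\<Sum>s\<le>n. (-1) ^ s * qprod q s (Suc n) * q ^ (s * Suc n + tri s)) = shanks_sum q n + (\<Sum>s\<le>n. D s)"
    unfolding shanks_sum_def D_def by (simp add: sum_subtractf)
  also have "(\<Sum>s\<le>n. D s) = (-1) ^ Suc n * q ^ (Suc n * Suc n + tri n)"
    unfolding tele[OF order_refl] by (simp add: algebra_simps)
  finally show ?thesis by (simp add: algebra_simps)
qed

text \<open>The generalized pentagonal numbers; positive and negative \<open>n\<close> give the two exponents produced by one step of the finite identity.\<close>
definition penta :: "int \<Rightarrow> nat" where "penta n = nat (n * (3 * n + 1) div 2)"

lemma two_tri: "2 * tri s = s * (s + 1)"
  unfolding tri_def by simp

lemma penta_int: "2 * int (penta n) = n * (3 * n + 1)"
proof -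
  have "even (n * (3 * n + 1))" by simp
  moreover have "n * (3 * n + 1) \<ge> 0"
  proof (cases "n \<ge> 0")
    case False
    thus ?thesis by (intro mult_nonpos_nonpos) auto
  qed auto
  ultimately show ?thesis unfolding penta_def by auto
qed

lemma double_int_cancel: "2 * int a = 2 * int b \<Longrightarrow> a = b" by simp

lemma penta_pos: "penta (int (Suc n)) = Suc n * Suc n + tri (Suc n)"
proof -
  have "2 * int (penta (int (Suc n))) = 2 * int (Suc n * Suc n) + int (2 * tri (Suc n))"
    unfolding penta_int two_tri by (simp add: algebra_simps)
  also have "\<dots> = 2 * int (Suc n * Suc n + tri (Suc n))" by (simp only: of_nat_add of_nat_mult ring_distribs)
  finally show ?thesis by (rule double_int_cancel)
qed

lemma penta_neg: "penta (- int (Suc n)) = Suc n * Suc n + tri n"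
proof -
  have "2 * int (penta (- int (Suc n))) = 2 * int (Suc n * Suc n) + int (2 * tri n)"
    unfolding penta_int two_tri by (simp add: algebra_simps)
  also have "\<dots> = 2 * int (Suc n * Suc n + tri n)" by (simp only: of_nat_add of_nat_mult ring_distribs)
  finally show ?thesis by (rule double_int_cancel)
qed

text \<open>Comparison with a geometric series then gives absolute convergence in the open unit disc.\<close>
lemma penta_ge: "nat \<bar>n\<bar> \<le> penta n"
proof -
  have "2 * \<bar>n\<bar> \<le> n * (3 * n + 1)"
  proof (cases "n \<ge> 0")
    case True
    hence "n \<le> n * n" by (cases "n = 0") (auto simp: mult_le_cancel_left1)
    with True show ?thesis by (simp add: algebra_simps)
  next
    case False
    hence "(- n) * 1 \<le> (- n) * (- n)" by (intro mult_left_mono) auto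
    with False show ?thesis by (simp add: algebra_simps)
  qed
  thus ?thesis using penta_int[of n] by linarith
qed

definition psign :: "int \<Rightarrow> complex" where "psign n = (if even n then 1 else - 1)"

lemma shanks_penta: "shanks_sum q N = (\<Sum>n\<in>{- int N..int N}. psign n * q ^ penta n)"
proof (induction N)
  case 0
  thus ?case by (simp add: shanks_sum_def psign_def penta_def)
next
  case (Suc N)
  have "{- int (Suc N)..int (Suc N)} = insert (- int (Suc N)) (insert (int (Suc N)) {- int N..int N})" by auto
  hence "(\<Sum>n\<in>{- int (Suc N)..int (Suc N)}. psign n * q ^ penta n) =
      psign (- int (Suc N)) * q ^ penta (- int (Suc N)) + (psign (int (Suc N)) * q ^ penta (int (Suc N)) +
       (\<Sum>n\<in>{- int N..int N}. psign n * q ^ penta n))"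
    by (simp only: finite_insert finite_atLeastAtMost_int sum.insert) auto
  moreover have "psign (int (Suc N)) = (-1) ^ Suc N" "psign (- int (Suc N)) = (-1) ^ Suc N"
    by (auto simp: psign_def)
  ultimately show ?case unfolding shanks_step Suc penta_pos penta_neg by (simp add: algebra_simps)
qed

definition euler_phi :: "complex \<Rightarrow> complex" where
  "euler_phi q = (\<Prod>k. 1 - q ^ Suc k)"

lemma euler_phi_convergent:
  fixes q :: complex
  assumes "norm q < 1"
  shows "convergent_prod (\<lambda>k. 1 - q ^ Suc k)"
proof -
  have "summable (\<lambda>k. norm q ^ Suc k)" using assms by (intro summable_Suc_iff[THEN iffD2] summable_geometric) auto
  hence "summable (\<lambda>k. norm (1 - q ^ Suc k - 1))" by (simp add: norm_power norm_mult)
  from abs_convergent_prod_imp_convergent_prod[OF summable_imp_abs_convergent_prod[OF this]] show ?thesis .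
qed

text \<open>A convergent product without zero factors does not vanish. This is why the discriminant has no zeros in the upper half-plane.\<close>
lemma euler_phi_nonzero:
  assumes "norm q < 1"
  shows "euler_phi q \<noteq> 0"
  unfolding euler_phi_def
proof (rule prodinf_nonzero[OF euler_phi_convergent[OF assms]])
  fix k
  have "norm (q ^ Suc k) < 1"
    using assms power_Suc_less_one[of "norm q" k] by (cases "q = 0") (auto simp: norm_power simp del: power_Suc)
  thus "1 - q ^ Suc k \<noteq> 0" by auto
qed

lemma qprod_tendsto:
  assumes "norm q < 1"
  shows "(\<lambda>n. qprod q 0 n) \<longlonglongrightarrow> euler_phi q"
proof -
  have "(\<Prod>i\<le>n. 1 - q ^ Suc i) = qprod q 0 (Suc n)" for n
    unfolding qprod_def by (rule prod.reindex_bij_witness[of _ "\<lambda>k. k - 1" Suc]) auto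
  hence "(\<lambda>n. qprod q 0 (Suc n)) \<longlonglongrightarrow> euler_phi q"
    using convergent_prod_LIMSEQ[OF euler_phi_convergent[OF assms]] by (simp add: euler_phi_def)
  thus ?thesis by (rule LIMSEQ_imp_Suc)
qed

lemma norm_qprod_le:
  assumes "norm q < 1"
  shows "norm (qprod q s n) \<le> exp (1 / (1 - norm q))"
proof -
  have "norm (qprod q s n) = (\<Prod>k\<in>{s<..n}. norm (1 - q ^ k))" by (simp add: qprod_def prod_norm)
  also have "\<dots> \<le> (\<Prod>k\<in>{s<..n}. exp (norm q ^ k))"
  proof (rule prod_mono)
    fix k
    have "norm (1 - q ^ k) \<le> 1 + norm q ^ k" using norm_triangle_ineq4[of 1 "q ^ k"] by (simp add: norm_power)
    also have "\<dots> \<le> exp (norm q ^ k)" by (rule exp_ge_add_one_self)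
    finally show "0 \<le> norm (1 - q ^ k) \<and> norm (1 - q ^ k) \<le> exp (norm q ^ k)" by simp
  qed
  also have "\<dots> = exp (\<Sum>k\<in>{s<..n}. norm q ^ k)" by (simp add: exp_sum)
  also have "(\<Sum>k\<in>{s<..n}. norm q ^ k) \<le> (\<Sum>k. norm q ^ k)"
    using assms by (intro sum_le_suminf summable_geometric) auto
  hence "exp (\<Sum>k\<in>{s<..n}. norm q ^ k) \<le> exp (1 / (1 - norm q))"
    using assms by (simp add: suminf_geometric)
  finally show ?thesis .
qed

lemma shanks_tendsto:
  assumes q: "norm q < 1"
  shows "(\<lambda>n. shanks_sum q n) \<longlonglongrightarrow> euler_phi q"
proof -
  define C where "C = exp (1 / (1 - norm q))"
  have split: "shanks_sum q n = qprod q 0 n + (\<Sum>s\<in>{1..n}. (-1) ^ s * qprod q s n * q ^ (s * n + tri s))" for n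
  proof -
    have "shanks_sum q n = (\<Sum>s\<in>insert 0 {1..n}. (-1) ^ s * qprod q s n * q ^ (s * n + tri s))"
      unfolding shanks_sum_def by (rule sum.cong) auto
    also have "\<dots> = (-1) ^ 0 * qprod q 0 n * q ^ (0 * n + tri 0) + (\<Sum>s\<in>{1..n}. (-1) ^ s * qprod q s n * q ^ (s * n + tri s))"
      by (rule sum.insert) auto
    finally show ?thesis by (simp only: power_0 mult_1 mult_0 tri_0 add_0 mult_1_right)
  qed
  have "norm (\<Sum>s\<in>{1..n}. (-1) ^ s * qprod q s n * q ^ (s * n + tri s)) \<le> real n * (C * norm q ^ n)" for n
  proof -
    have "norm (\<Sum>s\<in>{1..n}. (-1) ^ s * qprod q s n * q ^ (s * n + tri s)) \<le> (\<Sum>s\<in>{1..n}. C * norm q ^ n)"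
    proof (rule sum_norm_le)
      fix s assume s: "s \<in> {1..n}"
      hence "1 * n \<le> s * n" by (intro mult_right_mono) auto
      hence "n \<le> s * n + tri s" by linarith
      hence "norm q ^ (s * n + tri s) \<le> norm q ^ n" using q by (intro power_decreasing) auto
      hence "norm (qprod q s n) * norm q ^ (s * n + tri s) \<le> C * norm q ^ n"
        using norm_qprod_le[OF q, of s n] unfolding C_def[symmetric] by (intro mult_mono) (auto simp: C_def)
      thus "norm ((-1) ^ s * qprod q s n * q ^ (s * n + tri s)) \<le> C * norm q ^ n"
        by (simp only: norm_mult norm_power norm_minus_cancel norm_one power_one mult_1)
    qed
    thus ?thesis by simp
  qed
  moreover have "(\<lambda>n. real n * (C * norm q ^ n)) \<longlonglongrightarrow> 0"
  proof -
    have "(\<lambda>n. C * (real n * norm q ^ n)) \<longlonglongrightarrow> C * 0"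
      by (rule tendsto_mult[OF tendsto_const powser_times_n_limit_0]) (use q in auto)
    thus ?thesis by (simp add: mult_ac)
  qed
  ultimately have "(\<lambda>n. \<Sum>s\<in>{1..n}. (-1) ^ s * qprod q s n * q ^ (s * n + tri s)) \<longlonglongrightarrow> 0"
    by (rule Lim_null_comparison[OF always_eventually[OF allI]])
  from tendsto_add[OF qprod_tendsto[OF q] this] show ?thesis by (simp only: split add_0_right)
qed

lemma power_abs_int_summable:
  assumes "0 \<le> \<rho>" "\<rho> < (1::real)"
  shows "(\<lambda>n::int. \<rho> ^ nat \<bar>n\<bar>) summable_on UNIV"
proof -
  have nat: "(\<lambda>n::nat. \<rho> ^ n) summable_on UNIV"
    using assms by (intro summable_nonneg_imp_summable_on summable_geometric) auto
  have a: "(\<lambda>n::int. \<rho> ^ nat \<bar>n\<bar>) summable_on {0..}"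
    using nat by (subst summable_on_reindex_bij_witness[of _ int nat UNIV "\<lambda>n. \<rho> ^ n"]) auto
  have b: "(\<lambda>n::int. \<rho> ^ nat \<bar>n\<bar>) summable_on {..0}"
    using nat by (subst summable_on_reindex_bij_witness[of _ "\<lambda>n. - int n" "\<lambda>j. nat (- j)" UNIV "\<lambda>n. \<rho> ^ n"]) auto
  have "UNIV = {..0} \<union> {0::int..}" by auto
  thus ?thesis using summable_on_union[OF b a] by simp
qed

lemma norm_penta_term_le:
  assumes "norm q \<le> \<rho>" "\<rho> < 1"
  shows "norm (psign n * q ^ penta n) \<le> \<rho> ^ nat \<bar>n\<bar>"
proof -
  have "norm (psign n * q ^ penta n) = norm q ^ penta n" by (auto simp: psign_def norm_mult norm_power)
  also have "\<dots> \<le> \<rho> ^ penta n" using assms by (intro power_mono) auto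
  also have "\<dots> \<le> \<rho> ^ nat \<bar>n\<bar>" using assms penta_ge
    by (intro power_decreasing) (auto intro: order_trans[OF norm_ge_zero])
  finally show ?thesis .
qed

theorem pentagonal_number_theorem:
  assumes q: "norm q < 1"
  shows "(\<lambda>n. psign n * q ^ penta n) summable_on UNIV" "euler_phi q = (\<Sum>\<^sub>\<infinity>n. psign n * q ^ penta n)"
proof -
  show s: "(\<lambda>n. psign n * q ^ penta n) summable_on UNIV"
    by (rule summable_on_bound[OF power_abs_int_summable[of "norm q"] norm_penta_term_le]) (use q in auto)
  have "(\<lambda>N. \<Sum>n\<in>{- int N..int N}. psign n * q ^ penta n) \<longlonglongrightarrow> (\<Sum>\<^sub>\<infinity>n. psign n * q ^ penta n)"
    using infsum_tendsto[OF s] filterlim_int_intervals by (rule filterlim_compose)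
  thus "euler_phi q = (\<Sum>\<^sub>\<infinity>n. psign n * q ^ penta n)"
    using shanks_tendsto[OF q] LIMSEQ_unique unfolding shanks_penta[abs_def] by blast
qed

text \<open>The pentagonal series, unlike the product, is visibly a locally uniform limit of polynomials.\<close>
lemma euler_phi_holomorphic: "euler_phi holomorphic_on ball 0 1"
proof -
  have "(\<lambda>q. \<Sum>\<^sub>\<infinity>n. psign n * q ^ penta n) holomorphic_on ball 0 1"
  proof (rule holomorphic_on_infsum)
    fix x :: complex assume "x \<in> ball 0 1"
    hence x: "norm x < 1" by simp
    define \<rho> where "\<rho> = (1 + norm x) / 2"
    have \<rho>: "0 \<le> \<rho>" "\<rho> < 1" "norm x < \<rho>" using x by (auto simp: \<rho>_def)
    show "\<exists>d>0. cball x d \<subseteq> ball 0 1 \<and> (\<exists>M. M summable_on UNIV \<and> (\<forall>n\<in>UNIV. \<forall>y\<in>cball x d. norm (psign n * y ^ penta n) \<le> M n))"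
    proof (intro exI[of _ "\<rho> - norm x"] conjI exI)
      have le: "norm y \<le> \<rho>" if "y \<in> cball x (\<rho> - norm x)" for y
        using that norm_triangle_ineq2[of y x] by (simp add: dist_norm norm_minus_commute)
      show "cball x (\<rho> - norm x) \<subseteq> ball 0 1" using le \<rho> by fastforce
      show "(\<lambda>n::int. \<rho> ^ nat \<bar>n\<bar>) summable_on UNIV" by (rule power_abs_int_summable[OF \<rho>(1,2)])
      show "\<forall>n\<in>UNIV. \<forall>y\<in>cball x (\<rho> - norm x). norm (psign n * y ^ penta n) \<le> \<rho> ^ nat \<bar>n\<bar>"
        using le norm_penta_term_le[OF _ \<rho>(2)] by blast
    qed (use \<rho> in auto)
  qed (auto intro!: holomorphic_intros)
  thus ?thesis
    by (rule holomorphic_transform) (simp add: pentagonal_number_theorem(2))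
qed

section \<open>The eta function and the discriminant\<close>

lemma Im_neg_inverse: "Im (- 1 / \<tau>) = Im \<tau> / (norm \<tau>)\<^sup>2"
  by (simp add: Im_divide cmod_power2)

lemma Im_neg_inverse_pos: "Im \<tau> > 0 \<Longrightarrow> Im (- 1 / \<tau>) > 0"
  unfolding Im_neg_inverse by (intro divide_pos_pos zero_less_power) auto

definition eta :: "complex \<Rightarrow> complex" where
  "eta \<tau> = e2 (\<tau> / 24) * euler_phi (e2 \<tau>)"

text \<open>Completing the square in the pentagonal exponents: \<open>1 / 24 + n * (3 * n + 1) / 2 = (6 * n + 1)\<^sup>2 / 24\<close>.\<close>
lemma eta_series:
  assumes "Im \<tau> > 0"
  shows "eta \<tau> = (\<Sum>\<^sub>\<infinity>n. psign n * e2 (\<tau> * (6 * of_int n + 1)\<^sup>2 / 24))"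
proof -
  have "e2 (\<tau> / 24) * (psign n * e2 \<tau> ^ penta n) = psign n * e2 (\<tau> * (6 * of_int n + 1)\<^sup>2 / 24)" for n
  proof -
    have "2 * of_nat (penta n) = (of_int n * (3 * of_int n + 1) :: complex)"
      using arg_cong[OF penta_int[of n], of "of_int :: int \<Rightarrow> complex"] by simp
    hence "\<tau> / 24 + of_nat (penta n) * \<tau> = \<tau> * (6 * of_int n + 1)\<^sup>2 / 24"
      by algebra
    thus ?thesis unfolding e2_power mult.left_commute[of "e2 (\<tau> / 24)"] e2_add[symmetric] by (simp only:)
  qed
  thus ?thesis unfolding eta_def pentagonal_number_theorem(2)[OF norm_e2_less_1[OF assms]] infsum_cmult_right'[symmetric]
    by (simp only:)
qed

lemma psign_e2: "psign n = e2 (of_int n / 2)"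
proof (cases "even n")
  case True
  then obtain k where "n = 2 * k" by (elim evenE)
  thus ?thesis by (simp add: psign_def)
next
  case False
  then obtain k where k: "n = 2 * k + 1" by (elim oddE)
  have "e2 (of_int n / 2) = e2 (of_int k + 1 / 2)" by (simp add: k add_divide_distrib)
  also have "\<dots> = e2 (1 / 2)" by (simp add: e2_add)
  also have "\<dots> = - 1" by (simp add: e2_def)
  finally show ?thesis using False by (simp add: psign_def)
qed

lemma psign_minus: "psign (- n) = psign n" by (simp add: psign_def)

text \<open>The number in question is \<open>2 * cos (pi / 6)\<close>.\<close>
lemma e2_sqrt3: "(e2 (1 / 12) + e2 (- (1 / 12)))\<^sup>2 = 3"
proof -
  have "(e2 (1 / 12) + e2 (- (1 / 12)))\<^sup>2 = e2 (1 / 6) + e2 (- (1 / 6)) + 2"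
    unfolding power2_eq_square ring_distribs e2_add[symmetric] by simp
  also have "e2 (1 / 6) = cis (pi / 3)" by (simp add: e2_def cis_conv_exp mult_ac)
  also have "e2 (- (1 / 6)) = cis (- (pi / 3))" by (simp add: e2_def cis_conv_exp mult_ac)
  also have "cis (pi / 3) + cis (- (pi / 3)) = 1" by (simp add: complex_eq_iff cos_60)
  finally show ?thesis by simp
qed

text \<open>The series of eta is a Gaussian sum with shift \<open>1 / 6\<close> and frequency \<open>1 / 2\<close>. Its transform runs over odd integers \<open>k = 2 * l - 1\<close>, weighted by
twelfth roots of unity. The classes of \<open>k\<close> congruent to \<open>1\<close> and \<open>- 1\<close> modulo 6 both give the eta series again, and the class of
\<open>3\<close> cancels under \<open>k \<mapsto> - k\<close>.\<close>
lemma eta_inversion: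
  assumes \<tau>: "Im \<tau> > 0"
  shows "csqrt (- 3 * \<i> * \<tau>) * eta \<tau> = (e2 (1 / 12) + e2 (- (1 / 12))) * eta (- 1 / \<tau>)"
proof -
  define s where "s = - 3 * \<i> * \<tau>"
  define \<tau>' where "\<tau>' = - 1 / \<tau>"
  have t0: "\<tau> \<noteq> 0" using \<tau> by auto
  have s: "Re s > 0" using \<tau> by (simp add: s_def)
  have s': "Re (1 / s) > 0" by (rule inverse_Re_pos[OF s])
  have \<tau>': "Im \<tau>' > 0" unfolding \<tau>'_def by (rule Im_neg_inverse_pos[OF \<tau>])
  have s\<tau>': "1 / s = - \<i> * \<tau>' / 3" using t0 by (simp add: s_def \<tau>'_def field_simps)
  have 1: "gauss_term s (1/6) (1/2) n = e2 (1 / 12) * (psign n * e2 (\<tau> * (6 * of_int n + 1)\<^sup>2 / 24))" for n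
    unfolding gauss_term_def psign_e2 e2_add[symmetric] unfolding e2_def s_def
    by (rule arg_cong[of _ _ exp]) (simp add: field_simps power2_eq_square)
  define g where "g = gauss_term (1 / s) (- (1/2)) (1/6)"
  have g: "g l = e2 (\<tau>' * (2 * of_int l - 1)\<^sup>2 / 24 + (2 * of_int l - 1) / 12)" for l
    unfolding g_def gauss_term_def s\<tau>' e2_def
    by (rule arg_cong[of _ _ exp]) (simp add: field_simps power2_eq_square)
  have gs: "g summable_on UNIV" unfolding g_def by (rule gauss_term_summable[OF s'])
  have g0: "g (3 * n) = e2 (- (1 / 12)) * (psign (- n) * e2 (\<tau>' * (6 * of_int (- n) + 1)\<^sup>2 / 24))" for n
  proof -
    have ps: "psign (- n) = e2 (of_int n / 2)" unfolding psign_minus by (rule psign_e2)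
    show ?thesis unfolding g ps e2_add[symmetric]
      by (rule arg_cong[of _ _ e2]) (simp add: field_simps power2_eq_square)
  qed
  have g1: "g (3 * n + 1) = e2 (1 / 12) * (psign n * e2 (\<tau>' * (6 * of_int n + 1)\<^sup>2 / 24))" for n
    unfolding g psign_e2 e2_add[symmetric]
    by (rule arg_cong[of _ _ e2]) (simp add: field_simps power2_eq_square)
  \<comment> \<open>The involution \<open>n \<mapsto> - n - 1\<close> is \<open>k \<mapsto> - k\<close> on \<open>k = 6 * n + 3\<close>.\<close>
  have g2: "g (3 * (- n - 1) + 2) = - g (3 * n + 2)" for n
  proof -
    have "g (3 * (- n - 1) + 2) * e2 (1 / 2) = g (3 * n + 2) * e2 (of_int (- n))"
      unfolding g e2_add[symmetric]
      by (rule arg_cong[of _ _ e2]) (simp add: field_simps power2_eq_square)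
    hence "g (3 * (- n - 1) + 2) * e2 (1 / 2) = g (3 * n + 2)" by (simp only: e2_of_int mult_1_right)
    moreover have "e2 (1 / 2) = - 1" by (simp add: e2_def)
    moreover have "x = - y" if "x * (- 1) = y" for x y :: complex using that by auto
    ultimately show ?thesis by (simp only:)
  qed
  have S2: "infsum (\<lambda>n. g (3 * n + 2)) UNIV = 0"
  proof -
    have "infsum (\<lambda>n. g (3 * n + 2)) UNIV = infsum (\<lambda>n. g (3 * (- n - 1) + 2)) UNIV"
      by (rule infsum_reindex_bij_witness[of _ "\<lambda>n. - n - 1" "\<lambda>n. - n - 1"]) auto
    also have "\<dots> = - infsum (\<lambda>n. g (3 * n + 2)) UNIV" unfolding g2 by (rule infsum_uminus)
    finally show ?thesis by simp
  qed
  have S1: "infsum (\<lambda>n. g (3 * n + 1)) UNIV = e2 (1 / 12) * eta \<tau>'"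
    unfolding g1 infsum_cmult_right' eta_series[OF \<tau>'] ..
  have S0: "infsum (\<lambda>n. g (3 * n)) UNIV = e2 (- (1 / 12)) * eta \<tau>'"
  proof -
    have "infsum (\<lambda>n. psign (- n) * e2 (\<tau>' * (6 * of_int (- n) + 1)\<^sup>2 / 24)) UNIV = eta \<tau>'"
      unfolding eta_series[OF \<tau>'] by (rule infsum_reindex_bij_witness[of _ uminus uminus]) auto
    thus ?thesis unfolding g0 infsum_cmult_right' by simp
  qed
  have "infsum g UNIV = infsum (\<lambda>n. g (3 * n)) UNIV + infsum (\<lambda>n. g (3 * n + 1)) UNIV + infsum (\<lambda>n. g (3 * n + 2)) UNIV"
    using infsum_residue_classes[OF _ gs, of 3] by (simp add: numeral_3_eq_3)
  hence "infsum g UNIV = (e2 (1 / 12) + e2 (- (1 / 12))) * eta \<tau>'"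
    unfolding S0 S1 S2 by (simp add: ring_distribs)
  moreover have "e2 (1 / 12) * eta \<tau> = e2 (1 / 12) / csqrt s * infsum g UNIV"
    using gauss_poisson[OF s, of "1/6" "1/2"] unfolding 1 infsum_cmult_right' eta_series[OF \<tau>] g_def by simp
  moreover have "csqrt s \<noteq> 0" using s by auto
  ultimately have "infsum g UNIV = (e2 (1 / 12) + e2 (- (1 / 12))) * eta \<tau>'"
      "e2 (1 / 12) * (csqrt s * eta \<tau>) = e2 (1 / 12) * infsum g UNIV"
    by (simp_all add: divide_simps mult.commute[of "csqrt s"])
  hence "csqrt s * eta \<tau> = (e2 (1 / 12) + e2 (- (1 / 12))) * eta \<tau>'" by simp
  thus ?thesis by (simp add: s_def \<tau>'_def)
qed

text \<open>The discriminant, normalized to begin with \<open>q\<close>.\<close>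
definition modular_disc :: "complex \<Rightarrow> complex" where
  "modular_disc \<tau> = e2 \<tau> * euler_phi (e2 \<tau>) ^ 24"

lemma modular_disc_eta: "modular_disc \<tau> = eta \<tau> ^ 24"
  by (simp add: modular_disc_def eta_def power_mult_distrib e2_power)

lemma modular_disc_inversion:
  assumes \<tau>: "Im \<tau> > 0"
  shows "modular_disc (- 1 / \<tau>) = \<tau> ^ 12 * modular_disc \<tau>"
proof -
  have "(csqrt (- 3 * \<i> * \<tau>) * eta \<tau>) ^ 24 = ((e2 (1 / 12) + e2 (- (1 / 12))) * eta (- 1 / \<tau>)) ^ 24"
    by (simp only: eta_inversion[OF \<tau>])
  hence "((csqrt (- 3 * \<i> * \<tau>))\<^sup>2) ^ 12 * modular_disc \<tau> = ((e2 (1 / 12) + e2 (- (1 / 12)))\<^sup>2) ^ 12 * modular_disc (- 1 / \<tau>)"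
    unfolding modular_disc_eta power_mult_distrib power_mult[symmetric] by simp
  hence "3 ^ 12 * (\<tau> ^ 12 * modular_disc \<tau>) = 3 ^ 12 * modular_disc (- 1 / \<tau>)"
    unfolding power2_csqrt e2_sqrt3 by (simp add: power_mult_distrib)
  thus ?thesis by simp
qed

lemma modular_disc_nonzero: "Im \<tau> > 0 \<Longrightarrow> modular_disc \<tau> \<noteq> 0"
  by (simp add: modular_disc_def euler_phi_nonzero norm_e2_less_1)

section \<open>Order at the cusp of modular forms for the full modular group\<close>

text \<open>Reduction theory without a fundamental domain. A point with \<open>\<bar>Re \<tau>\<bar> \<le> 1 / 2\<close> and \<open>Im \<tau> < 1 / 2\<close> satisfies
\<open>(norm \<tau>)\<^sup>2 \<le> 1 / 2\<close>, so that inversion at least doubles its imaginary part; after finitely many steps the imaginary part is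
at least \<open>1 / 2\<close>.\<close>
lemma upper_half_plane_induct:
  assumes per: "\<And>\<tau>. Im \<tau> > 0 \<Longrightarrow> P (\<tau> + 1) \<longleftrightarrow> P \<tau>"
    and inv: "\<And>\<tau>. Im \<tau> > 0 \<Longrightarrow> P (- 1 / \<tau>) \<Longrightarrow> P \<tau>"
    and high: "\<And>\<tau>. Im \<tau> \<ge> 1 / 2 \<Longrightarrow> P \<tau>"
    and \<tau>: "Im \<tau> > 0"
  shows "P \<tau>"
proof -
  have shift_nat: "P (\<sigma> + of_nat n) \<longleftrightarrow> P \<sigma>" if "Im \<sigma> > 0" for \<sigma> n
  proof (induction n)
    case (Suc n)
    have "P (\<sigma> + of_nat n + 1) \<longleftrightarrow> P (\<sigma> + of_nat n)" by (rule per) (use that in simp)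
    moreover have "\<sigma> + of_nat (Suc n) = \<sigma> + of_nat n + 1" by simp
    ultimately show ?case using Suc by (simp only:)
  qed simp
  have shift: "P (\<sigma> + of_int n) \<longleftrightarrow> P \<sigma>" if "Im \<sigma> > 0" for \<sigma> n
  proof (cases "n \<ge> 0")
    case True
    hence e: "(of_nat (nat n) :: complex) = of_int n" by simp
    show ?thesis using shift_nat[OF that, of "nat n"] unfolding e .
  next
    case False
    hence e: "\<sigma> + of_int n + (of_nat (nat (- n)) :: complex) = \<sigma>" by simp
    have "P (\<sigma> + of_int n + of_nat (nat (- n))) \<longleftrightarrow> P (\<sigma> + of_int n)"
      by (rule shift_nat) (use that in simp)
    thus ?thesis unfolding e by (rule sym)
  qed
  have low: "P \<sigma>" if "Im \<sigma> \<ge> 1 / 2 ^ k" "Im \<sigma> > 0" for \<sigma> k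
    using that
  proof (induction k arbitrary: \<sigma>)
    case 0
    thus ?case by (intro high) auto
  next
    case (Suc k)
    show ?case
    proof (cases "Im \<sigma> \<ge> 1 / 2")
      case True
      thus ?thesis by (rule high)
    next
      case False
      \<comment> \<open>Translate to real part at most \<open>1 / 2\<close> in absolute value, then invert.\<close>
      define \<rho> where "\<rho> = \<sigma> - of_int (round (Re \<sigma>))"
      have Im: "Im \<rho> = Im \<sigma>" by (simp add: \<rho>_def)
      have "\<bar>Re \<rho>\<bar> \<le> 1 / 2" using of_int_round_abs_le[of "Re \<sigma>"] by (simp add: \<rho>_def abs_minus_commute)
      hence "\<bar>Re \<rho>\<bar>\<^sup>2 \<le> (1 / 2)\<^sup>2" by (rule power_mono) auto
      hence "(Re \<rho>)\<^sup>2 \<le> (1 / 2)\<^sup>2" by simp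
      moreover have "(Im \<rho>)\<^sup>2 \<le> (1 / 2)\<^sup>2" using False Suc.prems(2) Im by (intro power_mono) auto
      ultimately have n: "(Re \<rho>)\<^sup>2 + (Im \<rho>)\<^sup>2 \<le> 1 / 2" by (simp add: power2_eq_square)
      have pos: "(Re \<rho>)\<^sup>2 + (Im \<rho>)\<^sup>2 > 0" using Suc.prems(2) Im by (intro add_nonneg_pos) auto
      have Im': "Im (- 1 / \<rho>) = Im \<rho> / ((Re \<rho>)\<^sup>2 + (Im \<rho>)\<^sup>2)" by (simp add: Im_divide)
      have "Im \<rho> / ((Re \<rho>)\<^sup>2 + (Im \<rho>)\<^sup>2) \<ge> Im \<rho> / (1 / 2)"
        using n pos Suc.prems(2) Im by (intro divide_left_mono) auto
      hence "Im (- 1 / \<rho>) \<ge> 2 * Im \<sigma>" unfolding Im' Im by simp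
      hence "Im (- 1 / \<rho>) \<ge> 1 / 2 ^ k" "Im (- 1 / \<rho>) > 0" using Suc.prems by auto
      hence "P (- 1 / \<rho>)" by (rule Suc.IH)
      hence "P \<rho>" by (rule inv[rotated]) (use Suc.prems(2) Im in simp)
      moreover have "P (\<rho> + of_int (round (Re \<sigma>))) \<longleftrightarrow> P \<rho>" by (rule shift) (use Suc.prems(2) Im in simp)
      moreover have "\<rho> + of_int (round (Re \<sigma>)) = \<sigma>" by (simp add: \<rho>_def)
      ultimately show ?thesis by (simp only:)
    qed
  qed
  obtain k where "(1 / 2) ^ k < Im \<tau>"
    using real_arch_pow_inv[OF \<tau>, of "1/2"] by auto
  hence "1 / 2 ^ k \<le> Im \<tau>" by (simp add: power_one_over)
  from low[OF this \<tau>] show ?thesis .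
qed

lemma powser_eq_0_imp_coeffs_0:
  fixes c :: "nat \<Rightarrow> complex"
  assumes sm: "\<And>q. norm q < 1 \<Longrightarrow> (\<lambda>n. c n * q ^ n) sums 0"
  shows "c m = 0"
proof (rule ccontr)
  assume m: "c m \<noteq> 0"
  have c0: "c 0 = 0" using sm[of 0] by (simp add: powser_sums_zero_iff)
  have "m > 0" using m c0 by (cases m) auto
  show False
  proof (rule powser_0_nonzero[of 1 0 c "\<lambda>_. 0::complex" m])
    fix s :: real assume s: "0 < s" "\<And>z::complex. z \<in> cball 0 s - {0} \<Longrightarrow> (0::complex) \<noteq> 0"
    have "complex_of_real s \<in> cball 0 s - {0}" using s(1) by auto
    from s(2)[OF this] show False by simp
  qed (use sm m \<open>m > 0\<close> in auto)
qed

text \<open>Suppose the order at the cusp exceeds \<open>w / 12\<close>. The quotient \<open>G\<close> of the form by the \<open>r\<close>-th power of the discriminant has negative weight \<open>- \<kappa>\<close>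
and is holomorphic in \<open>q\<close> on the whole unit disc. The invariant function \<open>(norm G)\<^sup>2 / (Im \<tau>) ^ \<kappa>\<close> is bounded where \<open>Im \<tau> \<ge> 1 / 2\<close>, and
hence everywhere. So \<open>G\<close> tends to zero uniformly as \<open>norm q\<close> tends to 1, and the maximum principle gives \<open>G = 0\<close>.\<close>
theorem level_one_vanishing:
  fixes c :: "nat \<Rightarrow> complex" and F :: "complex \<Rightarrow> complex"
  assumes sums: "\<And>q. norm q < 1 \<Longrightarrow> (\<lambda>n. c n * q ^ n) sums F q"
    and ord: "\<And>n. n < r \<Longrightarrow> c n = 0"
    and inv: "\<And>\<tau>. Im \<tau> > 0 \<Longrightarrow> F (e2 (- 1 / \<tau>)) = \<tau> ^ w * F (e2 \<tau>)"
    and weight: "w < 12 * r"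
  shows "c n = 0"
proof -
  define \<kappa> where "\<kappa> = 12 * r - w"
  have \<kappa>: "\<kappa> > 0" "12 * r = w + \<kappa>" using weight by (auto simp: \<kappa>_def)
  define F1 where "F1 = (\<lambda>q. \<Sum>n. c (n + r) * q ^ n)"
  have F1: "(\<lambda>n. c (n + r) * q ^ n) sums F1 q" "F q = q ^ r * F1 q" if q: "norm q < 1" for q
    unfolding F1_def by (rule powser_leading_factor[OF sums[OF q] ord], assumption)+
  define G where "G = (\<lambda>q. F1 q / euler_phi q ^ (24 * r))"
  have holF1: "F1 holomorphic_on ball 0 1"
    by (rule power_series_holomorphic[where a = "\<lambda>n. c (n + r)"]) (use F1(1) in auto)
  have holG: "G holomorphic_on ball 0 1"
    unfolding G_def by (intro holomorphic_intros holF1 euler_phi_holomorphic) (auto simp: euler_phi_nonzero)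
  have GF: "F (e2 \<tau>) = modular_disc \<tau> ^ r * G (e2 \<tau>)" if "Im \<tau> > 0" for \<tau>
    using F1(2)[OF norm_e2_less_1[OF that]] euler_phi_nonzero[OF norm_e2_less_1[OF that]]
    by (simp add: G_def modular_disc_def power_mult_distrib power_mult)
  have Ginv: "norm (G (e2 (- 1 / \<tau>))) * norm \<tau> ^ \<kappa> = norm (G (e2 \<tau>))" if \<tau>: "Im \<tau> > 0" for \<tau>
  proof -
    have \<tau>': "Im (- 1 / \<tau>) > 0" by (rule Im_neg_inverse_pos[OF \<tau>])
    have t0: "\<tau> \<noteq> 0" using \<tau> by auto
    have "\<tau> ^ (12 * r) * modular_disc \<tau> ^ r * G (e2 (- 1 / \<tau>)) = \<tau> ^ w * (modular_disc \<tau> ^ r * G (e2 \<tau>))"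
      using inv[OF \<tau>] unfolding GF[OF \<tau>] GF[OF \<tau>'] modular_disc_inversion[OF \<tau>] by (simp only: power_mult_distrib power_mult)
    hence "(\<tau> ^ w * modular_disc \<tau> ^ r) * (\<tau> ^ \<kappa> * G (e2 (- 1 / \<tau>))) = (\<tau> ^ w * modular_disc \<tau> ^ r) * G (e2 \<tau>)"
      unfolding \<kappa>(2) power_add by (simp only: mult_ac)
    hence "\<tau> ^ \<kappa> * G (e2 (- 1 / \<tau>)) = G (e2 \<tau>)"
      using t0 modular_disc_nonzero[OF \<tau>] by simp
    from this[symmetric] show ?thesis by (simp add: norm_mult norm_power mult.commute)
  qed
  \<comment> \<open>The disc \<open>norm q \<le> exp (- pi)\<close> is the image of the half-plane \<open>Im \<tau> \<ge> 1 / 2\<close>.\<close>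
  define \<rho>0 where "\<rho>0 = exp (- pi)"
  have \<rho>0: "0 < \<rho>0" "\<rho>0 < 1" by (auto simp: \<rho>0_def)
  have "compact (G ` cball 0 \<rho>0)"
    using \<rho>0 by (intro compact_continuous_image continuous_on_subset[OF holomorphic_on_imp_continuous_on[OF holG]]) auto
  then obtain C where C: "\<And>q. norm q \<le> \<rho>0 \<Longrightarrow> norm (G q) \<le> C"
    by (metis compact_imp_bounded bounded_iff imageI mem_cball_0)
  have C0: "C \<ge> 0" using order_trans[OF norm_ge_zero C[of 0]] \<rho>0 by simp
  define M where "M = C\<^sup>2 * 2 ^ \<kappa>"
  have bound: "(norm (G (e2 \<tau>)))\<^sup>2 \<le> M * Im \<tau> ^ \<kappa>" if "Im \<tau> > 0" for \<tau>
  proof (rule upper_half_plane_induct[OF _ _ _ that])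
    fix \<tau> :: complex assume "Im \<tau> > 0"
    show "(norm (G (e2 (\<tau> + 1))))\<^sup>2 \<le> M * Im (\<tau> + 1) ^ \<kappa> \<longleftrightarrow> (norm (G (e2 \<tau>)))\<^sup>2 \<le> M * Im \<tau> ^ \<kappa>"
      by (simp add: e2_add)
  next
    fix \<tau> :: complex assume \<tau>: "Im \<tau> > 0" and le: "(norm (G (e2 (- 1 / \<tau>))))\<^sup>2 \<le> M * Im (- 1 / \<tau>) ^ \<kappa>"
    have "\<tau> \<noteq> 0" using \<tau> by auto
    hence Im': "Im (- 1 / \<tau>) * (norm \<tau>)\<^sup>2 = Im \<tau>" unfolding Im_neg_inverse by simp
    have "(norm (G (e2 \<tau>)))\<^sup>2 = (norm (G (e2 (- 1 / \<tau>))))\<^sup>2 * ((norm \<tau>)\<^sup>2) ^ \<kappa>"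
      unfolding Ginv[OF \<tau>, symmetric] by (simp add: power_mult_distrib power_mult[symmetric] mult.commute)
    also have "\<dots> \<le> M * Im (- 1 / \<tau>) ^ \<kappa> * ((norm \<tau>)\<^sup>2) ^ \<kappa>"
      by (rule mult_right_mono[OF le]) simp
    also have "\<dots> = M * Im \<tau> ^ \<kappa>" unfolding Im'[symmetric] power_mult_distrib by (simp only: mult_ac)
    finally show "(norm (G (e2 \<tau>)))\<^sup>2 \<le> M * Im \<tau> ^ \<kappa>" .
  next
    fix \<tau> :: complex assume \<tau>: "Im \<tau> \<ge> 1 / 2"
    have "norm (e2 \<tau>) \<le> \<rho>0" unfolding norm_e2 \<rho>0_def using \<tau> mult_left_mono[OF \<tau>, of "2 * pi"] by simp
    hence "(norm (G (e2 \<tau>)))\<^sup>2 \<le> C\<^sup>2 * 1" using C by (simp add: power_mono)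
    also have "\<dots> \<le> C\<^sup>2 * (2 * Im \<tau>) ^ \<kappa>" using \<tau> by (intro mult_left_mono one_le_power) auto
    finally show "(norm (G (e2 \<tau>)))\<^sup>2 \<le> M * Im \<tau> ^ \<kappa>" by (simp add: M_def power_mult_distrib mult_ac)
  qed
  have G0: "G q0 = 0" if q0: "norm q0 < 1" for q0
  proof -
    have le: "(norm (G q0))\<^sup>2 \<le> M * (- ln \<rho> / (2 * pi)) ^ \<kappa>" if \<rho>: "norm q0 < \<rho>" "\<rho> < 1" for \<rho>
    proof -
      have \<rho>p: "\<rho> > 0" using \<rho>(1) norm_ge_zero[of q0] by linarith
      define B where "B = M * (- ln \<rho> / (2 * pi)) ^ \<kappa>"
      have B0: "B \<ge> 0" using \<rho>(2) \<rho>p C0 unfolding B_def M_def by (intro mult_nonneg_nonneg zero_le_power) (auto intro!: divide_nonpos_pos)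
      have fr: "norm (G q) \<le> sqrt B" if "q \<in> frontier (cball 0 \<rho>)" for q
      proof -
        have nq: "norm q = \<rho>" using that \<rho>p by (simp add: frontier_cball)
        have "q \<noteq> 0" "norm q < 1" using nq \<rho>p \<rho>(2) by auto
        then obtain \<tau> where \<tau>: "Im \<tau> > 0" and eq: "e2 \<tau> = q" using e2_surj by blast
        have "exp (- (2 * pi * Im \<tau>)) = \<rho>" using norm_e2[of \<tau>] eq nq by simp
        hence "- (2 * pi * Im \<tau>) = ln \<rho>" by (metis ln_exp)
        hence Im: "Im \<tau> = - ln \<rho> / (2 * pi)" by (simp add: field_simps)
        from bound[OF \<tau>] have "(norm (G q))\<^sup>2 \<le> B" unfolding eq Im B_def .
        thus ?thesis by (rule real_le_rsqrt)
      qed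
      have "norm (G q0) \<le> sqrt B"
      proof (rule maximum_modulus_frontier[where S = "cball 0 \<rho>" and f = G and \<xi> = q0])
        show "G holomorphic_on interior (cball 0 \<rho>)" "continuous_on (closure (cball 0 \<rho>)) G"
          using \<rho>(2) holG by (auto intro: holomorphic_on_subset continuous_on_subset[OF holomorphic_on_imp_continuous_on[OF holG]])
      qed (use fr \<rho> in auto)
      hence "(norm (G q0))\<^sup>2 \<le> (sqrt B)\<^sup>2" by (intro power_mono) auto
      thus ?thesis using B0 unfolding B_def by simp
    qed
    have "((\<lambda>\<rho>. M * (- ln \<rho> / (2 * pi)) ^ \<kappa>) \<longlongrightarrow> M * (- ln 1 / (2 * pi)) ^ \<kappa>) (at_left 1)"
      by (intro tendsto_intros) auto
    hence lim: "((\<lambda>\<rho>. M * (- ln \<rho> / (2 * pi)) ^ \<kappa>) \<longlongrightarrow> 0) (at_left 1)"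
      using \<kappa>(1) by (simp add: zero_power)
    have "(norm (G q0))\<^sup>2 \<le> 0"
    proof (rule tendsto_lowerbound[OF lim])
      show "\<forall>\<^sub>F \<rho> in at_left 1. (norm (G q0))\<^sup>2 \<le> M * (- ln \<rho> / (2 * pi)) ^ \<kappa>"
        using eventually_at_left_real[OF q0] by (rule eventually_mono) (use le in auto)
    qed auto
    thus ?thesis by simp
  qed
  have "F1 q = 0" if "norm q < 1" for q
    using G0[OF that] euler_phi_nonzero[OF that] by (simp add: G_def)
  hence "c (m + r) = 0" for m
    using powser_eq_0_imp_coeffs_0[of "\<lambda>n. c (n + r)" m] F1(1) by simp
  thus ?thesis using ord[of n] by (metis le_add_diff_inverse2 not_le)
qed

section \<open>Fourier expansions in degree two\<close>

text \<open>Average the hypothesis, multiplied by \<open>e2 (- l * x)\<close>, over the points \<open>x = k / N\<close>: the sum of all \<open>a i\<close> with \<open>h i\<close> congruent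
to \<open>l\<close> modulo \<open>N\<close> is zero. By absolute convergence, for large \<open>N\<close> the terms with \<open>h i \<noteq> l\<close> contribute arbitrarily little to it.\<close>
lemma fourier_fiber_sum_zero:
  fixes a :: "'i \<Rightarrow> complex" and h :: "'i \<Rightarrow> int"
  assumes a: "a summable_on I"
    and zero: "\<And>x::real. infsum (\<lambda>i. a i * e2 (of_int (h i) * of_real x)) I = 0"
  shows "infsum a {i\<in>I. h i = l} = 0"
proof -
  have na: "(\<lambda>i. norm (a i)) summable_on I" using a by (simp only: summable_on_iff_abs_summable_on_complex)
  have sub: "a summable_on J" if "J \<subseteq> I" for J
    using a that by (rule summable_on_subset_banach)
  have nsub: "(\<lambda>i. norm (a i)) summable_on J" if "J \<subseteq> I" for J
    using na that by (rule summable_on_subset_banach)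
  have class_zero: "infsum a {i\<in>I. int N dvd h i - l} = 0" if N: "N > 0" for N :: nat
  proof -
    have sx: "(\<lambda>i. a i * e2 (of_int (h i - l) * (of_nat k / of_nat N))) summable_on I" for k
    proof (rule summable_on_bound[OF na])
      have "Im (of_int (h i - l) * (of_nat k / of_nat N)) = 0" for i by simp
      thus "norm (a i * e2 (of_int (h i - l) * (of_nat k / of_nat N))) \<le> norm (a i)" for i
        by (simp add: norm_mult norm_e2)
    qed
    have z: "infsum (\<lambda>i. a i * e2 (of_int (h i - l) * (of_nat k / of_nat N))) I = 0" for k
    proof -
      have "a i * e2 (of_int (h i - l) * (of_nat k / of_nat N)) =
         e2 (of_int (- l) * (of_nat k / of_nat N)) * (a i * e2 (of_int (h i) * of_real (real k / real N)))" for i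
        by (simp add: e2_add[symmetric] algebra_simps)
      thus ?thesis by (simp only: infsum_cmult_right' zero mult_zero_right)
    qed
    have "0 = (\<Sum>k<N. infsum (\<lambda>i. a i * e2 (of_int (h i - l) * (of_nat k / of_nat N))) I)"
      by (simp only: z sum.neutral_const)
    also have "\<dots> = infsum (\<lambda>i. \<Sum>k<N. a i * e2 (of_int (h i - l) * (of_nat k / of_nat N))) I"
      by (rule infsum_finite_sum[symmetric, OF _ sx]) simp
    also have "\<dots> = infsum (\<lambda>i. if int N dvd h i - l then of_nat N * a i else 0) I"
      by (intro infsum_cong) (simp only: sum_distrib_left[symmetric] sum_roots_of_unity[OF N], auto)
    also have "\<dots> = infsum (\<lambda>i. of_nat N * a i) {i\<in>I. int N dvd h i - l}"
      by (rule infsum_cong_neutral) auto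
    finally show ?thesis using N by (simp add: infsum_cmult_right')
  qed
  have "norm (infsum a {i\<in>I. h i = l}) \<le> \<epsilon>" if \<epsilon>: "\<epsilon> > 0" for \<epsilon>
  proof -
    obtain F where F: "finite F" "F \<subseteq> I" "dist (sum (\<lambda>i. norm (a i)) F) (infsum (\<lambda>i. norm (a i)) I) \<le> \<epsilon>"
      using infsum_finite_approximation[OF na \<epsilon>] by blast
    have tail: "infsum (\<lambda>i. norm (a i)) (I - F) \<le> \<epsilon>"
      using F(3) infsum_Diff[OF na nsub[OF F(2)] F(2)] F(1) by (simp add: dist_norm)
    \<comment> \<open>For \<open>i\<close> in \<open>F\<close>, divisibility of \<open>h i - l\<close> by a number this large means \<open>h i = l\<close>.\<close>
    define N where "N = Suc (nat (\<Sum>i\<in>F. \<bar>h i - l\<bar>))"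
    have small: "\<bar>h i - l\<bar> < int N" if "i \<in> F" for i
    proof -
      have "\<bar>h i - l\<bar> \<le> (\<Sum>i\<in>F. \<bar>h i - l\<bar>)" using F(1) that by (intro member_le_sum) auto
      thus ?thesis by (simp add: N_def)
    qed
    let ?D = "{i\<in>I. int N dvd h i - l} - {i\<in>I. h i = l}"
    have D: "?D \<subseteq> I - F"
    proof
      fix i assume i: "i \<in> ?D"
      have "i \<notin> F"
      proof
        assume "i \<in> F"
        have "int N dvd h i - l" "h i - l \<noteq> 0" using i by simp_all
        hence "\<bar>int N\<bar> \<le> \<bar>h i - l\<bar>" by (intro dvd_imp_le_int)
        thus False using small[OF \<open>i \<in> F\<close>] by simp
      qed
      with i show "i \<in> I - F" by blast
    qed
    have "infsum a ?D = infsum a {i\<in>I. int N dvd h i - l} - infsum a {i\<in>I. h i = l}"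
      by (rule infsum_Diff) (auto intro!: sub)
    hence "norm (infsum a {i\<in>I. h i = l}) = norm (infsum a ?D)"
      using class_zero[of N] by (simp add: N_def)
    also have "\<dots> \<le> infsum (\<lambda>i. norm (a i)) ?D"
      by (rule infsum_complex_norm) (auto intro!: sub)
    also have "\<dots> \<le> infsum (\<lambda>i. norm (a i)) (I - F)"
      using D by (intro infsum_mono_neutral nsub) auto
    finally show ?thesis using tail by linarith
  qed
  hence "norm (infsum a {i\<in>I. h i = l}) \<le> 0" by (rule field_le_epsilon) simp
  thus ?thesis by simp
qed

text \<open>The condition that the symmetric matrix with entries \<open>\<tau>, z, z, \<sigma>\<close> has positive definite imaginary part.\<close>
definition H2_point :: "complex \<Rightarrow> complex \<Rightarrow> complex \<Rightarrow> bool" where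
  "H2_point \<tau> z \<sigma> \<longleftrightarrow> Im \<tau> > 0 \<and> (Im z)\<^sup>2 < Im \<tau> * Im \<sigma>"

text \<open>Coefficients are indexed by binary quadratic forms \<open>n * x\<^sup>2 + \<rho> * x * y + m * y\<^sup>2\<close>, given by three integers.\<close>
definition siegel_term :: "(int \<Rightarrow> int \<Rightarrow> int \<Rightarrow> complex) \<Rightarrow> complex \<Rightarrow> complex \<Rightarrow> complex \<Rightarrow> int \<times> int \<times> int \<Rightarrow> complex" where
  "siegel_term A \<tau> z \<sigma> = (\<lambda>(n, \<rho>, m). A n \<rho> m * e2 (of_int n * \<tau> + of_int \<rho> * z + of_int m * \<sigma>))"

text \<open>The one-variable statement is applied to the real parts of the three variables in turn, which isolates one coefficient.\<close>
lemma siegel_fourier_zero: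
  assumes "\<And>\<tau> z \<sigma>. H2_point \<tau> z \<sigma> \<Longrightarrow> (siegel_term A \<tau> z \<sigma> has_sum 0) UNIV"
  shows "A n \<rho> m = 0"
proof -
  define a where "a = (\<lambda>y w (n, \<rho>, m). A n \<rho> m * e2 (of_int n * \<i> + of_int \<rho> * of_real y + of_int m * (of_real w + \<i>)))"
  have zero: "infsum (\<lambda>p. a y w p * e2 (of_int (fst p) * of_real x)) UNIV = 0"
    and sm: "a y w summable_on UNIV" for x y w
  proof -
    have "(siegel_term A (of_real x + \<i>) (of_real y) (of_real w + \<i>) has_sum 0) UNIV" for x
      by (rule assms) (simp add: H2_point_def)
    moreover have "siegel_term A (of_real x + \<i>) (of_real y) (of_real w + \<i>) = (\<lambda>p. a y w p * e2 (of_int (fst p) * of_real x))" for x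
      by (auto simp: siegel_term_def a_def fun_eq_iff e2_add[symmetric] algebra_simps)
    ultimately have hs: "((\<lambda>p. a y w p * e2 (of_int (fst p) * of_real x)) has_sum 0) UNIV" for x by simp
    show "infsum (\<lambda>p. a y w p * e2 (of_int (fst p) * of_real x)) UNIV = 0" by (rule infsumI[OF hs])
    show "a y w summable_on UNIV" using has_sum_imp_summable[OF hs[of 0]] by simp
  qed
  have 1: "infsum (a y w) {p. fst p = n} = 0" for y w
    using fourier_fiber_sum_zero[OF sm zero, of y w n] by simp
  have 2: "infsum (a 0 w) {p \<in> {p. fst p = n}. fst (snd p) = \<rho>} = 0" for w
  proof (rule fourier_fiber_sum_zero)
    show "a 0 w summable_on {p. fst p = n}" using sm by (rule summable_on_subset_banach) auto
    fix x :: real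
    have "(\<lambda>p. a 0 w p * e2 (of_int (fst (snd p)) * of_real x)) = a x w"
      by (auto simp: a_def fun_eq_iff e2_add[symmetric] algebra_simps)
    thus "infsum (\<lambda>p. a 0 w p * e2 (of_int (fst (snd p)) * of_real x)) {p. fst p = n} = 0" using 1 by simp
  qed
  have 3: "infsum (a 0 0) {p \<in> {p \<in> {p. fst p = n}. fst (snd p) = \<rho>}. snd (snd p) = m} = 0"
  proof (rule fourier_fiber_sum_zero)
    show "a 0 0 summable_on {p \<in> {p. fst p = n}. fst (snd p) = \<rho>}" using sm by (rule summable_on_subset_banach) auto
    fix x :: real
    have "(\<lambda>p. a 0 0 p * e2 (of_int (snd (snd p)) * of_real x)) = a 0 x"
      by (auto simp: a_def fun_eq_iff e2_add[symmetric] algebra_simps)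
    thus "infsum (\<lambda>p. a 0 0 p * e2 (of_int (snd (snd p)) * of_real x)) {p \<in> {p. fst p = n}. fst (snd p) = \<rho>} = 0" using 2 by simp
  qed
  have "{p \<in> {p \<in> {p. fst p = n}. fst (snd p) = \<rho>}. snd (snd p) = m} = {(n, \<rho>, m)}" by auto
  with 3 show ?thesis by (simp add: a_def)
qed

lemma siegel_fourier_unique:
  assumes "\<And>\<tau> z \<sigma>. H2_point \<tau> z \<sigma> \<Longrightarrow> (siegel_term A \<tau> z \<sigma> has_sum g \<tau> z \<sigma>) UNIV"
    and "\<And>\<tau> z \<sigma>. H2_point \<tau> z \<sigma> \<Longrightarrow> (siegel_term B \<tau> z \<sigma> has_sum g \<tau> z \<sigma>) UNIV"
  shows "A n \<rho> m = B n \<rho> m"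
proof -
  have "A n \<rho> m - B n \<rho> m = 0"
  proof (rule siegel_fourier_zero[where A = "\<lambda>n \<rho> m. A n \<rho> m - B n \<rho> m"])
    fix \<tau> z \<sigma> assume "H2_point \<tau> z \<sigma>"
    from has_sum_add[OF assms(1)[OF this] has_sum_uminusI[OF assms(2)[OF this]]]
    show "(siegel_term (\<lambda>n \<rho> m. A n \<rho> m - B n \<rho> m) \<tau> z \<sigma> has_sum 0) UNIV"
      by (simp add: siegel_term_def case_prod_unfold algebra_simps)
  qed
  thus ?thesis by simp
qed

definition psd_supported :: "(int \<Rightarrow> int \<Rightarrow> int \<Rightarrow> complex) \<Rightarrow> bool" where
  "psd_supported A \<longleftrightarrow> (\<forall>n \<rho> m. A n \<rho> m \<noteq> 0 \<longrightarrow> n \<ge> 0 \<and> m \<ge> 0 \<and> \<rho>\<^sup>2 \<le> 4 * n * m)"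

definition siegel_expansion :: "(int \<Rightarrow> int \<Rightarrow> int \<Rightarrow> complex) \<Rightarrow> (complex \<Rightarrow> complex \<Rightarrow> complex \<Rightarrow> complex) \<Rightarrow> bool" where
  "siegel_expansion A G \<longleftrightarrow> psd_supported A \<and>
     (\<forall>\<tau> z \<sigma>. H2_point \<tau> z \<sigma> \<longrightarrow> (siegel_term A \<tau> z \<sigma> has_sum G \<tau> z \<sigma>) UNIV)"

text \<open>The part of modularity of weight \<open>k\<close> that the argument uses. Each clause is the action of one symplectic matrix; the
inversion is demanded for real \<open>z\<close> only, because the limit \<open>z \<rightarrow> 0\<close> along the reals determines Taylor coefficients.\<close>
definition jacobi_invariant :: "nat \<Rightarrow> (complex \<Rightarrow> complex \<Rightarrow> complex \<Rightarrow> complex) \<Rightarrow> bool" where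
  "jacobi_invariant k G \<longleftrightarrow>
     (\<forall>\<tau> z \<sigma>. H2_point \<tau> z \<sigma> \<longrightarrow> G \<sigma> z \<tau> = G \<tau> z \<sigma>) \<and>
     (\<forall>\<tau> z \<sigma>. H2_point \<tau> z \<sigma> \<longrightarrow> G \<tau> (z + \<tau>) (\<sigma> + 2 * z + \<tau>) = G \<tau> z \<sigma>) \<and>
     (\<forall>\<tau> x \<sigma>. Im \<tau> > 0 \<longrightarrow> Im \<sigma> > 0 \<longrightarrow>
        G (- 1 / \<tau>) (of_real x / \<tau>) (\<sigma> - (of_real x)\<^sup>2 / \<tau>) = \<tau> ^ k * G \<tau> (of_real x) \<sigma>)"

lemma H2_point_swap: "H2_point \<tau> z \<sigma> \<Longrightarrow> H2_point \<sigma> z \<tau>"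
proof -
  assume h: "H2_point \<tau> z \<sigma>"
  have "0 < Im \<tau> * Im \<sigma>" using h zero_le_power2[of "Im z"] unfolding H2_point_def by linarith
  thus ?thesis using h unfolding H2_point_def by (auto simp: zero_less_mult_iff mult.commute)
qed

lemma H2_point_shear: "H2_point \<tau> z \<sigma> \<Longrightarrow> H2_point \<tau> (z + \<tau>) (\<sigma> + 2 * z + \<tau>)"
  unfolding H2_point_def by (simp add: power2_eq_square algebra_simps)

lemma H2_point_inversion:
  assumes "Im \<tau> > 0" "Im \<sigma> > 0"
  shows "H2_point (- 1 / \<tau>) (of_real x / \<tau>) (\<sigma> - (of_real x)\<^sup>2 / \<tau>)"
proof -
  define d where "d = (Re \<tau>)\<^sup>2 + (Im \<tau>)\<^sup>2"
  have d: "d > 0" using assms by (auto simp: d_def intro: add_nonneg_pos)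
  have 1: "Im (- 1 / \<tau>) = Im \<tau> / d" by (simp add: Im_divide d_def)
  have 2: "Im (of_real x / \<tau>) = - (x * Im \<tau> / d)" by (simp add: Im_divide d_def)
  have 3: "Im (\<sigma> - (of_real x)\<^sup>2 / \<tau>) = Im \<sigma> + x\<^sup>2 * Im \<tau> / d"
    using Im_divide[of "(of_real x)\<^sup>2" \<tau>] by (simp add: d_def flip: of_real_power)
  have "Im \<tau> / d * (Im \<sigma> + x\<^sup>2 * Im \<tau> / d) = (x * Im \<tau> / d)\<^sup>2 + Im \<tau> * Im \<sigma> / d"
    by (simp add: power2_eq_square algebra_simps)
  moreover have "Im \<tau> * Im \<sigma> / d > 0" using assms d by simp
  moreover have "Im \<tau> / d > 0" using assms d by simp
  ultimately show ?thesis unfolding H2_point_def 1 2 3 by simp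
qed

text \<open>Equality of functions gives equality of coefficients, by uniqueness of Fourier expansions.\<close>
lemma siegel_coeff_swap:
  assumes E: "siegel_expansion A G" and J: "jacobi_invariant k G"
  shows "A m \<rho> n = A n \<rho> m"
proof -
  show ?thesis
  proof (rule siegel_fourier_unique[where A = "\<lambda>n \<rho> m. A m \<rho> n" and B = A and g = G])
    fix \<tau> z \<sigma> assume h: "H2_point \<tau> z \<sigma>"
    show "(siegel_term A \<tau> z \<sigma> has_sum G \<tau> z \<sigma>) UNIV" using E h unfolding siegel_expansion_def by blast
    have "(siegel_term A \<sigma> z \<tau> has_sum G \<sigma> z \<tau>) UNIV" using E H2_point_swap[OF h] unfolding siegel_expansion_def by blast
    moreover have "G \<sigma> z \<tau> = G \<tau> z \<sigma>" using J h unfolding jacobi_invariant_def by blast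
    ultimately have hs: "(siegel_term A \<sigma> z \<tau> has_sum G \<tau> z \<sigma>) UNIV" by simp
    show "(siegel_term (\<lambda>n \<rho> m. A m \<rho> n) \<tau> z \<sigma> has_sum G \<tau> z \<sigma>) UNIV"
      by (rule has_sum_reindex_bij_witness[THEN iffD2, OF _ _ _ _ _ _ hs, of _ "\<lambda>(n, \<rho>, m). (m, \<rho>, n)" "\<lambda>(n, \<rho>, m). (m, \<rho>, n)"])
         (auto simp: siegel_term_def add_ac)
  qed
qed

text \<open>The substitution \<open>y \<mapsto> x + y\<close> in the quadratic form; for theta series, the replacement of \<open>x\<close> by \<open>x + y\<close> in a pair of vectors.\<close>
lemma siegel_coeff_shear:
  assumes E: "siegel_expansion A G" and J: "jacobi_invariant k G"
  shows "A (n + \<rho> + m) (\<rho> + 2 * m) m = A n \<rho> m"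
proof -
  have "A n' \<rho>' m' = A (n' - \<rho>' + m') (\<rho>' - 2 * m') m'" for n' \<rho>' m'
  proof (rule siegel_fourier_unique[where A = A and B = "\<lambda>n \<rho> m. A (n - \<rho> + m) (\<rho> - 2 * m) m" and g = G])
    fix \<tau> z \<sigma> assume h: "H2_point \<tau> z \<sigma>"
    show "(siegel_term A \<tau> z \<sigma> has_sum G \<tau> z \<sigma>) UNIV" using E h unfolding siegel_expansion_def by blast
    have "(siegel_term A \<tau> (z + \<tau>) (\<sigma> + 2 * z + \<tau>) has_sum G \<tau> (z + \<tau>) (\<sigma> + 2 * z + \<tau>)) UNIV"
      using E H2_point_shear[OF h] unfolding siegel_expansion_def by blast
    moreover have "G \<tau> (z + \<tau>) (\<sigma> + 2 * z + \<tau>) = G \<tau> z \<sigma>" using J h unfolding jacobi_invariant_def by blast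
    ultimately have hs: "(siegel_term A \<tau> (z + \<tau>) (\<sigma> + 2 * z + \<tau>) has_sum G \<tau> z \<sigma>) UNIV" by simp
    show "(siegel_term (\<lambda>n \<rho> m. A (n - \<rho> + m) (\<rho> - 2 * m) m) \<tau> z \<sigma> has_sum G \<tau> z \<sigma>) UNIV"
      by (rule has_sum_reindex_bij_witness[THEN iffD2, OF _ _ _ _ _ _ hs, of _ "\<lambda>(n, \<rho>, m). (n + \<rho> + m, \<rho> + 2 * m, m)" "\<lambda>(n, \<rho>, m). (n - \<rho> + m, \<rho> - 2 * m, m)"])
         (auto simp: siegel_term_def algebra_simps)
  qed
  from this[of "n + \<rho> + m" "\<rho> + 2 * m" m] show ?thesis by simp
qed

text \<open>Pair \<open>a\<close> with the polynomial of degree at most \<open>d\<close> that vanishes on \<open>S\<close> except at \<open>\<rho>\<close>.\<close>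
lemma moments_determine:
  fixes a :: "int \<Rightarrow> complex"
  assumes S: "finite S" "card S \<le> Suc d" and mom: "\<And>j. j \<le> d \<Longrightarrow> (\<Sum>\<rho>\<in>S. a \<rho> * of_int \<rho> ^ j) = 0"
    and \<rho>: "\<rho> \<in> S"
  shows "a \<rho> = 0"
proof -
  define p :: "complex poly" where "p = (\<Prod>\<sigma>\<in>S - {\<rho>}. [:- of_int \<sigma>, 1:])"
  have deg: "degree p \<le> d"
  proof -
    have "degree p \<le> (\<Sum>\<sigma>\<in>S - {\<rho>}. degree [:- of_int \<sigma>, 1 :: complex:])"
      unfolding p_def using S(1) degree_prod_sum_le[of "S - {\<rho>}" "\<lambda>\<sigma>. [:- of_int \<sigma>, 1 :: complex:]"] by (simp add: o_def)
    also have "\<dots> = card (S - {\<rho>})" by simp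
    also have "\<dots> \<le> d" using S \<rho> by simp
    finally show ?thesis .
  qed
  have eval: "poly p x = (\<Prod>\<sigma>\<in>S - {\<rho>}. x - of_int \<sigma>)" for x
    by (simp add: p_def poly_prod)
  have "(\<Sum>\<sigma>\<in>S. a \<sigma> * poly p (of_int \<sigma>)) = (\<Sum>\<sigma>\<in>S. \<Sum>j\<le>d. coeff p j * (a \<sigma> * of_int \<sigma> ^ j))"
  proof (rule sum.cong[OF refl])
    fix \<sigma>
    have "poly p (of_int \<sigma>) = (\<Sum>j\<le>d. coeff p j * of_int \<sigma> ^ j)"
      unfolding poly_altdef using deg by (intro sum.mono_neutral_left) (auto simp: coeff_eq_0)
    thus "a \<sigma> * poly p (of_int \<sigma>) = (\<Sum>j\<le>d. coeff p j * (a \<sigma> * of_int \<sigma> ^ j))"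
      by (simp add: sum_distrib_left mult_ac)
  qed
  also have "\<dots> = (\<Sum>j\<le>d. coeff p j * (\<Sum>\<sigma>\<in>S. a \<sigma> * of_int \<sigma> ^ j))"
    by (subst sum.swap) (simp only: sum_distrib_left)
  also have "\<dots> = 0" using mom by simp
  finally have "(\<Sum>\<sigma>\<in>S. a \<sigma> * poly p (of_int \<sigma>)) = 0" .
  moreover have "(\<Sum>\<sigma>\<in>S. a \<sigma> * poly p (of_int \<sigma>)) = (\<Sum>\<sigma>\<in>{\<rho>}. a \<sigma> * poly p (of_int \<sigma>))"
    using S \<rho> by (intro sum.mono_neutral_right) (auto simp: eval)
  ultimately have "a \<rho> * poly p (of_int \<rho>) = 0" by simp
  moreover have "poly p (of_int \<rho>) \<noteq> 0" unfolding eval using S by simp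
  ultimately show ?thesis by simp
qed

section \<open>Taylor coefficients of Fourier-Jacobi coefficients\<close>

text \<open>The coefficient of \<open>e2 (m * \<sigma>)\<close> in an expansion of degree two.\<close>
definition fourier_jacobi_coeff :: "(int \<Rightarrow> int \<Rightarrow> int \<Rightarrow> complex) \<Rightarrow> int \<Rightarrow> complex \<Rightarrow> complex \<Rightarrow> complex" where
  "fourier_jacobi_coeff A m \<tau> z = (\<Sum>\<^sub>\<infinity>(n, \<rho>). A n \<rho> m * e2 (of_int n * \<tau> + of_int \<rho> * z))"

lemma siegel_expansion_summable:
  assumes "siegel_expansion A G" "H2_point \<tau> z \<sigma>"
  shows "siegel_term A \<tau> z \<sigma> summable_on UNIV"
  using assms unfolding siegel_expansion_def by (blast intro: has_sum_imp_summable)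

lemma exists_H2_point: "Im \<tau> > 0 \<Longrightarrow> \<exists>\<sigma>. H2_point \<tau> z \<sigma>"
proof -
  assume t: "Im \<tau> > 0"
  have "H2_point \<tau> z (\<i> * of_real (((Im z)\<^sup>2 + 1) / Im \<tau>))"
    using t by (simp add: H2_point_def)
  thus ?thesis ..
qed

lemma infsum_fiber_siegel_term:
  "infsum (siegel_term A \<tau> z \<sigma>) {p \<in> UNIV. snd (snd p) = m} = fourier_jacobi_coeff A m \<tau> z * e2 (of_int m * \<sigma>)"
proof -
  have "infsum (siegel_term A \<tau> z \<sigma>) {p \<in> UNIV. snd (snd p) = m} =
      infsum (\<lambda>p. (case p of (n, \<rho>) \<Rightarrow> A n \<rho> m * e2 (of_int n * \<tau> + of_int \<rho> * z)) * e2 (of_int m * \<sigma>)) UNIV"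
    by (rule infsum_reindex_bij_witness[of _ "\<lambda>(n, \<rho>). (n, \<rho>, m)" "\<lambda>(n, \<rho>, m). (n, \<rho>)"])
       (auto simp: siegel_term_def e2_add)
  thus ?thesis unfolding fourier_jacobi_coeff_def infsum_cmult_left' .
qed

lemma fourier_jacobi_summable:
  assumes E: "siegel_expansion A G" and t: "Im \<tau> > 0"
  shows "(\<lambda>(n, \<rho>). A n \<rho> m * e2 (of_int n * \<tau> + of_int \<rho> * z)) summable_on UNIV"
proof -
  obtain \<sigma> where "H2_point \<tau> z \<sigma>" using exists_H2_point[OF t] by blast
  hence "siegel_term A \<tau> z \<sigma> summable_on {p. snd (snd p) = m}"
    using siegel_expansion_summable[OF E] by (blast intro: summable_on_subset_banach)
  also have "?this \<longleftrightarrow> (\<lambda>p. (case p of (n, \<rho>) \<Rightarrow> A n \<rho> m * e2 (of_int n * \<tau> + of_int \<rho> * z)) * e2 (of_int m * \<sigma>)) summable_on UNIV"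
    by (rule summable_on_reindex_bij_witness[of _ "\<lambda>(n, \<rho>). (n, \<rho>, m)" "\<lambda>(n, \<rho>, m). (n, \<rho>)"])
       (auto simp: siegel_term_def e2_add)
  finally show ?thesis by (simp add: summable_on_cmult_left')
qed

text \<open>The transformation law of a Jacobi form of index \<open>m\<close>, obtained by comparing coefficients in the variable \<open>\<sigma>\<close>.\<close>
lemma fourier_jacobi_inversion:
  assumes E: "siegel_expansion A G" and J: "jacobi_invariant k G" and t: "Im \<tau> > 0"
  shows "fourier_jacobi_coeff A m (- 1 / \<tau>) (of_real x / \<tau>) * e2 (- (of_int m * (of_real x)\<^sup>2 / \<tau>)) = \<tau> ^ k * fourier_jacobi_coeff A m \<tau> (of_real x)"
proof -
  define a where "a = (\<lambda>p. siegel_term A (- 1 / \<tau>) (of_real x / \<tau>) (\<i> - (of_real x)\<^sup>2 / \<tau>) p - \<tau> ^ k * siegel_term A \<tau> (of_real x) \<i> p)"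
  have sh: "siegel_term A t' z' (s' + of_real y) p = siegel_term A t' z' s' p * e2 (of_int (snd (snd p)) * of_real y)" for t' z' s' y p
    by (cases p) (simp add: siegel_term_def e2_add[symmetric] algebra_simps)
  have H: "H2_point (- 1 / \<tau>) (of_real x / \<tau>) (\<i> - (of_real x)\<^sup>2 / \<tau>)" "H2_point \<tau> (of_real x) \<i>"
    using H2_point_inversion[OF t, of \<i> x] t by (auto simp: H2_point_def)
  have s1: "siegel_term A (- 1 / \<tau>) (of_real x / \<tau>) (\<i> - (of_real x)\<^sup>2 / \<tau>) summable_on UNIV"
    and s2: "siegel_term A \<tau> (of_real x) \<i> summable_on UNIV"
    by (rule siegel_expansion_summable[OF E], rule H)+
  have sd: "a summable_on J" for J
  proof -
    have "(\<lambda>p. siegel_term A (- 1 / \<tau>) (of_real x / \<tau>) (\<i> - (of_real x)\<^sup>2 / \<tau>) p + - (\<tau> ^ k) * siegel_term A \<tau> (of_real x) \<i> p) summable_on UNIV"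
      by (intro summable_on_add summable_on_cmult_right s1 s2)
    hence "a summable_on UNIV" by (simp add: a_def)
    thus ?thesis by (rule summable_on_subset_banach) auto
  qed
  have zero: "infsum (\<lambda>p. a p * e2 (of_int (snd (snd p)) * of_real y)) UNIV = 0" for y :: real
  proof -
    have Hy: "H2_point (- 1 / \<tau>) (of_real x / \<tau>) (\<i> - (of_real x)\<^sup>2 / \<tau> + of_real y)" "H2_point \<tau> (of_real x) (\<i> + of_real y)"
      using H by (simp_all add: H2_point_def)
    have "((\<lambda>p. siegel_term A (- 1 / \<tau>) (of_real x / \<tau>) (\<i> - (of_real x)\<^sup>2 / \<tau> + of_real y) p
          + - (\<tau> ^ k) * siegel_term A \<tau> (of_real x) (\<i> + of_real y) p) has_sum
          (G (- 1 / \<tau>) (of_real x / \<tau>) (\<i> - (of_real x)\<^sup>2 / \<tau> + of_real y) + - (\<tau> ^ k) * G \<tau> (of_real x) (\<i> + of_real y))) UNIV"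
      using E Hy unfolding siegel_expansion_def by (intro has_sum_add has_sum_cmult_right) blast+
    moreover have "G (- 1 / \<tau>) (of_real x / \<tau>) ((\<i> + of_real y) - (of_real x)\<^sup>2 / \<tau>) = \<tau> ^ k * G \<tau> (of_real x) (\<i> + of_real y)"
      using J t unfolding jacobi_invariant_def by simp
    ultimately have "((\<lambda>p. a p * e2 (of_int (snd (snd p)) * of_real y)) has_sum 0) UNIV"
      unfolding sh a_def by (simp add: algebra_simps)
    thus ?thesis by (rule infsumI)
  qed
  have "0 = infsum a {p \<in> UNIV. snd (snd p) = m}"
    by (rule fourier_fiber_sum_zero[OF sd zero, symmetric])
  also have "\<dots> = infsum (\<lambda>p. siegel_term A (- 1 / \<tau>) (of_real x / \<tau>) (\<i> - (of_real x)\<^sup>2 / \<tau>) p + - (\<tau> ^ k) * siegel_term A \<tau> (of_real x) \<i> p) {p \<in> UNIV. snd (snd p) = m}"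
    by (simp add: a_def)
  also have "\<dots> = infsum (siegel_term A (- 1 / \<tau>) (of_real x / \<tau>) (\<i> - (of_real x)\<^sup>2 / \<tau>)) {p \<in> UNIV. snd (snd p) = m}
       + - (\<tau> ^ k) * infsum (siegel_term A \<tau> (of_real x) \<i>) {p \<in> UNIV. snd (snd p) = m}"
    unfolding infsum_cmult_right'[symmetric]
    by (intro infsum_add summable_on_cmult_right summable_on_subset_banach[OF s1] summable_on_subset_banach[OF s2]) auto
  finally have "fourier_jacobi_coeff A m (- 1 / \<tau>) (of_real x / \<tau>) * e2 (of_int m * (\<i> - (of_real x)\<^sup>2 / \<tau>)) = \<tau> ^ k * (fourier_jacobi_coeff A m \<tau> (of_real x) * e2 (of_int m * \<i>))"
    unfolding infsum_fiber_siegel_term by (simp add: add_eq_0_iff)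
  moreover have "e2 (of_int m * (\<i> - (of_real x)\<^sup>2 / \<tau>)) = e2 (- (of_int m * (of_real x)\<^sup>2 / \<tau>)) * e2 (of_int m * \<i>)"
    unfolding e2_add[symmetric] by (simp add: algebra_simps)
  ultimately show ?thesis by (simp add: mult.assoc[symmetric])
qed

text \<open>The \<open>j\<close>-th Taylor coefficient at \<open>z = 0\<close> of the Fourier-Jacobi coefficient of index \<open>m\<close>.\<close>
definition taylor_coeff :: "(int \<Rightarrow> int \<Rightarrow> int \<Rightarrow> complex) \<Rightarrow> int \<Rightarrow> complex \<Rightarrow> nat \<Rightarrow> complex" where
  "taylor_coeff A m \<tau> j = (2 * of_real pi * \<i>) ^ j / fact j * (\<Sum>\<^sub>\<infinity>(n, \<rho>). A n \<rho> m * of_int \<rho> ^ j * e2 (of_int n * \<tau>))"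

text \<open>Expand \<open>e2 (\<rho> * z)\<close> into its exponential series and exchange the sums. The double series converges absolutely, because
\<open>exp (2 * pi * \<bar>\<rho>\<bar> * norm z)\<close> is at most the sum of the absolute values of \<open>e2 (\<rho> * z)\<close> at the two imaginary points of absolute value \<open>norm z\<close>.\<close>
lemma fourier_jacobi_taylor:
  assumes E: "siegel_expansion A G" and t: "Im \<tau> > 0"
  shows "(\<lambda>(n, \<rho>). A n \<rho> m * of_int \<rho> ^ j * e2 (of_int n * \<tau>)) summable_on UNIV"
    and "(\<lambda>j. taylor_coeff A m \<tau> j * z ^ j) sums fourier_jacobi_coeff A m \<tau> z"
proof -
  define w where "w = (\<lambda>(p::int\<times>int) z. 2 * of_real pi * \<i> * of_int (snd p) * z)"
  \<comment> \<open>The index \<open>p\<close> is the pair \<open>(n, \<rho>)\<close>.\<close>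
  define F where "F = (\<lambda>z (p::int\<times>int, j::nat). A (fst p) (snd p) m * e2 (of_int (fst p) * \<tau>) * (w p z ^ j /\<^sub>R fact j))"
  have exps: "((\<lambda>j. u ^ j /\<^sub>R fact j) has_sum exp u) UNIV" for u :: complex
    by (rule norm_summable_imp_has_sum[OF summable_norm_exp exp_converges])
  have nexps: "((\<lambda>j. norm (u ^ j /\<^sub>R fact j)) has_sum exp (norm u)) UNIV" for u :: complex
  proof -
    have eq: "norm (u ^ j /\<^sub>R fact j) = norm u ^ j /\<^sub>R fact j" for j by (simp add: norm_power)
    have "(\<lambda>j. norm (norm u ^ j /\<^sub>R fact j)) = (\<lambda>j. norm u ^ j /\<^sub>R fact j)" by auto
    thus ?thesis unfolding eq using summable_norm_exp[of "norm u"]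
      by (intro norm_summable_imp_has_sum exp_converges) auto
  qed
  have Fs: "F z summable_on UNIV \<times> UNIV" for z
  proof (rule summable_on_times_bound)
    define c where "c = norm z"
    have sg: "(\<lambda>p. norm ((case p of (n, \<rho>) \<Rightarrow> A n \<rho> m * e2 (of_int n * \<tau> + of_int \<rho> * (\<i> * of_real d))))) summable_on UNIV" for d :: real
      using fourier_jacobi_summable[OF E t, of m "\<i> * of_real d"] by (simp only: summable_on_iff_abs_summable_on_complex)
    show "(\<lambda>p. norm ((case p of (n, \<rho>) \<Rightarrow> A n \<rho> m * e2 (of_int n * \<tau> + of_int \<rho> * (\<i> * of_real c)))) +
         norm ((case p of (n, \<rho>) \<Rightarrow> A n \<rho> m * e2 (of_int n * \<tau> + of_int \<rho> * (\<i> * of_real (- c)))))) summable_on UNIV"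
      by (intro summable_on_add sg)
    fix p :: "int \<times> int"
    have nF: "norm (F z (p, j)) = norm (A (fst p) (snd p) m * e2 (of_int (fst p) * \<tau>)) * norm (w p z ^ j /\<^sub>R fact j)" for j
      by (simp only: F_def prod.case norm_mult)
    show "(\<lambda>j. norm (F z (p, j))) summable_on UNIV"
      unfolding nF by (intro summable_on_cmult_right has_sum_imp_summable[OF nexps])
    have "infsum (\<lambda>j. norm (F z (p, j))) UNIV = norm (A (fst p) (snd p) m * e2 (of_int (fst p) * \<tau>)) * exp (norm (w p z))"
      unfolding nF infsum_cmult_right' infsumI[OF nexps] ..
    also have "exp (norm (w p z)) \<le> norm (e2 (of_int (snd p) * (\<i> * of_real c))) + norm (e2 (of_int (snd p) * (\<i> * of_real (- c))))"
    proof -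
      have "norm (w p z) = 2 * pi * \<bar>of_int (snd p)\<bar> * c" by (simp add: w_def norm_mult c_def)
      thus ?thesis unfolding norm_e2 by (cases "snd p \<ge> 0") (auto simp: mult_ac)
    qed
    hence "norm (A (fst p) (snd p) m * e2 (of_int (fst p) * \<tau>)) * exp (norm (w p z)) \<le>
       norm (A (fst p) (snd p) m * e2 (of_int (fst p) * \<tau>)) * (norm (e2 (of_int (snd p) * (\<i> * of_real c))) + norm (e2 (of_int (snd p) * (\<i> * of_real (- c)))))"
      by (rule mult_left_mono) simp
    also have "\<dots> = norm ((case p of (n, \<rho>) \<Rightarrow> A n \<rho> m * e2 (of_int n * \<tau> + of_int \<rho> * (\<i> * of_real c)))) +
         norm ((case p of (n, \<rho>) \<Rightarrow> A n \<rho> m * e2 (of_int n * \<tau> + of_int \<rho> * (\<i> * of_real (- c)))))"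
      unfolding case_prod_unfold e2_add norm_mult by (simp add: algebra_simps)
    finally show "infsum (\<lambda>j. norm (F z (p, j))) UNIV \<le> \<dots>" .
  qed
  have Fterm: "F z (p, j) = ((2 * of_real pi * \<i>) ^ j / fact j * z ^ j) * (case p of (n, \<rho>) \<Rightarrow> A n \<rho> m * of_int \<rho> ^ j * e2 (of_int n * \<tau>))" for z p j
  proof -
    have "w p z ^ j = (2 * of_real pi * \<i>) ^ j * z ^ j * of_int (snd p) ^ j" by (simp add: w_def power_mult_distrib mult_ac)
    thus ?thesis by (simp add: F_def case_prod_unfold scaleR_conv_of_real field_simps)
  qed
  have Fswap: "(\<lambda>(j, p). F z (p, j)) summable_on UNIV \<times> UNIV" for z
    using Fs[of z] by (subst (asm) summable_on_swap) simp
  show "(\<lambda>(n, \<rho>). A n \<rho> m * of_int \<rho> ^ j * e2 (of_int n * \<tau>)) summable_on UNIV"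
  proof -
    have "(\<lambda>p. F 1 (p, j)) summable_on UNIV"
      using summable_on_SigmaD1[OF Fswap[of 1], of j] by simp
    thus ?thesis unfolding Fterm by (subst (asm) summable_on_cmult_right') auto
  qed
  show "(\<lambda>j. taylor_coeff A m \<tau> j * z ^ j) sums fourier_jacobi_coeff A m \<tau> z"
  proof (rule has_sum_imp_sums)
    have inner: "infsum (\<lambda>p. F z (p, j)) UNIV = taylor_coeff A m \<tau> j * z ^ j" for j
      unfolding Fterm infsum_cmult_right' taylor_coeff_def by (simp add: mult_ac)
    have "(\<lambda>j. infsum (\<lambda>p. F z (p, j)) UNIV) summable_on UNIV"
      using summable_on_Sigma_banach[OF Fswap[of z]] by simp
    hence s: "(\<lambda>j. taylor_coeff A m \<tau> j * z ^ j) summable_on UNIV" unfolding inner .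
    have "infsum (\<lambda>j. taylor_coeff A m \<tau> j * z ^ j) UNIV = infsum (\<lambda>j. infsum (\<lambda>p. F z (p, j)) UNIV) UNIV"
      unfolding inner ..
    also have "\<dots> = infsum (\<lambda>p. infsum (\<lambda>j. F z (p, j)) UNIV) UNIV"
      by (rule infsum_swap_banach[OF Fswap])
    also have "\<dots> = infsum (\<lambda>p. A (fst p) (snd p) m * e2 (of_int (fst p) * \<tau>) * exp (w p z)) UNIV"
      by (simp only: F_def prod.case infsum_cmult_right' infsumI[OF exps])
    also have "\<dots> = fourier_jacobi_coeff A m \<tau> z"
      unfolding fourier_jacobi_coeff_def by (intro infsum_cong) (simp add: case_prod_unfold e2_add w_def, simp add: e2_def mult_ac)
    finally show "((\<lambda>j. taylor_coeff A m \<tau> j * z ^ j) has_sum fourier_jacobi_coeff A m \<tau> z) UNIV"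
      using s by (simp add: has_sum_iff)
  qed
qed

text \<open>The factor \<open>c\<close> allows one to approach zero along an arbitrary complex direction while the variable stays real.\<close>
lemma powser_leading_limit:
  fixes b :: "nat \<Rightarrow> complex"
  assumes s: "\<And>z. (\<lambda>j. b j * z ^ j) sums f z" and z: "\<And>j. j < \<nu> \<Longrightarrow> b j = 0"
  shows "((\<lambda>x::real. f (of_real x * c) / of_real x ^ \<nu>) \<longlongrightarrow> b \<nu> * c ^ \<nu>) (at 0)"
proof -
  define g where "g = (\<lambda>z. \<Sum>j. b (j + \<nu>) * z ^ j)"
  have g: "(\<lambda>j. b (j + \<nu>) * z ^ j) sums g z" "f z = z ^ \<nu> * g z" for z
    unfolding g_def by (rule powser_leading_factor[OF s z], assumption)+
  have "g holomorphic_on ball 0 1"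
    by (rule power_series_holomorphic[where a = "\<lambda>j. b (j + \<nu>)"]) (use g in auto)
  hence "isCont g 0"
    using holomorphic_on_imp_continuous_on continuous_on_eq_continuous_at[OF open_ball] by (metis centre_in_ball zero_less_one)
  hence lim: "(g \<longlongrightarrow> b \<nu>) (nhds 0)"
    using g(1)[of 0] powser_sums_zero_iff[of "\<lambda>j. b (j + \<nu>)" "g 0"] by (simp add: isCont_def tendsto_at_iff_tendsto_nhds)
  have "((\<lambda>x::real. of_real x * c) \<longlongrightarrow> of_real 0 * c) (at 0)" by (intro tendsto_intros)
  hence "filterlim (\<lambda>x::real. of_real x * c) (nhds 0) (at 0)" by simp
  from filterlim_compose[OF lim this] have "((\<lambda>x::real. c ^ \<nu> * g (of_real x * c)) \<longlongrightarrow> c ^ \<nu> * b \<nu>) (at 0)"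
    by (intro tendsto_mult_left)
  moreover have "\<forall>\<^sub>F x::real in at 0. c ^ \<nu> * g (of_real x * c) = f (of_real x * c) / of_real x ^ \<nu>"
    by (rule eventually_at_ball'[of 1 0 UNIV, THEN eventually_mono]) (use g in \<open>auto simp: power_mult_distrib\<close>)
  ultimately show ?thesis
    using Lim_transform_eventually by (fastforce simp: mult.commute)
qed

text \<open>Divide the transformation law of the Fourier-Jacobi coefficient by \<open>z ^ \<nu>\<close> and let \<open>z\<close> tend to zero. On the left, the argument \<open>z / \<tau>\<close>
produces the extra factor \<open>\<tau> ^ \<nu>\<close> in the weight, and the exponential factor of the index tends to 1.\<close>
lemma taylor_coeff_modular:
  assumes E: "siegel_expansion A G" and J: "jacobi_invariant k G" and t: "Im \<tau> > 0"
    and low: "\<And>\<tau> j. Im \<tau> > 0 \<Longrightarrow> j < \<nu> \<Longrightarrow> taylor_coeff A m \<tau> j = 0"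
  shows "taylor_coeff A m (- 1 / \<tau>) \<nu> = \<tau> ^ (k + \<nu>) * taylor_coeff A m \<tau> \<nu>"
proof -
  have t': "Im (- 1 / \<tau>) > 0" by (rule Im_neg_inverse_pos[OF t])
  have t0: "\<tau> \<noteq> 0" using t by auto
  have l1: "((\<lambda>x::real. fourier_jacobi_coeff A m (- 1 / \<tau>) (of_real x * (1 / \<tau>)) / of_real x ^ \<nu>) \<longlongrightarrow> taylor_coeff A m (- 1 / \<tau>) \<nu> * (1 / \<tau>) ^ \<nu>) (at 0)"
    by (rule powser_leading_limit[OF fourier_jacobi_taylor(2)[OF E t'] low[OF t']])
  have l2: "((\<lambda>x::real. fourier_jacobi_coeff A m \<tau> (of_real x * 1) / of_real x ^ \<nu>) \<longlongrightarrow> taylor_coeff A m \<tau> \<nu> * 1 ^ \<nu>) (at 0)"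
    by (rule powser_leading_limit[OF fourier_jacobi_taylor(2)[OF E t] low[OF t]])
  have "((\<lambda>x::real. e2 (- (of_int m * (of_real x)\<^sup>2 / \<tau>))) \<longlongrightarrow> e2 (- (of_int m * (of_real 0)\<^sup>2 / \<tau>))) (at 0)"
    unfolding e2_def by (intro tendsto_intros) (use t0 in auto)
  from tendsto_mult[OF l1 this]
  have l3: "((\<lambda>x::real. fourier_jacobi_coeff A m (- 1 / \<tau>) (of_real x * (1 / \<tau>)) / of_real x ^ \<nu> * e2 (- (of_int m * (of_real x)\<^sup>2 / \<tau>))) \<longlongrightarrow> taylor_coeff A m (- 1 / \<tau>) \<nu> * (1 / \<tau>) ^ \<nu>) (at 0)"
    by simp
  have eq: "fourier_jacobi_coeff A m (- 1 / \<tau>) (of_real x * (1 / \<tau>)) / of_real x ^ \<nu> * e2 (- (of_int m * (of_real x)\<^sup>2 / \<tau>)) =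
      \<tau> ^ k * (fourier_jacobi_coeff A m \<tau> (of_real x * 1) / of_real x ^ \<nu>)" for x
    using fourier_jacobi_inversion[OF E J t, of m x] by simp
  have "((\<lambda>x::real. \<tau> ^ k * (fourier_jacobi_coeff A m \<tau> (of_real x * 1) / of_real x ^ \<nu>)) \<longlongrightarrow> \<tau> ^ k * (taylor_coeff A m \<tau> \<nu> * 1 ^ \<nu>)) (at 0)"
    by (rule tendsto_mult_left[OF l2])
  from tendsto_unique[OF _ l3[unfolded eq] this]
  have "taylor_coeff A m (- 1 / \<tau>) \<nu> * (1 / \<tau>) ^ \<nu> = \<tau> ^ k * taylor_coeff A m \<tau> \<nu>" by simp
  thus ?thesis using t0 by (simp add: power_divide power_add field_simps)
qed

section \<open>Vanishing of the Fourier coefficients\<close>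

text \<open>The sum extends over all \<open>\<rho>\<close>; the restriction to the support, which is finite, makes it a finite sum.\<close>
definition moment :: "(int \<Rightarrow> int \<Rightarrow> int \<Rightarrow> complex) \<Rightarrow> int \<Rightarrow> nat \<Rightarrow> int \<Rightarrow> complex" where
  "moment A m j n = (\<Sum>\<rho> | A n \<rho> m \<noteq> 0. A n \<rho> m * of_int \<rho> ^ j)"

lemma psd_supportedD:
  assumes "psd_supported A" "A n \<rho> m \<noteq> 0"
  shows "n \<ge> 0" "m \<ge> 0" "\<rho>\<^sup>2 \<le> 4 * n * m"
  using assms unfolding psd_supported_def by blast+

lemma finite_support_row:
  assumes "psd_supported A"
  shows "finite {\<rho>. A n \<rho> m \<noteq> 0}"
proof (rule finite_subset)
  show "{\<rho>. A n \<rho> m \<noteq> 0} \<subseteq> {- (4 * n * m)..4 * n * m}"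
  proof
    fix \<rho> assume "\<rho> \<in> {\<rho>. A n \<rho> m \<noteq> 0}"
    hence sq: "\<rho>\<^sup>2 \<le> 4 * n * m" using psd_supportedD(3)[OF assms] by blast
    have "\<bar>\<rho>\<bar> * 1 \<le> \<bar>\<rho>\<bar> * \<bar>\<rho>\<bar>" if "\<rho> \<noteq> 0" using that by (intro mult_left_mono) auto
    hence "\<bar>\<rho>\<bar> \<le> \<rho>\<^sup>2" by (cases "\<rho> = 0") (auto simp: power2_eq_square)
    with sq show "\<rho> \<in> {- (4 * n * m)..4 * n * m}" by auto
  qed
qed simp

lemma moment_eq_sum:
  assumes "finite S" "{\<rho>. A n \<rho> m \<noteq> 0} \<subseteq> S"
  shows "moment A m j n = (\<Sum>\<rho>\<in>S. A n \<rho> m * of_int \<rho> ^ j)"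
  unfolding moment_def using assms by (intro sum.mono_neutral_left) auto

text \<open>Up to a constant, the moments are the coefficients of the \<open>q\<close>-expansion of a Taylor coefficient.\<close>
lemma taylor_coeff_moments:
  assumes E: "siegel_expansion A G" and t: "Im \<tau> > 0"
  shows "(\<lambda>n. moment A m j (int n) * e2 \<tau> ^ n) sums (fact j / (2 * of_real pi * \<i>) ^ j * taylor_coeff A m \<tau> j)"
proof -
  have psd: "psd_supported A" using E by (simp add: siegel_expansion_def)
  define f where "f = (\<lambda>(n, \<rho>). A n \<rho> m * of_int \<rho> ^ j * e2 (of_int n * \<tau>))"
  have s: "f summable_on UNIV \<times> UNIV" using fourier_jacobi_taylor(1)[OF E t, of m j] by (simp add: f_def)
  have row: "((\<lambda>\<rho>. f (n, \<rho>)) has_sum moment A m j n * e2 (of_int n * \<tau>)) UNIV" for n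
  proof (rule has_sum_finite_neutralI[where B = "{\<rho>. A n \<rho> m \<noteq> 0}"])
    show "moment A m j n * e2 (of_int n * \<tau>) = (\<Sum>\<rho> | A n \<rho> m \<noteq> 0. f (n, \<rho>))"
      by (simp add: moment_def f_def sum_distrib_right)
  qed (use finite_support_row[OF psd] in \<open>auto simp: f_def\<close>)
  have "(f has_sum infsum f UNIV) (UNIV \<times> UNIV)" using s by simp
  from has_sum_SigmaD[OF this row]
  have hs: "((\<lambda>n. moment A m j n * e2 (of_int n * \<tau>)) has_sum infsum f UNIV) UNIV" .
  have neg: "moment A m j n = 0" if "n < 0" for n
    unfolding moment_def using psd_supportedD(1)[OF psd] that by (intro sum.neutral) force
  have "((\<lambda>n. moment A m j n * e2 (of_int n * \<tau>)) has_sum infsum f UNIV) {0..}"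
    by (rule has_sum_cong_neutral[THEN iffD1, OF _ _ _ hs]) (use neg in auto)
  hence "((\<lambda>n::nat. moment A m j (int n) * e2 (of_int (int n) * \<tau>)) has_sum infsum f UNIV) UNIV"
    by (subst has_sum_reindex_bij_witness[of _ nat int "{0..}"]) auto
  hence "(\<lambda>n. moment A m j (int n) * e2 \<tau> ^ n) sums infsum f UNIV"
    by (intro has_sum_imp_sums) (simp add: e2_power)
  moreover have "fact j / (2 * of_real pi * \<i>) ^ j * taylor_coeff A m \<tau> j = infsum f UNIV"
    unfolding taylor_coeff_def f_def by simp
  ultimately show ?thesis by simp
qed

text \<open>If all lower moments vanish, the Taylor coefficient of order \<open>\<nu>\<close> is the leading one, and so a modular form of weight \<open>k + \<nu>\<close>.\<close>
lemma moment_vanish_step: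
  assumes E: "siegel_expansion A G" and J: "jacobi_invariant k G"
    and ord: "\<And>n \<rho>. n < int R \<Longrightarrow> A n \<rho> m = 0"
    and low: "\<And>j n. j < \<nu> \<Longrightarrow> moment A m j n = 0"
    and weight: "k + \<nu> < 12 * R"
  shows "moment A m \<nu> n = 0"
proof -
  have psd: "psd_supported A" using E by (simp add: siegel_expansion_def)
  define c where "c = (\<lambda>n::nat. moment A m \<nu> (int n))"
  define K :: complex where "K = fact \<nu> / (2 * of_real pi * \<i>) ^ \<nu>"
  have sm: "(\<lambda>n. c n * e2 \<tau> ^ n) sums (K * taylor_coeff A m \<tau> \<nu>)" if "Im \<tau> > 0" for \<tau>
    unfolding c_def K_def by (rule taylor_coeff_moments[OF E that])
  have tl: "taylor_coeff A m \<tau> j = 0" if "Im \<tau> > 0" "j < \<nu>" for \<tau> j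
  proof -
    have "(\<lambda>n. moment A m j (int n) * e2 \<tau> ^ n) sums (fact j / (2 * of_real pi * \<i>) ^ j * taylor_coeff A m \<tau> j)"
      by (rule taylor_coeff_moments[OF E that(1)])
    hence "(\<lambda>n. 0 :: complex) sums (fact j / (2 * of_real pi * \<i>) ^ j * taylor_coeff A m \<tau> j)"
      by (simp only: low[OF that(2)] mult_zero_left)
    hence "fact j / (2 * of_real pi * \<i>) ^ j * taylor_coeff A m \<tau> j = 0"
      using sums_zero sums_unique2 by blast
    thus ?thesis by simp
  qed
  define F where "F = (\<lambda>q. \<Sum>n. c n * q ^ n)"
  have Fs: "(\<lambda>n. c n * q ^ n) sums F q" if q: "norm q < 1" for q
  proof (cases "q = 0")
    case True
    thus ?thesis unfolding F_def using powser_sums_zero[of c] by simp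
  next
    case False
    then obtain \<tau> where "Im \<tau> > 0" "e2 \<tau> = q" using e2_surj q by blast
    thus ?thesis using sm[of \<tau>] unfolding F_def by (simp add: sums_iff)
  qed
  have FT: "F (e2 \<tau>) = K * taylor_coeff A m \<tau> \<nu>" if "Im \<tau> > 0" for \<tau>
    using sm[OF that] unfolding F_def by (simp add: sums_iff)
  have c0: "c i = 0" for i
  proof (rule level_one_vanishing[OF Fs _ _ weight])
    fix i assume "i < R"
    thus "c i = 0" unfolding c_def moment_def by (intro sum.neutral) (use ord[of "int i"] in auto)
  next
    fix \<tau> assume t: "Im \<tau> > 0"
    have "taylor_coeff A m (- 1 / \<tau>) \<nu> = \<tau> ^ (k + \<nu>) * taylor_coeff A m \<tau> \<nu>"
      by (rule taylor_coeff_modular[OF E J t]) (rule tl)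
    thus "F (e2 (- 1 / \<tau>)) = \<tau> ^ (k + \<nu>) * F (e2 \<tau>)"
      unfolding FT[OF t] FT[OF Im_neg_inverse_pos[OF t]] by simp
  qed
  show ?thesis
  proof (cases "n < 0")
    case True
    thus ?thesis unfolding moment_def using psd_supportedD(1)[OF psd] by (intro sum.neutral) force
  next
    case False
    thus ?thesis using c0[of "nat n"] by (simp add: c_def)
  qed
qed

lemma moments_vanish:
  assumes E: "siegel_expansion A G" and J: "jacobi_invariant k G"
    and ord: "\<And>n \<rho>. n < int R \<Longrightarrow> A n \<rho> m = 0"
    and weight: "k + \<nu> < 12 * R"
  shows "moment A m \<nu> n = 0"
  using weight
proof (induction \<nu> arbitrary: n rule: less_induct)
  case (less \<nu>)
  show ?case by (rule moment_vanish_step[OF E J ord _ less.prems]) (use less in auto)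
qed

text \<open>A shear changes \<open>\<rho>\<close> by \<open>2 * m\<close>; if \<open>\<bar>\<rho>\<bar> > m\<close>, the shear towards zero strictly decreases \<open>n\<close>.\<close>
lemma row_support_bound:
  assumes E: "siegel_expansion A G" and J: "jacobi_invariant k G"
    and below: "\<And>n' \<rho>. n' < n \<Longrightarrow> A n' \<rho> m = 0"
  shows "{\<rho>. A n \<rho> m \<noteq> 0} \<subseteq> {- m..m}"
proof
  fix \<rho> assume "\<rho> \<in> {\<rho>. A n \<rho> m \<noteq> 0}"
  hence nz: "A n \<rho> m \<noteq> 0" by simp
  have "\<not> \<rho> > m"
  proof
    assume "\<rho> > m"
    hence "A (n - \<rho> + m) (\<rho> - 2 * m) m = 0" by (intro below) auto
    moreover have "A (n - \<rho> + m) (\<rho> - 2 * m) m = A n \<rho> m"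
      using siegel_coeff_shear[OF E J, of "n - \<rho> + m" "\<rho> - 2 * m" m] by simp
    ultimately show False using nz by simp
  qed
  moreover have "\<not> \<rho> < - m"
  proof
    assume "\<rho> < - m"
    hence "A (n + \<rho> + m) (\<rho> + 2 * m) m = 0" by (intro below) auto
    thus False using siegel_coeff_shear[OF E J, of n \<rho> m] nz by simp
  qed
  ultimately show "\<rho> \<in> {- m..m}" by simp
qed

text \<open>By induction on \<open>n\<close>, the row of \<open>n\<close> has at most \<open>2 * m + 1\<close> unknown entries, as many as there are vanishing moments.\<close>
lemma fourier_jacobi_vanish:
  assumes E: "siegel_expansion A G" and J: "jacobi_invariant k G" and m: "m \<ge> 0"
    and mom: "\<And>\<nu> n. \<nu> \<le> nat (2 * m) \<Longrightarrow> moment A m \<nu> n = 0"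
  shows "A n \<rho> m = 0"
proof (cases "n < 0")
  case True
  thus ?thesis using E psd_supportedD(1)[of A n \<rho> m] by (auto simp: siegel_expansion_def)
next
  case False
  hence "n = int (nat n)" by simp
  moreover have "A (int i) \<rho> m = 0" for i \<rho>
  proof (induction i arbitrary: \<rho> rule: less_induct)
    case (less i)
    have below: "A n' \<rho> m = 0" if "n' < int i" for n' \<rho>
    proof (cases "n' < 0")
      case True
      thus ?thesis using E psd_supportedD(1)[of A n' \<rho> m] by (auto simp: siegel_expansion_def)
    next
      case False
      thus ?thesis using less[of "nat n'" \<rho>] that by simp
    qed
    have supp: "{\<rho>. A (int i) \<rho> m \<noteq> 0} \<subseteq> {- m..m}" by (rule row_support_bound[OF E J below])
    show ?case
    proof (cases "\<rho> \<in> {- m..m}")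
      case True
      show ?thesis
      proof (rule moments_determine[of "{- m..m}" "nat (2 * m)" "\<lambda>\<rho>. A (int i) \<rho> m", OF _ _ _ True])
        fix j assume "j \<le> nat (2 * m)"
        from mom[OF this] show "(\<Sum>\<rho>\<in>{- m..m}. A (int i) \<rho> m * of_int \<rho> ^ j) = 0"
          using moment_eq_sum[of "{- m..m}" A "int i" m j] supp by simp
      qed (use m in auto)
    next
      case False
      thus ?thesis using supp by blast
    qed
  qed
  ultimately show ?thesis by metis
qed

text \<open>Induction on the index \<open>r\<close>: if all Fourier-Jacobi coefficients of smaller index vanish, then the exchange of \<open>n\<close> and \<open>m\<close> gives the
one of index \<open>r\<close> order at least \<open>r\<close> at the cusp. The moments up to \<open>2 * r\<close> vanish if
\<open>12 * t + 2 * r < 12 * r\<close>, which holds for \<open>r > t\<close> unless \<open>t = 5\<close> and \<open>r = 6\<close>. The index \<open>0\<close> is the classical statement that the theta series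
of degree one of an extremal lattice is determined by its rank.\<close>
theorem siegel_coeffs_vanish:
  assumes E: "siegel_expansion A G" and J: "jacobi_invariant (12 * t) G"
    and A0: "A 0 0 0 = 0" and low: "\<And>n \<rho> m. 1 \<le> m \<Longrightarrow> m \<le> int t \<Longrightarrow> A n \<rho> m = 0"
    and t: "t \<le> 4 \<or> t = 5 \<and> A 6 6 6 = 0"
  shows "A n \<rho> m = 0"
proof -
  have psd: "psd_supported A" using E by (simp add: siegel_expansion_def)
  have swap: "A m \<rho> n = A n \<rho> m" for n \<rho> m by (rule siegel_coeff_swap[OF E J])
  have main: "A n \<rho> (int r) = 0" for n \<rho> r
  proof (induction r arbitrary: n \<rho> rule: less_induct)
    case (less r)
    have ord: "A n \<rho> (int r) = 0" if "n < int r" for n \<rho>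
    proof (cases "n < 0")
      case True
      thus ?thesis using psd_supportedD(1)[OF psd, of n \<rho> "int r"] by auto
    next
      case False
      thus ?thesis using less[of "nat n" "int r" \<rho>] that swap[of n \<rho> "int r"] by simp
    qed
    consider "r = 0" | "1 \<le> r" "r \<le> t" | "r \<ge> t + 1" "5 * r > 6 * t" | "t = 5" "r = 6" using t by linarith
    thus ?case
    proof cases
      case 1
      have ord0: "A n \<rho> 0 = 0" if "n < int (t + 1)" for n \<rho>
      proof -
        consider "n < 0" | "n = 0" | "1 \<le> n" "n \<le> int t" using \<open>n < int (t + 1)\<close> by linarith
        thus ?thesis
        proof cases
          case 2
          show ?thesis
          proof (rule ccontr)
            assume "A n \<rho> 0 \<noteq> 0"
            with psd_supportedD(3)[OF psd this] show False using A0 2 by simp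
          qed
        next
          case 3
          thus ?thesis using low[of n 0 \<rho>] swap[of n \<rho> 0] by simp
        qed (use psd_supportedD(1)[OF psd, of n \<rho> 0] in auto)
      qed
      have "A n \<rho> 0 = 0"
      proof (rule fourier_jacobi_vanish[OF E J])
        fix \<nu> n assume "\<nu> \<le> nat (2 * 0)"
        thus "moment A 0 \<nu> n = 0" by (intro moments_vanish[OF E J ord0]) auto
      qed simp
      thus ?thesis using 1 by simp
    next
      case 2
      thus ?thesis using low by simp
    next
      case 3
      show ?thesis
      proof (rule fourier_jacobi_vanish[OF E J])
        fix \<nu> n assume "\<nu> \<le> nat (2 * int r)"
        thus "moment A (int r) \<nu> n = 0" using 3 by (intro moments_vanish[OF E J ord]) auto
      qed simp
    next
      case 4
      \<comment> \<open>The moments up to 11 vanish. In the row \<open>n = 6\<close> the hypothesis and a shear remove the entries at \<open>6\<close> and \<open>- 6\<close>, so that the moments up to 10 suffice. The order at the cusp is then at least 7, and the twelfth moment vanishes as well.\<close>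
      have A6: "A 6 6 6 = 0" using t 4 by simp
      have ord6: "A n \<rho> 6 = 0" if "n < 6" for n \<rho> using ord[of n \<rho>] that 4 by simp
      have supp: "{\<rho>. A 6 \<rho> 6 \<noteq> 0} \<subseteq> {- 6..6}" by (rule row_support_bound[OF E J ord6])
      have "A 6 (- 6) 6 = 0" using siegel_coeff_shear[OF E J, of 6 "- 6" 6] A6 by simp
      have supp5: "{\<rho>. A 6 \<rho> 6 \<noteq> 0} \<subseteq> {- 5..5}"
      proof
        fix \<rho> assume r: "\<rho> \<in> {\<rho>. A 6 \<rho> 6 \<noteq> 0}"
        hence "\<rho> \<in> {- 6..6}" using supp by blast
        moreover have "\<rho> \<noteq> 6" "\<rho> \<noteq> - 6" using r A6 \<open>A 6 (- 6) 6 = 0\<close> by auto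
        ultimately show "\<rho> \<in> {- 5..5}" by auto
      qed
      have row6: "A 6 \<rho> 6 = 0" for \<rho>
      proof (cases "\<rho> \<in> {- 5..5}")
        case True
        show ?thesis
        proof (rule moments_determine[of "{- 5..5}" 10 "\<lambda>\<rho>. A 6 \<rho> 6", OF _ _ _ True])
          fix j :: nat assume "j \<le> 10"
          hence "moment A (int r) j 6 = 0" using 4 by (intro moments_vanish[where R = r, OF E J ord]) auto
          thus "(\<Sum>\<rho>\<in>{- 5..5}. A 6 \<rho> 6 * of_int \<rho> ^ j) = 0"
            using moment_eq_sum[of "{- 5..5}" A 6 6 j] supp5 4 by simp
        qed auto
      next
        case False
        thus ?thesis using supp5 by blast
      qed
      have ord7: "A n \<rho> 6 = 0" if "n < int 7" for n \<rho>
        using ord6[of n \<rho>] row6[of \<rho>] that by (cases "n = 6") auto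
      have "A n \<rho> 6 = 0"
      proof (rule fourier_jacobi_vanish[OF E J])
        fix \<nu> n assume "\<nu> \<le> nat (2 * 6)"
        thus "moment A 6 \<nu> n = 0" using 4 by (intro moments_vanish[where R = 7, OF E J ord7]) auto
      qed simp
      thus ?thesis using 4 by simp
    qed
  qed
  show ?thesis
  proof (cases "m < 0")
    case True
    thus ?thesis using psd_supportedD(2)[OF psd, of n \<rho> m] by auto
  next
    case False
    thus ?thesis using main[of n \<rho> "nat m"] by simp
  qed
qed

section \<open>Theta series of even unimodular lattices\<close>

definition zmat :: "complex \<Rightarrow> complex \<Rightarrow> complex \<Rightarrow> complex^2^2" where
  "zmat \<tau> z \<sigma> = vector [vector [\<tau>, z], vector [z, \<sigma>]]"

lemma zmat_nth [simp]:
  "zmat \<tau> z \<sigma> $ 1 $ 1 = \<tau>" "zmat \<tau> z \<sigma> $ 1 $ 2 = z" "zmat \<tau> z \<sigma> $ 2 $ 1 = z" "zmat \<tau> z \<sigma> $ 2 $ 2 = \<sigma>"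
  by (simp_all add: zmat_def)

text \<open>Completing the square.\<close>
lemma binary_form_pos:
  fixes a b c x y :: real
  assumes "a > 0" "b\<^sup>2 < a * c" "x \<noteq> 0 \<or> y \<noteq> 0"
  shows "a * x\<^sup>2 + 2 * b * x * y + c * y\<^sup>2 > 0"
proof -
  have eq: "a * (a * x\<^sup>2 + 2 * b * x * y + c * y\<^sup>2) = (a * x + b * y)\<^sup>2 + (a * c - b\<^sup>2) * y\<^sup>2"
    by (simp add: power2_eq_square algebra_simps)
  have "(a * x + b * y)\<^sup>2 + (a * c - b\<^sup>2) * y\<^sup>2 > 0"
  proof (cases "y = 0")
    case True
    thus ?thesis using assms by simp
  next
    case False
    thus ?thesis using assms by (intro add_nonneg_pos mult_pos_pos) auto
  qed
  thus ?thesis using assms(1) unfolding eq[symmetric] by (simp add: zero_less_mult_iff)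
qed

lemma quadratic_form_Im_zmat:
  "v \<bullet> (map_matrix Im (zmat \<tau> z \<sigma>) *v v) = Im \<tau> * (v $ 1)\<^sup>2 + 2 * Im z * (v $ 1) * (v $ 2) + Im \<sigma> * (v $ 2)\<^sup>2"
  by (simp add: inner_vec_def matrix_vector_mult_def sum_2 map_matrix_def power2_eq_square algebra_simps)

text \<open>Testing positivity on the first unit vector and on \<open>(Im z, - Im \<tau>)\<close> gives the two inequalities.\<close>
lemma siegel_H2_iff: "Z \<in> siegel_H2 \<longleftrightarrow> (\<exists>\<tau> z \<sigma>. Z = zmat \<tau> z \<sigma> \<and> H2_point \<tau> z \<sigma>)"
proof
  assume Z: "Z \<in> siegel_H2"
  hence tr: "transpose Z = Z" and pos: "\<And>v::real^2. v \<noteq> 0 \<Longrightarrow> v \<bullet> (map_matrix Im Z *v v) > 0"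
    by (auto simp: siegel_H2_def)
  define \<tau> where "\<tau> = Z $ 1 $ 1" define z where "z = Z $ 1 $ 2" define \<sigma> where "\<sigma> = Z $ 2 $ 2"
  have "transpose Z $ 2 $ 1 = Z $ 1 $ 2" by (simp add: transpose_def)
  hence sym: "Z $ 2 $ 1 = z" unfolding tr z_def .
  have eqZ: "Z = zmat \<tau> z \<sigma>"
    unfolding vec_eq_iff forall_2 zmat_nth by (simp only: \<tau>_def z_def \<sigma>_def sym[unfolded z_def] simp_thms)
  note val = quadratic_form_Im_zmat[of _ \<tau> z \<sigma>, folded eqZ]
  have p1: "Im \<tau> > 0"
    using pos[of "vector [1, 0]"] unfolding val by (simp add: vec_eq_iff forall_2)
  have "0 < Im \<tau> * (Im z)\<^sup>2 + 2 * Im z * (Im z) * (- Im \<tau>) + Im \<sigma> * (Im \<tau>)\<^sup>2"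
    using pos[of "vector [Im z, - Im \<tau>]"] p1 unfolding val by (simp add: vec_eq_iff forall_2)
  also have "\<dots> = Im \<tau> * (Im \<tau> * Im \<sigma> - (Im z)\<^sup>2)" by (simp add: power2_eq_square algebra_simps)
  finally have "Im \<tau> * Im \<sigma> - (Im z)\<^sup>2 > 0" using p1 by (simp add: zero_less_mult_iff)
  with p1 eqZ show "\<exists>\<tau> z \<sigma>. Z = zmat \<tau> z \<sigma> \<and> H2_point \<tau> z \<sigma>" by (auto simp: H2_point_def)
next
  assume "\<exists>\<tau> z \<sigma>. Z = zmat \<tau> z \<sigma> \<and> H2_point \<tau> z \<sigma>"
  then obtain \<tau> z \<sigma> where Z: "Z = zmat \<tau> z \<sigma>" and h: "H2_point \<tau> z \<sigma>" by blast
  have "transpose Z = Z" by (simp add: Z transpose_def vec_eq_iff forall_2)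
  moreover have "v \<bullet> (map_matrix Im Z *v v) > 0" if "v \<noteq> 0" for v :: "real^2"
  proof -
    note quadratic_form_Im_zmat[of v \<tau> z \<sigma>, folded Z]
    moreover have "v $ 1 \<noteq> 0 \<or> v $ 2 \<noteq> 0" using that by (auto simp: vec_eq_iff forall_2)
    ultimately show ?thesis using binary_form_pos[of "Im \<tau>" "Im z" "Im \<sigma>"] h by (simp add: H2_point_def)
  qed
  ultimately show "Z \<in> siegel_H2" by (simp add: siegel_H2_def)
qed

definition pair_term :: "complex \<Rightarrow> complex \<Rightarrow> complex \<Rightarrow> 'a::real_inner \<times> 'a \<Rightarrow> complex" where
  "pair_term \<tau> z \<sigma> = (\<lambda>(x, y). e2 (of_real ((x \<bullet> x) / 2) * \<tau> + of_real (x \<bullet> y) * z + of_real ((y \<bullet> y) / 2) * \<sigma>))"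

lemma siegel_theta_zmat: "siegel_theta L (zmat \<tau> z \<sigma>) = infsum (pair_term \<tau> z \<sigma>) (L \<times> L)"
proof -
  have "exp (of_real pi * \<i> * trace (map_matrix of_real (gram2 x y) ** zmat \<tau> z \<sigma>)) = pair_term \<tau> z \<sigma> (x, y)" for x y :: 'a
    by (simp add: pair_term_def e2_def trace_def sum_2 matrix_matrix_mult_def map_matrix_def gram2_def inner_commute[of y x])
       (simp add: algebra_simps)
  thus ?thesis unfolding siegel_theta_def by (intro infsum_cong) (auto simp: case_prod_unfold)
qed

lemma norm_pair_term:
  "norm (pair_term \<tau> z \<sigma> (x, y)) = exp (- pi * (Im \<tau> * (x \<bullet> x) + 2 * Im z * (x \<bullet> y) + Im \<sigma> * (y \<bullet> y)))"
  by (simp add: pair_term_def norm_e2 algebra_simps)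

text \<open>Completing the square in \<open>x\<close> bounds the sum over \<open>x\<close> by a constant that does not depend on \<open>y\<close>, times a Gaussian in \<open>y\<close> of positive width \<open>\<delta>\<close>.\<close>
lemma pair_term_summable:
  fixes L :: "'a::real_inner set"
  assumes L: "even_unimodular n L" and h: "H2_point \<tau> z \<sigma>"
  shows "pair_term \<tau> z \<sigma> summable_on (L \<times> L)"
proof -
  define a where "a = Im \<tau>" define b where "b = Im z" define c where "c = Im \<sigma>"
  have a: "a > 0" and d: "b\<^sup>2 < a * c" using h by (auto simp: H2_point_def a_def b_def c_def)
  define \<delta> where "\<delta> = c - b\<^sup>2 / a"
  have \<delta>: "\<delta> > 0" using a d by (simp add: \<delta>_def field_simps)
  have sa: "Re (of_real a) > 0" "Re (of_real \<delta>) > 0" using a \<delta> by auto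
  note P = unimodular_poisson[OF L]
  have 0: "0 \<in> L" by (rule P(3))
  obtain K where K: "\<And>u w a' c'. u \<in> L \<Longrightarrow> w \<in> L \<Longrightarrow> infsum (\<lambda>y. norm (lattice_term (of_real a) (a' *\<^sub>R u) (c' *\<^sub>R w) y)) L \<le> K"
    using P(4)[OF sa(1)] by blast
  have nrm: "norm (pair_term \<tau> z \<sigma> (x, y)) =
       norm (lattice_term (of_real a) ((b / a) *\<^sub>R y) (0 *\<^sub>R 0) x) * norm (lattice_term (of_real \<delta>) (0 *\<^sub>R 0) (0 *\<^sub>R 0) y)" for x y :: 'a
  proof -
    have "a * ((x + (b / a) *\<^sub>R y) \<bullet> (x + (b / a) *\<^sub>R y)) = a * (x \<bullet> x) + 2 * b * (x \<bullet> y) + b\<^sup>2 / a * (y \<bullet> y)"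
      using a by (simp add: inner_add_left inner_add_right inner_commute[of y x] field_simps power2_eq_square)
    hence "a * (x \<bullet> x) + 2 * b * (x \<bullet> y) + c * (y \<bullet> y) = a * ((x + (b / a) *\<^sub>R y) \<bullet> (x + (b / a) *\<^sub>R y)) + \<delta> * (y \<bullet> y)"
      by (simp add: \<delta>_def algebra_simps)
    thus ?thesis unfolding norm_pair_term norm_lattice_term a_def[symmetric] b_def[symmetric] c_def[symmetric]
      by (simp add: exp_add[symmetric] algebra_simps)
  qed
  have ns: "(\<lambda>x. norm (lattice_term (of_real e) (e1 *\<^sub>R u) (e2' *\<^sub>R w) x)) summable_on L" if "e > 0" "u \<in> L" "w \<in> L" for e e1 e2' :: real and u w
    using P(1)[of "of_real e" u w e1 e2'] that by (simp only: summable_on_iff_abs_summable_on_complex) simp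
  have "(\<lambda>(y, x). pair_term \<tau> z \<sigma> (x, y)) summable_on (L \<times> L)"
  proof (rule summable_on_times_bound)
    show "(\<lambda>y. K * norm (lattice_term (of_real \<delta>) (0 *\<^sub>R 0) (0 *\<^sub>R 0) y)) summable_on L"
      by (intro summable_on_cmult_right ns \<delta> 0)
    fix y assume y: "y \<in> L"
    show "(\<lambda>x. norm (case (y, x) of (y, x) \<Rightarrow> pair_term \<tau> z \<sigma> (x, y))) summable_on L"
      unfolding prod.case nrm by (intro summable_on_cmult_left ns a y 0)
    show "infsum (\<lambda>x. norm (case (y, x) of (y, x) \<Rightarrow> pair_term \<tau> z \<sigma> (x, y))) L \<le> K * norm (lattice_term (of_real \<delta>) (0 *\<^sub>R 0) (0 *\<^sub>R 0) y)"
      unfolding prod.case nrm infsum_cmult_left' by (intro mult_right_mono K y 0) auto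
  qed
  thus ?thesis by (subst summable_on_swap)
qed

definition gram_fiber :: "'a::real_inner set \<Rightarrow> int \<Rightarrow> int \<Rightarrow> int \<Rightarrow> ('a \<times> 'a) set" where
  "gram_fiber L n \<rho> m = {(x, y) \<in> L \<times> L. x \<bullet> x = 2 * of_int n \<and> x \<bullet> y = of_int \<rho> \<and> y \<bullet> y = 2 * of_int m}"

definition rep_number :: "'a::real_inner set \<Rightarrow> int \<Rightarrow> int \<Rightarrow> int \<Rightarrow> complex" where
  "rep_number L n \<rho> m = of_nat (card (gram_fiber L n \<rho> m))"

text \<open>Sort the pairs of vectors by their Gram matrix. The fibres are finite, because a nonzero constant family is summable only over a finite set.\<close>
lemma theta_expansion:
  fixes L :: "'a::real_inner set"
  assumes L: "even_unimodular n L"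
  shows "siegel_expansion (rep_number L) (\<lambda>\<tau> z \<sigma>. siegel_theta L (zmat \<tau> z \<sigma>))"
  unfolding siegel_expansion_def
proof (intro conjI allI impI)
  show "psd_supported (rep_number L)"
    unfolding psd_supported_def
  proof (intro allI impI)
    fix n \<rho> m assume "rep_number L n \<rho> m \<noteq> 0"
    hence "gram_fiber L n \<rho> m \<noteq> {}" by (auto simp: rep_number_def)
    then obtain x y :: 'a where xy: "x \<bullet> x = 2 * of_int n" "x \<bullet> y = of_int \<rho>" "y \<bullet> y = 2 * of_int m"
      unfolding gram_fiber_def by blast
    have "0 \<le> 2 * real_of_int n" "0 \<le> 2 * real_of_int m" unfolding xy[symmetric] by simp_all
    moreover have "(real_of_int \<rho>)\<^sup>2 \<le> (2 * of_int n) * (2 * of_int m)"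
      unfolding xy[symmetric] by (rule Cauchy_Schwarz_ineq)
    hence "real_of_int (\<rho>\<^sup>2) \<le> real_of_int (4 * n * m)" by simp
    hence "\<rho>\<^sup>2 \<le> 4 * n * m" by (simp only: of_int_le_iff)
    ultimately show "0 \<le> n \<and> 0 \<le> m \<and> \<rho>\<^sup>2 \<le> 4 * n * m" by simp
  qed
next
  fix \<tau> z \<sigma> assume h: "H2_point \<tau> z \<sigma>"
  have s: "pair_term \<tau> z \<sigma> summable_on (L \<times> L)" by (rule pair_term_summable[OF L h])
  define \<phi> where "\<phi> = (\<lambda>(x :: 'a, y). (\<lfloor>(x \<bullet> x) / 2\<rfloor>, \<lfloor>x \<bullet> y\<rfloor>, \<lfloor>(y \<bullet> y) / 2\<rfloor> :: int) :: int \<times> int \<times> int)"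
  have even: "\<exists>k::int. x \<bullet> x = 2 * of_int k" if "x \<in> L" for x using L that by (auto simp: even_unimodular_def)
  have int: "x \<bullet> y \<in> \<int>" if "x \<in> L" "y \<in> L" for x y using L that by (auto simp: even_unimodular_def)
  have fib: "{p \<in> L \<times> L. \<phi> p = (n, \<rho>, m)} = gram_fiber L n \<rho> m" for n \<rho> m
  proof -
    have "\<phi> (x, y) = (n, \<rho>, m) \<longleftrightarrow> x \<bullet> x = 2 * of_int n \<and> x \<bullet> y = of_int \<rho> \<and> y \<bullet> y = 2 * of_int m"
      if xL: "x \<in> L" and yL: "y \<in> L" for x y
    proof -
      obtain a where a: "x \<bullet> x = 2 * of_int a" using even[OF xL] by blast
      obtain c where c: "y \<bullet> y = 2 * of_int c" using even[OF yL] by blast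
      obtain b where b: "x \<bullet> y = of_int b" using int[OF xL yL] by (auto elim: Ints_cases)
      show ?thesis by (simp add: \<phi>_def a b c)
    qed
    thus ?thesis by (auto simp: gram_fiber_def)
  qed
  have val: "infsum (pair_term \<tau> z \<sigma>) {p \<in> L \<times> L. \<phi> p = k} = siegel_term (rep_number L) \<tau> z \<sigma> k" for k
  proof -
    obtain n \<rho> m where k: "k = (n, \<rho>, m)" by (cases k)
    define c where "c = e2 (of_int n * \<tau> + of_int \<rho> * z + of_int m * \<sigma>)"
    have const: "pair_term \<tau> z \<sigma> p = c" if "p \<in> gram_fiber L n \<rho> m" for p
      using that by (auto simp: gram_fiber_def pair_term_def c_def)
    have "pair_term \<tau> z \<sigma> summable_on gram_fiber L n \<rho> m"
      by (rule summable_on_subset_banach[OF s]) (auto simp: gram_fiber_def)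
    hence "(\<lambda>_. c) summable_on gram_fiber L n \<rho> m" using const by (metis (no_types, lifting) summable_on_cong)
    hence fin: "finite (gram_fiber L n \<rho> m)" by (rule summable_const_imp_finite) (simp add: c_def)
    have "infsum (pair_term \<tau> z \<sigma>) (gram_fiber L n \<rho> m) = infsum (\<lambda>_. c) (gram_fiber L n \<rho> m)"
      by (intro infsum_cong const)
    also have "\<dots> = of_nat (card (gram_fiber L n \<rho> m)) * c" by (rule infsum_constant[OF fin])
    finally show ?thesis unfolding k fib by (simp add: siegel_term_def rep_number_def c_def)
  qed
  show "(siegel_term (rep_number L) \<tau> z \<sigma> has_sum siegel_theta L (zmat \<tau> z \<sigma>)) UNIV"
    using has_sum_group[OF s, of \<phi>] unfolding val siegel_theta_zmat .
qed

lemma even_unimodular_add_diff: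
  assumes "even_unimodular n L" "x \<in> L" "y \<in> L"
  shows "x + y \<in> L" "x - y \<in> L"
proof -
  obtain B where B: "finite B" "L = {(\<Sum>b\<in>B. of_int (c b) *\<^sub>R b) | c :: 'a \<Rightarrow> int. True}"
    using assms(1) unfolding even_unimodular_def lattice_of_rank_def by blast
  obtain c where c: "x = (\<Sum>b\<in>B. of_int (c b) *\<^sub>R b)" using assms(2) B(2) by blast
  obtain d where d: "y = (\<Sum>b\<in>B. of_int (d b) *\<^sub>R b)" using assms(3) B(2) by blast
  have "x + y = (\<Sum>b\<in>B. of_int ((\<lambda>b. c b + d b) b) *\<^sub>R b)" by (simp add: c d scaleR_left_distrib sum.distrib)
  thus "x + y \<in> L" unfolding B(2) by (intro CollectI exI[of _ "\<lambda>b. c b + d b"] conjI TrueI)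
  have "x - y = (\<Sum>b\<in>B. of_int ((\<lambda>b. c b - d b) b) *\<^sub>R b)" by (simp add: c d scaleR_left_diff_distrib sum_subtractf)
  thus "x - y \<in> L" unfolding B(2) by (intro CollectI exI[of _ "\<lambda>b. c b - d b"] conjI TrueI)
qed

text \<open>Exchange and shear are changes of the pair of vectors. The inversion is Poisson summation over \<open>x\<close> for fixed \<open>y\<close>, with frequency \<open>r * y\<close>. No
root of unity appears, because the rank is divisible by 8.\<close>
lemma theta_jacobi_invariant:
  fixes L :: "'a::real_inner set"
  assumes L: "even_unimodular (24 * t) L"
  shows "jacobi_invariant (12 * t) (\<lambda>\<tau> z \<sigma>. siegel_theta L (zmat \<tau> z \<sigma>))"
  unfolding jacobi_invariant_def siegel_theta_zmat
proof (intro conjI allI impI)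
  fix \<tau> z \<sigma> assume "H2_point \<tau> z \<sigma>"
  show "infsum (pair_term \<sigma> z \<tau>) (L \<times> L) = infsum (pair_term \<tau> z \<sigma>) (L \<times> L)"
    by (rule infsum_reindex_bij_witness[of _ prod.swap prod.swap]) (auto simp: pair_term_def inner_commute add_ac)
  show "infsum (pair_term \<tau> (z + \<tau>) (\<sigma> + 2 * z + \<tau>)) (L \<times> L) = infsum (pair_term \<tau> z \<sigma>) (L \<times> L)"
  proof (rule infsum_reindex_bij_witness[of _ "\<lambda>(x, y). (x - y, y)" "\<lambda>(x, y). (x + y, y)"])
    fix p assume "p \<in> L \<times> L"
    obtain x y where p: "p = (x, y)" by (cases p)
    have "of_real (((x + y) \<bullet> (x + y)) / 2) * \<tau> + of_real ((x + y) \<bullet> y) * z + of_real ((y \<bullet> y) / 2) * \<sigma> =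
        of_real ((x \<bullet> x) / 2) * \<tau> + of_real (x \<bullet> y) * (z + \<tau>) + of_real ((y \<bullet> y) / 2) * (\<sigma> + 2 * z + \<tau>)"
      by (simp add: inner_add_left inner_add_right inner_commute[of y x] field_simps)
    thus "pair_term \<tau> z \<sigma> (case p of (x, y) \<Rightarrow> (x + y, y)) = pair_term \<tau> (z + \<tau>) (\<sigma> + 2 * z + \<tau>) p"
      by (simp add: p pair_term_def)
  qed (use even_unimodular_add_diff[OF L] in auto)
next
  fix \<tau> :: complex and r :: real and \<sigma> :: complex assume t: "Im \<tau> > 0" and sg: "Im \<sigma> > 0"
  note P = unimodular_poisson[OF L]
  define s where "s = - \<i> * \<tau>"
  have t0: "\<tau> \<noteq> 0" using t by auto
  have s: "Re s > 0" using t by (simp add: s_def)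
  have s1: "1 / s = - (\<i> * (- 1 / \<tau>))" using t0 by (simp add: s_def field_simps)
  have H: "H2_point (- 1 / \<tau>) (of_real r / \<tau>) (\<sigma> - (of_real r)\<^sup>2 / \<tau>)" "H2_point \<tau> (of_real r) \<sigma>"
    using H2_point_inversion[OF t sg, of r] t sg by (auto simp: H2_point_def)
  have pw: "csqrt s ^ (24 * t) = \<tau> ^ (12 * t)" for t
  proof -
    have "csqrt s ^ (24 * t) = ((csqrt s)\<^sup>2) ^ (12 * t)" by (simp only: power_mult[symmetric]) simp
    also have "\<dots> = (s ^ 12) ^ t" by (simp add: power_mult)
    also have "s ^ 12 = \<tau> ^ 12" by (simp add: s_def power_mult_distrib)
    finally show ?thesis by (simp add: power_mult)
  qed
  have 1: "pair_term \<tau> (of_real r) \<sigma> (x, y) = e2 (of_real ((y \<bullet> y) / 2) * \<sigma>) * lattice_term s 0 (r *\<^sub>R y) x" for x y :: 'a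
  proof -
    have "exp (- (of_real pi * s * of_real (x \<bullet> x))) = e2 (of_real ((x \<bullet> x) / 2) * \<tau>)"
      unfolding e2_def s_def by (rule arg_cong[of _ _ exp]) simp
    thus ?thesis by (simp add: pair_term_def lattice_term_def e2_add mult_ac)
  qed
  have 2: "e2 (of_real ((y \<bullet> y) / 2) * \<sigma>) * lattice_term (1 / s) (- (r *\<^sub>R y)) 0 x = pair_term (- 1 / \<tau>) (of_real r / \<tau>) (\<sigma> - (of_real r)\<^sup>2 / \<tau>) (x, y)" for x y :: 'a
  proof -
    have n: "(x + - (r *\<^sub>R y)) \<bullet> (x + - (r *\<^sub>R y)) = x \<bullet> x - 2 * r * (x \<bullet> y) + r\<^sup>2 * (y \<bullet> y)"
      by (simp add: inner_diff_left inner_diff_right inner_commute[of y x] power2_eq_square algebra_simps)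
    have "exp (- (of_real pi * (1 / s) * of_real ((x + - (r *\<^sub>R y)) \<bullet> (x + - (r *\<^sub>R y))))) =
        e2 (of_real ((x \<bullet> x) / 2) * (- 1 / \<tau>) + of_real (x \<bullet> y) * (of_real r / \<tau>) + of_real ((y \<bullet> y) / 2) * (- (of_real r)\<^sup>2 / \<tau>))"
      unfolding n s1 e2_def by (rule arg_cong[of _ _ exp]) (use t0 in \<open>simp add: field_simps\<close>)
    moreover have "e2 (of_real ((y \<bullet> y) / 2) * \<sigma>) * e2 (of_real ((x \<bullet> x) / 2) * (- 1 / \<tau>) + of_real (x \<bullet> y) * (of_real r / \<tau>) + of_real ((y \<bullet> y) / 2) * (- (of_real r)\<^sup>2 / \<tau>))
      = pair_term (- 1 / \<tau>) (of_real r / \<tau>) (\<sigma> - (of_real r)\<^sup>2 / \<tau>) (x, y)"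
      unfolding pair_term_def e2_add[symmetric] by (simp add: algebra_simps)
    ultimately show ?thesis by (simp add: lattice_term_def)
  qed
  have swapsum: "infsum f (L \<times> L) = infsum (\<lambda>y. infsum (\<lambda>x. f (x, y)) L) L" if "f summable_on L \<times> L" for f :: "'a \<times> 'a \<Rightarrow> complex"
    using that infsum_Sigma_banach[OF that] infsum_swap_banach[of "\<lambda>x y. f (x, y)" L L] by simp
  have "\<tau> ^ (12 * t) * infsum (pair_term \<tau> (of_real r) \<sigma>) (L \<times> L) =
      infsum (\<lambda>y. \<tau> ^ (12 * t) * (e2 (of_real ((y \<bullet> y) / 2) * \<sigma>) * infsum (lattice_term s 0 (r *\<^sub>R y)) L)) L"
    unfolding swapsum[OF pair_term_summable[OF L H(2)]] 1 by (simp only: infsum_cmult_right')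
  also have "\<dots> = infsum (\<lambda>y. e2 (of_real ((y \<bullet> y) / 2) * \<sigma>) * infsum (lattice_term (1 / s) (- (r *\<^sub>R y)) 0) L) L"
  proof (rule infsum_cong)
    fix y assume "y \<in> L"
    thus "\<tau> ^ (12 * t) * (e2 (of_real ((y \<bullet> y) / 2) * \<sigma>) * infsum (lattice_term s 0 (r *\<^sub>R y)) L) = e2 (of_real ((y \<bullet> y) / 2) * \<sigma>) * infsum (lattice_term (1 / s) (- (r *\<^sub>R y)) 0) L"
      using t0 unfolding P(2)[OF s \<open>y \<in> L\<close>] pw by simp
  qed
  also have "\<dots> = infsum (pair_term (- 1 / \<tau>) (of_real r / \<tau>) (\<sigma> - (of_real r)\<^sup>2 / \<tau>)) (L \<times> L)"
    unfolding swapsum[OF pair_term_summable[OF L H(1)]] 2[symmetric] by (simp only: infsum_cmult_right')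
  finally show "infsum (pair_term (- 1 / \<tau>) (of_real r / \<tau>) (\<sigma> - (of_real r)\<^sup>2 / \<tau>)) (L \<times> L) = \<tau> ^ (12 * t) * infsum (pair_term \<tau> (of_real r) \<sigma>) (L \<times> L)"
    by (rule sym)
qed

lemma extremal_norm_ge:
  assumes "extremal (24 * t) L" "x \<in> L" "x \<noteq> 0"
  shows "x \<bullet> x \<ge> real (2 * t + 2)"
proof -
  have "lattice_min L \<le> x \<bullet> x" unfolding lattice_min_def
    by (rule cInf_lower) (use assms in \<open>auto intro!: bdd_belowI[of _ 0]\<close>)
  thus ?thesis using assms(1) by (simp add: extremal_def)
qed

text \<open>A nonzero vector has norm at least \<open>2 * t + 2\<close>, so \<open>m\<close> is \<open>0\<close> or greater than \<open>t\<close>.\<close>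
lemma extremal_rep_number:
  assumes "extremal (24 * t) L"
  shows "rep_number L 0 0 0 = 1" and "1 \<le> m \<Longrightarrow> m \<le> int t \<Longrightarrow> rep_number L n \<rho> m = 0"
proof -
  have "0 \<in> L" using assms unimodular_poisson(3) unfolding extremal_def by blast
  hence "gram_fiber L 0 0 0 = {(0, 0)}" by (auto simp: gram_fiber_def)
  thus "rep_number L 0 0 0 = 1" by (simp add: rep_number_def)
next
  assume m: "1 \<le> m" "m \<le> int t"
  have "gram_fiber L n \<rho> m = {}"
  proof (rule ccontr)
    assume "gram_fiber L n \<rho> m \<noteq> {}"
    then obtain y where y: "y \<in> L" "y \<bullet> y = 2 * of_int m" by (auto simp: gram_fiber_def)
    hence "y \<noteq> 0" using m by auto
    from extremal_norm_ge[OF assms y(1) this] have "real (2 * t + 2) \<le> 2 * of_int m" using y by simp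
    hence "int t + 1 \<le> m" by linarith
    with m show False by simp
  qed
  thus "rep_number L n \<rho> m = 0" by (simp add: rep_number_def)
qed

lemma siegel_expansion_diff:
  assumes "siegel_expansion A G" "siegel_expansion B H"
  shows "siegel_expansion (\<lambda>n \<rho> m. A n \<rho> m - c * B n \<rho> m) (\<lambda>\<tau> z \<sigma>. G \<tau> z \<sigma> - c * H \<tau> z \<sigma>)"
  unfolding siegel_expansion_def
proof (intro conjI allI impI)
  show "psd_supported (\<lambda>n \<rho> m. A n \<rho> m - c * B n \<rho> m)"
    unfolding psd_supported_def
  proof (intro allI impI)
    fix n \<rho> m assume "A n \<rho> m - c * B n \<rho> m \<noteq> 0"
    hence "A n \<rho> m \<noteq> 0 \<or> B n \<rho> m \<noteq> 0" by auto
    thus "0 \<le> n \<and> 0 \<le> m \<and> \<rho>\<^sup>2 \<le> 4 * n * m"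
      using assms unfolding siegel_expansion_def psd_supported_def by blast
  qed
  fix \<tau> z \<sigma> assume "H2_point \<tau> z \<sigma>"
  hence "((\<lambda>p. siegel_term A \<tau> z \<sigma> p + (- c) * siegel_term B \<tau> z \<sigma> p) has_sum (G \<tau> z \<sigma> + (- c) * H \<tau> z \<sigma>)) UNIV"
    using assms unfolding siegel_expansion_def by (intro has_sum_add has_sum_cmult_right) blast+
  moreover have "(\<lambda>p. siegel_term A \<tau> z \<sigma> p + (- c) * siegel_term B \<tau> z \<sigma> p) = siegel_term (\<lambda>n \<rho> m. A n \<rho> m - c * B n \<rho> m) \<tau> z \<sigma>"
    by (auto simp: siegel_term_def fun_eq_iff algebra_simps)
  ultimately show "(siegel_term (\<lambda>n \<rho> m. A n \<rho> m - c * B n \<rho> m) \<tau> z \<sigma> has_sum (G \<tau> z \<sigma> - c * H \<tau> z \<sigma>)) UNIV"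
    by simp
qed

lemma jacobi_invariant_diff:
  assumes "jacobi_invariant k G" "jacobi_invariant k H"
  shows "jacobi_invariant k (\<lambda>\<tau> z \<sigma>. G \<tau> z \<sigma> - c * H \<tau> z \<sigma>)"
  using assms unfolding jacobi_invariant_def by (simp add: algebra_simps)

lemma siegel_expansion_zero:
  assumes "siegel_expansion A G" "\<And>n \<rho> m. A n \<rho> m = 0" "H2_point \<tau> z \<sigma>"
  shows "G \<tau> z \<sigma> = 0"
proof -
  have "(siegel_term A \<tau> z \<sigma> has_sum G \<tau> z \<sigma>) UNIV" using assms unfolding siegel_expansion_def by blast
  moreover have "(siegel_term A \<tau> z \<sigma> has_sum 0) UNIV"
    by (rule has_sum_0) (auto simp: siegel_term_def assms(2))
  ultimately show ?thesis by (rule has_sum_unique)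
qed

section \<open>Modular forms of degree two\<close>

definition hmat :: "int \<Rightarrow> int \<Rightarrow> int \<Rightarrow> real^2^2" where
  "hmat n \<rho> m = vector [vector [of_int n, of_int \<rho> / 2], vector [of_int \<rho> / 2, of_int m]]"

lemma hmat_nth [simp]:
  "hmat n \<rho> m $ 1 $ 1 = of_int n" "hmat n \<rho> m $ 1 $ 2 = of_int \<rho> / 2"
  "hmat n \<rho> m $ 2 $ 1 = of_int \<rho> / 2" "hmat n \<rho> m $ 2 $ 2 = of_int m"
  by (simp_all add: hmat_def)

definition psd_index :: "(int \<times> int \<times> int) set" where
  "psd_index = {(n, \<rho>, m). 0 \<le> n \<and> 0 \<le> m \<and> \<rho>\<^sup>2 \<le> 4 * n * m}"

lemma quadratic_form_hmat:
  "v \<bullet> (hmat n \<rho> m *v v) = of_int n * (v $ 1)\<^sup>2 + of_int \<rho> * (v $ 1) * (v $ 2) + of_int m * (v $ 2)\<^sup>2"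
  by (simp add: inner_vec_def matrix_vector_mult_def sum_2 power2_eq_square algebra_simps)

lemma integral_form_nonneg:
  fixes x y :: real and n \<rho> m :: int
  assumes "0 \<le> n" "0 \<le> m" "\<rho>\<^sup>2 \<le> 4 * n * m"
  shows "of_int n * x\<^sup>2 + of_int \<rho> * x * y + of_int m * y\<^sup>2 \<ge> 0"
proof (cases "n = 0")
  case True
  with assms show ?thesis by simp
next
  case False
  have eq: "4 * of_int n * (of_int n * x\<^sup>2 + of_int \<rho> * x * y + of_int m * y\<^sup>2) =
      (2 * of_int n * x + of_int \<rho> * y)\<^sup>2 + of_int (4 * n * m - \<rho>\<^sup>2) * y\<^sup>2"
    by (simp add: power2_eq_square algebra_simps)
  have "4 * n * m - \<rho>\<^sup>2 \<ge> 0" using assms(3) by simp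
  hence "real_of_int (4 * n * m - \<rho>\<^sup>2) \<ge> 0" by (simp only: of_int_0_le_iff)
  hence "4 * of_int n * (of_int n * x\<^sup>2 + of_int \<rho> * x * y + of_int m * y\<^sup>2) \<ge> 0"
    unfolding eq by (intro add_nonneg_nonneg mult_nonneg_nonneg) auto
  moreover have "0 < (4 * of_int n :: real)" using False assms(1) by simp
  ultimately show ?thesis by (simp add: zero_le_mult_iff)
qed

text \<open>The test vectors are the unit vectors and \<open>(- \<rho>, 2 * n)\<close>; if \<open>n = 0\<close>, the vector \<open>(- \<rho> * (m + 1), 1)\<close> forces \<open>\<rho> = 0\<close>.\<close>
lemma psd_indexI:
  assumes nonneg: "\<And>x y :: real. of_int n * x\<^sup>2 + of_int \<rho> * x * y + of_int m * y\<^sup>2 \<ge> 0"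
  shows "(n, \<rho>, m) \<in> psd_index"
proof -
  have n: "0 \<le> n" using nonneg[of 1 0] by simp
  have m: "0 \<le> m" using nonneg[of 0 1] by simp
  have "\<rho>\<^sup>2 \<le> 4 * n * m"
  proof (cases "n = 0")
    case True
    have "real_of_int (- (\<rho>\<^sup>2) * (m + 1) + m) \<ge> 0"
      using nonneg[of "- of_int \<rho> * (of_int m + 1)" 1] True by (simp add: power2_eq_square algebra_simps)
    hence le: "\<rho>\<^sup>2 * (m + 1) \<le> m" by (simp only: of_int_0_le_iff)
    have "\<rho>\<^sup>2 < 1"
    proof (rule ccontr)
      assume "\<not> \<rho>\<^sup>2 < 1"
      hence "1 * (m + 1) \<le> \<rho>\<^sup>2 * (m + 1)" using m by (intro mult_right_mono) auto
      with le show False by simp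
    qed
    moreover have "4 * n * m = 0" using True by simp
    ultimately show ?thesis by linarith
  next
    case False
    have "real_of_int (n * (4 * n * m - \<rho>\<^sup>2)) \<ge> 0"
      using nonneg[of "- of_int \<rho>" "2 * of_int n"] by (simp add: power2_eq_square algebra_simps)
    hence "n * (4 * n * m - \<rho>\<^sup>2) \<ge> 0" by (simp only: of_int_0_le_iff)
    thus ?thesis using False n by (simp add: zero_le_mult_iff)
  qed
  with n m show ?thesis by (simp add: psd_index_def)
qed

definition hmat_index :: "real^2^2 \<Rightarrow> int \<times> int \<times> int" where
  "hmat_index T = (\<lfloor>T $ 1 $ 1\<rfloor>, \<lfloor>2 * T $ 1 $ 2\<rfloor>, \<lfloor>T $ 2 $ 2\<rfloor>)"

text \<open>Half-integral positive semidefinite matrices correspond to integral binary forms with nonnegative diagonal and nonpositive discriminant.\<close>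
lemma bij_betw_hmat: "bij_betw (\<lambda>(n, \<rho>, m). hmat n \<rho> m) psd_index half_integral_psd"
proof (rule bij_betwI[of _ _ _ hmat_index])
  have recover: "hmat \<lfloor>T $ 1 $ 1\<rfloor> \<lfloor>2 * T $ 1 $ 2\<rfloor> \<lfloor>T $ 2 $ 2\<rfloor> = T" if T: "T \<in> half_integral_psd" for T
  proof -
    have "T $ 1 $ 1 \<in> \<int>" "2 * T $ 1 $ 2 \<in> \<int>" "T $ 2 $ 2 \<in> \<int>" "transpose T = T"
      using T by (auto simp: half_integral_psd_def)
    moreover have "transpose T $ 2 $ 1 = T $ 1 $ 2" by (simp add: transpose_def)
    ultimately show ?thesis by (auto simp: vec_eq_iff forall_2 elim!: Ints_cases)
  qed
  show "(\<lambda>(n, \<rho>, m). hmat n \<rho> m) \<in> psd_index \<rightarrow> half_integral_psd"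
  proof clarify
    fix n \<rho> m assume "(n, \<rho>, m) \<in> psd_index"
    hence "v \<bullet> (hmat n \<rho> m *v v) \<ge> 0" for v
      unfolding quadratic_form_hmat by (intro integral_form_nonneg) (auto simp: psd_index_def)
    thus "hmat n \<rho> m \<in> half_integral_psd"
      by (simp add: half_integral_psd_def transpose_def vec_eq_iff forall_2)
  qed
  show "hmat_index \<in> half_integral_psd \<rightarrow> psd_index"
  proof
    fix T :: "real^2^2" assume T: "T \<in> half_integral_psd"
    have "v \<bullet> (T *v v) \<ge> 0" for v using T by (auto simp: half_integral_psd_def)
    hence "v \<bullet> (hmat \<lfloor>T $ 1 $ 1\<rfloor> \<lfloor>2 * T $ 1 $ 2\<rfloor> \<lfloor>T $ 2 $ 2\<rfloor> *v v) \<ge> 0" for v unfolding recover[OF T] .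
    hence "of_int \<lfloor>T $ 1 $ 1\<rfloor> * x\<^sup>2 + of_int \<lfloor>2 * T $ 1 $ 2\<rfloor> * x * y + of_int \<lfloor>T $ 2 $ 2\<rfloor> * y\<^sup>2 \<ge> 0" for x y :: real
      using quadratic_form_hmat[of "vector [x, y]" "\<lfloor>T $ 1 $ 1\<rfloor>" "\<lfloor>2 * T $ 1 $ 2\<rfloor>" "\<lfloor>T $ 2 $ 2\<rfloor>"] by (metis vector_2)
    thus "hmat_index T \<in> psd_index"
      unfolding hmat_index_def by (rule psd_indexI)
  qed
  show "hmat_index ((\<lambda>(n, \<rho>, m). hmat n \<rho> m) p) = p" for p
    by (cases p) (simp add: hmat_index_def)
  show "(\<lambda>(n, \<rho>, m). hmat n \<rho> m) (hmat_index T) = T" if "T \<in> half_integral_psd" for T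
    using recover[OF that] by (simp add: hmat_index_def)
qed

definition index_coeff :: "(real^2^2 \<Rightarrow> complex) \<Rightarrow> int \<Rightarrow> int \<Rightarrow> int \<Rightarrow> complex" where
  "index_coeff a n \<rho> m = (if (n, \<rho>, m) \<in> psd_index then a (hmat n \<rho> m) else 0)"

lemma trace_hmat_zmat:
  "trace (map_matrix of_real (hmat n \<rho> m) ** zmat \<tau> z \<sigma>) = of_int n * \<tau> + of_int \<rho> * z + of_int m * \<sigma>"
  by (simp add: trace_def sum_2 matrix_matrix_mult_def map_matrix_def)

lemma fourier_expansion_index:
  assumes "fourier_expansion F a"
  shows "siegel_expansion (index_coeff a) (\<lambda>\<tau> z \<sigma>. F (zmat \<tau> z \<sigma>))"
  unfolding siegel_expansion_def
proof (intro conjI allI impI)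
  show "psd_supported (index_coeff a)"
    by (auto simp: psd_supported_def index_coeff_def psd_index_def)
  fix \<tau> z \<sigma> assume "H2_point \<tau> z \<sigma>"
  hence "zmat \<tau> z \<sigma> \<in> siegel_H2" unfolding siegel_H2_iff by blast
  hence "((\<lambda>T. a T * exp (2 * of_real pi * \<i> * trace (map_matrix of_real T ** zmat \<tau> z \<sigma>))) has_sum F (zmat \<tau> z \<sigma>)) half_integral_psd"
    using assms unfolding fourier_expansion_def by blast
  hence hs: "((\<lambda>p. a ((\<lambda>(n, \<rho>, m). hmat n \<rho> m) p) * exp (2 * of_real pi * \<i> * trace (map_matrix of_real ((\<lambda>(n, \<rho>, m). hmat n \<rho> m) p) ** zmat \<tau> z \<sigma>))) has_sum F (zmat \<tau> z \<sigma>)) psd_index"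
    by (subst has_sum_reindex_bij_betw[OF bij_betw_hmat])
  show "(siegel_term (index_coeff a) \<tau> z \<sigma> has_sum F (zmat \<tau> z \<sigma>)) UNIV"
    by (rule has_sum_cong_neutral[THEN iffD1, OF _ _ _ hs])
       (auto simp: siegel_term_def index_coeff_def trace_hmat_zmat e2_def)
qed

lemma matrix_inv_eqI:
  fixes A B :: "complex^2^2"
  assumes "A ** B = mat 1"
  shows "matrix_inv A = B"
proof -
  have BA: "B ** A = mat 1" using assms matrix_left_right_inverse by blast
  hence "A ** matrix_inv A = mat 1 \<and> matrix_inv A ** A = mat 1"
    unfolding matrix_inv_def using assms by (intro someI[of "\<lambda>A'. A ** A' = mat 1 \<and> A' ** A = mat 1" B]) blast
  hence "matrix_inv A ** (A ** B) = B" by (simp add: matrix_mul_assoc)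
  thus ?thesis by (simp add: assms)
qed

lemmas mat2_simps = vec_eq_iff forall_2 sum_2 matrix_matrix_mult_def mat_def transpose_def map_matrix_def

text \<open>The symplectic matrices are those of the exchange and the shear in \<open>GL\<^sub>2(\<int>)\<close>, embedded as block diagonal matrices, and the inversion in
\<open>SL\<^sub>2(\<int>)\<close> acting on \<open>\<tau>\<close>. The exchange has determinant \<open>- 1\<close>, whence the parity assumption on the weight.\<close>
lemma modular_form_jacobi_invariant:
  assumes F: "siegel_modular_form k F" and k: "even k"
  shows "jacobi_invariant k (\<lambda>\<tau> z \<sigma>. F (zmat \<tau> z \<sigma>))"
proof -
  have act: "F ((map_matrix of_int A ** zmat \<tau> z \<sigma> + map_matrix of_int B) ** W) =
      det (map_matrix of_int C ** zmat \<tau> z \<sigma> + map_matrix of_int D) ^ k * F (zmat \<tau> z \<sigma>)"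
    if "in_Sp4Z A B C D" "H2_point \<tau> z \<sigma>" "(map_matrix of_int C ** zmat \<tau> z \<sigma> + map_matrix of_int D) ** W = mat 1" for A B C D \<tau> z \<sigma> W
  proof -
    have "zmat \<tau> z \<sigma> \<in> siegel_H2" using that(2) unfolding siegel_H2_iff by blast
    hence "F ((map_matrix of_int A ** zmat \<tau> z \<sigma> + map_matrix of_int B) **
        matrix_inv (map_matrix of_int C ** zmat \<tau> z \<sigma> + map_matrix of_int D)) =
      det (map_matrix of_int C ** zmat \<tau> z \<sigma> + map_matrix of_int D) ^ k * F (zmat \<tau> z \<sigma>)"
      using F that(1) unfolding siegel_modular_form_def by blast
    thus ?thesis unfolding matrix_inv_eqI[OF that(3)] .
  qed
  show ?thesis
    unfolding jacobi_invariant_def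
  proof (intro conjI allI impI)
    fix \<tau> z \<sigma> assume h: "H2_point \<tau> z \<sigma>"
    define P :: "int^2^2" where "P = vector [vector [0, 1], vector [1, 0]]"
    define Q :: "complex^2^2" where "Q = vector [vector [0, 1], vector [1, 0]]"
    have sp: "in_Sp4Z P 0 0 P" by (simp add: in_Sp4Z_def P_def mat2_simps)
    have inv: "(map_matrix of_int 0 ** zmat \<tau> z \<sigma> + map_matrix of_int P) ** Q = mat 1"
      by (simp add: P_def Q_def mat2_simps)
    have "(map_matrix of_int P ** zmat \<tau> z \<sigma> + map_matrix of_int 0) ** Q = zmat \<sigma> z \<tau>"
      by (simp add: P_def Q_def mat2_simps)
    moreover have "det (map_matrix of_int 0 ** zmat \<tau> z \<sigma> + map_matrix of_int P) = (- 1 :: complex)"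
      by (simp add: det_2 P_def mat2_simps)
    ultimately show "F (zmat \<sigma> z \<tau>) = F (zmat \<tau> z \<sigma>)"
      using act[OF sp h inv] k by simp
  next
    fix \<tau> z \<sigma> assume h: "H2_point \<tau> z \<sigma>"
    define U :: "int^2^2" where "U = vector [vector [1, 0], vector [1, 1]]"
    define V :: "int^2^2" where "V = vector [vector [1, - 1], vector [0, 1]]"
    define W :: "complex^2^2" where "W = vector [vector [1, 1], vector [0, 1]]"
    have sp: "in_Sp4Z U 0 0 V" by (simp add: in_Sp4Z_def U_def V_def mat2_simps)
    have inv: "(map_matrix of_int 0 ** zmat \<tau> z \<sigma> + map_matrix of_int V) ** W = mat 1"
      by (simp add: V_def W_def mat2_simps)
    have "(map_matrix of_int U ** zmat \<tau> z \<sigma> + map_matrix of_int 0) ** W = zmat \<tau> (z + \<tau>) (\<sigma> + 2 * z + \<tau>)"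
      by (simp add: U_def W_def mat2_simps)
    moreover have "det (map_matrix of_int 0 ** zmat \<tau> z \<sigma> + map_matrix of_int V) = (1 :: complex)"
      by (simp add: det_2 V_def mat2_simps)
    ultimately show "F (zmat \<tau> (z + \<tau>) (\<sigma> + 2 * z + \<tau>)) = F (zmat \<tau> z \<sigma>)"
      using act[OF sp h inv] by simp
  next
    fix \<tau> :: complex and r :: real and \<sigma> :: complex assume t: "Im \<tau> > 0" and sg: "Im \<sigma> > 0"
    have h: "H2_point \<tau> (of_real r) \<sigma>" using t sg by (simp add: H2_point_def)
    have t0: "\<tau> \<noteq> 0" using t by auto
    define A :: "int^2^2" where "A = vector [vector [0, 0], vector [0, 1]]"
    define B :: "int^2^2" where "B = vector [vector [- 1, 0], vector [0, 0]]"
    define C :: "int^2^2" where "C = vector [vector [1, 0], vector [0, 0]]"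
    define W :: "complex^2^2" where "W = vector [vector [1 / \<tau>, - of_real r / \<tau>], vector [0, 1]]"
    have sp: "in_Sp4Z A B C A" by (simp add: in_Sp4Z_def A_def B_def C_def mat2_simps)
    have inv: "(map_matrix of_int C ** zmat \<tau> (of_real r) \<sigma> + map_matrix of_int A) ** W = mat 1"
      using t0 by (simp add: A_def C_def W_def mat2_simps)
    have "(map_matrix of_int A ** zmat \<tau> (of_real r) \<sigma> + map_matrix of_int B) ** W = zmat (- 1 / \<tau>) (of_real r / \<tau>) (\<sigma> - (of_real r)\<^sup>2 / \<tau>)"
      by (simp add: A_def B_def W_def mat2_simps power2_eq_square)
    moreover have "det (map_matrix of_int C ** zmat \<tau> (of_real r) \<sigma> + map_matrix of_int A) = \<tau>"
      by (simp add: det_2 A_def C_def mat2_simps)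
    ultimately show "F (zmat (- 1 / \<tau>) (of_real r / \<tau>) (\<sigma> - (of_real r)\<^sup>2 / \<tau>)) = \<tau> ^ k * F (zmat \<tau> (of_real r) \<sigma>)"
      using act[OF sp h inv] by simp
  qed
qed

lemma jacobi_invariant_power:
  "jacobi_invariant k G \<Longrightarrow> jacobi_invariant (k * j) (\<lambda>\<tau> z \<sigma>. G \<tau> z \<sigma> ^ j)"
  unfolding jacobi_invariant_def by (simp add: power_mult power_mult_distrib)

section \<open>Products of expansions and their leading coefficient\<close>

definition product_coeff :: "(int \<Rightarrow> int \<Rightarrow> int \<Rightarrow> complex) \<Rightarrow> (int \<Rightarrow> int \<Rightarrow> int \<Rightarrow> complex) \<Rightarrow> (int \<times> int \<times> int) \<times> (int \<times> int \<times> int) \<Rightarrow> complex" where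
  "product_coeff A B = (\<lambda>((n1, \<rho>1, m1), (n2, \<rho>2, m2)). A n1 \<rho>1 m1 * B n2 \<rho>2 m2)"

definition sum_fiber :: "int \<Rightarrow> int \<Rightarrow> int \<Rightarrow> ((int \<times> int \<times> int) \<times> (int \<times> int \<times> int)) set" where
  "sum_fiber n \<rho> m = {((n1, \<rho>1, m1), (n2, \<rho>2, m2)). n1 + n2 = n \<and> \<rho>1 + \<rho>2 = \<rho> \<and> m1 + m2 = m}"

text \<open>The coefficients of a product. The sum runs over all pairs of indices with the given sum; written as an unordered sum, it is literally what
grouping the terms of the product produces.\<close>
definition convolve :: "(int \<Rightarrow> int \<Rightarrow> int \<Rightarrow> complex) \<Rightarrow> (int \<Rightarrow> int \<Rightarrow> int \<Rightarrow> complex) \<Rightarrow> int \<Rightarrow> int \<Rightarrow> int \<Rightarrow> complex" where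
  "convolve A B n \<rho> m = infsum (product_coeff A B) (sum_fiber n \<rho> m)"

lemma product_coeff_apply: "product_coeff A B ((n1, \<rho>1, m1), (n2, \<rho>2, m2)) = A n1 \<rho>1 m1 * B n2 \<rho>2 m2"
  by (simp add: product_coeff_def)

lemma convolve_nonzero:
  assumes "convolve A B n \<rho> m \<noteq> 0"
  obtains n1 \<rho>1 m1 n2 \<rho>2 m2 where "n1 + n2 = n" "\<rho>1 + \<rho>2 = \<rho>" "m1 + m2 = m" "A n1 \<rho>1 m1 \<noteq> 0" "B n2 \<rho>2 m2 \<noteq> 0"
proof -
  have "\<exists>n1 \<rho>1 m1 n2 \<rho>2 m2. n1 + n2 = n \<and> \<rho>1 + \<rho>2 = \<rho> \<and> m1 + m2 = m \<and> A n1 \<rho>1 m1 \<noteq> 0 \<and> B n2 \<rho>2 m2 \<noteq> 0"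
  proof (rule ccontr)
    assume none: "\<not> ?thesis"
    have "convolve A B n \<rho> m = 0" unfolding convolve_def
    proof (rule infsum_0)
      fix p assume pin: "p \<in> sum_fiber n \<rho> m"
      obtain n1 \<rho>1 m1 n2 \<rho>2 m2 where p: "p = ((n1, \<rho>1, m1), (n2, \<rho>2, m2))"
        by (metis surj_pair)
      have "n1 + n2 = n" "\<rho>1 + \<rho>2 = \<rho>" "m1 + m2 = m" using pin unfolding p sum_fiber_def by simp_all
      hence "A n1 \<rho>1 m1 = 0 \<or> B n2 \<rho>2 m2 = 0" using none by blast
      thus "product_coeff A B p = 0" by (auto simp: p product_coeff_apply)
    qed
    with assms show False by simp
  qed
  thus ?thesis using that by blast
qed

text \<open>The sum of two positive semidefinite forms is positive semidefinite; the mixed term is estimated by the inequality of the arithmetic and the geometric mean.\<close>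
lemma psd_add:
  fixes n1 n2 m1 m2 \<rho>1 \<rho>2 :: int
  assumes "0 \<le> n1" "0 \<le> m1" "\<rho>1\<^sup>2 \<le> 4 * n1 * m1" "0 \<le> n2" "0 \<le> m2" "\<rho>2\<^sup>2 \<le> 4 * n2 * m2"
  shows "(\<rho>1 + \<rho>2)\<^sup>2 \<le> 4 * (n1 + n2) * (m1 + m2)"
proof -
  have "(\<rho>1 * \<rho>2)\<^sup>2 \<le> (4 * n1 * m1) * (4 * n2 * m2)"
    unfolding power_mult_distrib using assms by (intro mult_mono) auto
  also have "\<dots> \<le> (2 * (n1 * m2 + n2 * m1))\<^sup>2"
  proof -
    have "(2 * (n1 * m2 + n2 * m1))\<^sup>2 - (4 * n1 * m1) * (4 * n2 * m2) = 4 * (n1 * m2 - n2 * m1)\<^sup>2"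
      by (simp add: power2_eq_square algebra_simps)
    moreover have "0 \<le> 4 * (n1 * m2 - n2 * m1)\<^sup>2" by simp
    ultimately show ?thesis by linarith
  qed
  finally have "\<rho>1 * \<rho>2 \<le> 2 * (n1 * m2 + n2 * m1)"
    by (rule power2_le_imp_le) (use assms in auto)
  hence "\<rho>1\<^sup>2 + \<rho>2\<^sup>2 + 2 * (\<rho>1 * \<rho>2) \<le> 4 * n1 * m1 + 4 * n2 * m2 + 2 * (2 * (n1 * m2 + n2 * m1))"
    using assms by linarith
  thus ?thesis by (simp add: power2_eq_square algebra_simps)
qed

lemma siegel_expansion_mult:
  assumes A: "siegel_expansion A G" and B: "siegel_expansion B H"
  shows "siegel_expansion (convolve A B) (\<lambda>\<tau> z \<sigma>. G \<tau> z \<sigma> * H \<tau> z \<sigma>)"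
  unfolding siegel_expansion_def
proof (intro conjI allI impI)
  have pA: "psd_supported A" and pB: "psd_supported B" using A B by (auto simp: siegel_expansion_def)
  show "psd_supported (convolve A B)"
    unfolding psd_supported_def
  proof (intro allI impI)
    fix n \<rho> m assume "convolve A B n \<rho> m \<noteq> 0"
    then obtain n1 \<rho>1 m1 n2 \<rho>2 m2 where s: "n1 + n2 = n" "\<rho>1 + \<rho>2 = \<rho>" "m1 + m2 = m"
      and nz: "A n1 \<rho>1 m1 \<noteq> 0" "B n2 \<rho>2 m2 \<noteq> 0" by (rule convolve_nonzero)
    show "0 \<le> n \<and> 0 \<le> m \<and> \<rho>\<^sup>2 \<le> 4 * n * m"
      using psd_supportedD[OF pA nz(1)] psd_supportedD[OF pB nz(2)] psd_add[of n1 m1 \<rho>1 n2 m2 \<rho>2] s by auto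
  qed
  fix \<tau> z \<sigma> assume h: "H2_point \<tau> z \<sigma>"
  have sA: "(siegel_term A \<tau> z \<sigma> has_sum G \<tau> z \<sigma>) UNIV" and sB: "(siegel_term B \<tau> z \<sigma> has_sum H \<tau> z \<sigma>) UNIV"
    using A B h unfolding siegel_expansion_def by blast+
  have nA: "(\<lambda>p. norm (siegel_term A \<tau> z \<sigma> p)) summable_on UNIV" and nB: "(\<lambda>p. norm (siegel_term B \<tau> z \<sigma> p)) summable_on UNIV"
    using has_sum_imp_summable[OF sA] has_sum_imp_summable[OF sB] by (simp_all only: summable_on_iff_abs_summable_on_complex)
  define f where "f = (\<lambda>(p, q). siegel_term A \<tau> z \<sigma> p * siegel_term B \<tau> z \<sigma> q)"
  have fs: "f summable_on UNIV \<times> UNIV"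
  proof (rule summable_on_times_bound)
    show "(\<lambda>p. norm (siegel_term A \<tau> z \<sigma> p) * infsum (\<lambda>q. norm (siegel_term B \<tau> z \<sigma> q)) UNIV) summable_on UNIV"
      by (intro summable_on_cmult_left nA)
    fix p
    show "(\<lambda>q. norm (f (p, q))) summable_on UNIV"
      unfolding f_def prod.case norm_mult by (intro summable_on_cmult_right nB)
    show "infsum (\<lambda>q. norm (f (p, q))) UNIV \<le> norm (siegel_term A \<tau> z \<sigma> p) * infsum (\<lambda>q. norm (siegel_term B \<tau> z \<sigma> q)) UNIV"
      unfolding f_def prod.case norm_mult infsum_cmult_right' ..
  qed
  have total: "infsum f (UNIV \<times> UNIV) = G \<tau> z \<sigma> * H \<tau> z \<sigma>"
  proof -
    have "infsum f (UNIV \<times> UNIV) = infsum (\<lambda>p. infsum (\<lambda>q. f (p, q)) UNIV) UNIV"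
      by (rule infsum_Sigma_banach[OF fs, symmetric])
    also have "\<dots> = G \<tau> z \<sigma> * H \<tau> z \<sigma>"
      by (simp only: f_def prod.case infsum_cmult_right' infsum_cmult_left' infsumI[OF sA] infsumI[OF sB])
    finally show ?thesis .
  qed
  define \<phi> where "\<phi> = (\<lambda>((n1, \<rho>1, m1), (n2, \<rho>2, m2)). (n1 + n2, \<rho>1 + \<rho>2, m1 + m2 :: int) :: int \<times> int \<times> int)"
  have val: "infsum f {s \<in> UNIV \<times> UNIV. \<phi> s = k} = siegel_term (convolve A B) \<tau> z \<sigma> k" for k
  proof -
    obtain n \<rho> m where k: "k = (n, \<rho>, m)" by (cases k)
    have set: "{s \<in> UNIV \<times> UNIV. \<phi> s = k} = sum_fiber n \<rho> m"
      by (auto simp: \<phi>_def k sum_fiber_def)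
    have "infsum f (sum_fiber n \<rho> m) =
        infsum (\<lambda>s. product_coeff A B s * e2 (of_int n * \<tau> + of_int \<rho> * z + of_int m * \<sigma>)) (sum_fiber n \<rho> m)"
    proof (rule infsum_cong)
      fix p assume pin: "p \<in> sum_fiber n \<rho> m"
      obtain n1 \<rho>1 m1 n2 \<rho>2 m2 where p: "p = ((n1, \<rho>1, m1), (n2, \<rho>2, m2))"
        by (metis surj_pair)
      have s: "n1 + n2 = n" "\<rho>1 + \<rho>2 = \<rho>" "m1 + m2 = m" using pin unfolding p sum_fiber_def by simp_all
      have "e2 (of_int n * \<tau> + of_int \<rho> * z + of_int m * \<sigma>) =
         e2 (of_int n1 * \<tau> + of_int \<rho>1 * z + of_int m1 * \<sigma>) * e2 (of_int n2 * \<tau> + of_int \<rho>2 * z + of_int m2 * \<sigma>)"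
        unfolding e2_add[symmetric] s[symmetric] by (simp add: algebra_simps)
      thus "f p = product_coeff A B p * e2 (of_int n * \<tau> + of_int \<rho> * z + of_int m * \<sigma>)"
        by (simp only: p f_def siegel_term_def prod.case product_coeff_apply mult_ac)
    qed
    also have "\<dots> = siegel_term (convolve A B) \<tau> z \<sigma> k"
      unfolding infsum_cmult_left' by (simp add: k siegel_term_def convolve_def)
    finally show ?thesis unfolding set .
  qed
  show "(siegel_term (convolve A B) \<tau> z \<sigma> has_sum G \<tau> z \<sigma> * H \<tau> z \<sigma>) UNIV"
    using has_sum_group[OF fs, of \<phi>] unfolding val total .
qed

text \<open>The support lies in \<open>n, m \<ge> j\<close>, and among the forms \<open>[j, \<rho>, j]\<close> the extreme one \<open>[j, j, j]\<close> has coefficient 1. This shape is stable under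
products, where \<open>j\<close> adds up.\<close>
definition leading_at :: "int \<Rightarrow> (int \<Rightarrow> int \<Rightarrow> int \<Rightarrow> complex) \<Rightarrow> bool" where
  "leading_at j A \<longleftrightarrow> (\<forall>n \<rho> m. A n \<rho> m \<noteq> 0 \<longrightarrow> n \<ge> j \<and> m \<ge> j) \<and> (\<forall>\<rho>. A j \<rho> j \<noteq> 0 \<longrightarrow> \<rho> \<le> j) \<and> A j j j = 1"

text \<open>All inequalities must be equalities for an index to contribute to the extreme coefficient, so that only one pair of indices does.\<close>
lemma leading_at_convolve:
  assumes A: "leading_at i A" and B: "leading_at j B"
  shows "leading_at (i + j) (convolve A B)"
  unfolding leading_at_def
proof (intro conjI allI impI)
  fix n \<rho> m assume "convolve A B n \<rho> m \<noteq> 0"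
  then obtain n1 \<rho>1 m1 n2 \<rho>2 m2 where s: "n1 + n2 = n" "\<rho>1 + \<rho>2 = \<rho>" "m1 + m2 = m"
    and nz: "A n1 \<rho>1 m1 \<noteq> 0" "B n2 \<rho>2 m2 \<noteq> 0" by (rule convolve_nonzero)
  have "n1 \<ge> i" "m1 \<ge> i" "n2 \<ge> j" "m2 \<ge> j" using A B nz unfolding leading_at_def by blast+
  thus "n \<ge> i + j" "m \<ge> i + j" using s by auto
next
  fix \<rho> assume "convolve A B (i + j) \<rho> (i + j) \<noteq> 0"
  then obtain n1 \<rho>1 m1 n2 \<rho>2 m2 where s: "n1 + n2 = i + j" "\<rho>1 + \<rho>2 = \<rho>" "m1 + m2 = i + j"
    and nz: "A n1 \<rho>1 m1 \<noteq> 0" "B n2 \<rho>2 m2 \<noteq> 0" by (rule convolve_nonzero)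
  have "n1 \<ge> i" "m1 \<ge> i" "n2 \<ge> j" "m2 \<ge> j" using A B nz unfolding leading_at_def by blast+
  hence "n1 = i" "m1 = i" "n2 = j" "m2 = j" using s by auto
  hence "\<rho>1 \<le> i" "\<rho>2 \<le> j" using A B nz unfolding leading_at_def by blast+
  thus "\<rho> \<le> i + j" using s by simp
next
  have zero: "A n1 \<rho>1 m1 * B n2 \<rho>2 m2 = 0"
    if s: "n1 + n2 = i + j" "\<rho>1 + \<rho>2 = i + j" "m1 + m2 = i + j" and ne: "((n1, \<rho>1, m1), (n2, \<rho>2, m2)) \<noteq> ((i, i, i), (j, j, j))" for n1 \<rho>1 m1 n2 \<rho>2 m2
  proof (rule ccontr)
    assume "A n1 \<rho>1 m1 * B n2 \<rho>2 m2 \<noteq> 0"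
    hence nz: "A n1 \<rho>1 m1 \<noteq> 0" "B n2 \<rho>2 m2 \<noteq> 0" by auto
    have "n1 \<ge> i" "m1 \<ge> i" "n2 \<ge> j" "m2 \<ge> j" using A B nz unfolding leading_at_def by blast+
    hence e: "n1 = i" "m1 = i" "n2 = j" "m2 = j" using s by auto
    hence "\<rho>1 \<le> i" "\<rho>2 \<le> j" using A B nz unfolding leading_at_def by blast+
    with s e ne show False by auto
  qed
  have "convolve A B (i + j) (i + j) (i + j) = infsum (product_coeff A B) {((i, i, i), (j, j, j))}"
    unfolding convolve_def
  proof (rule infsum_cong_neutral)
    fix p assume pin: "p \<in> sum_fiber (i + j) (i + j) (i + j) - {((i, i, i), (j, j, j))}"
    obtain n1 \<rho>1 m1 n2 \<rho>2 m2 where p: "p = ((n1, \<rho>1, m1), (n2, \<rho>2, m2))"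
      by (metis surj_pair)
    have s: "n1 + n2 = i + j" "\<rho>1 + \<rho>2 = i + j" "m1 + m2 = i + j" "((n1, \<rho>1, m1), (n2, \<rho>2, m2)) \<noteq> ((i, i, i), (j, j, j))"
      using pin unfolding p sum_fiber_def by simp_all
    show "product_coeff A B p = 0"
      using zero[OF s] by (simp add: p product_coeff_apply)
  qed (auto simp: sum_fiber_def)
  also have "\<dots> = 1" using A B by (simp add: leading_at_def product_coeff_apply)
  finally show "convolve A B (i + j) (i + j) (i + j) = 1" .
qed

lemma siegel_expansion_power:
  assumes A: "siegel_expansion A G" and l: "leading_at 1 A"
  shows "\<exists>B. siegel_expansion B (\<lambda>\<tau> z \<sigma>. G \<tau> z \<sigma> ^ Suc j) \<and> leading_at (int (Suc j)) B"
proof (induction j)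
  case 0
  show ?case using A l by (intro exI[of _ A]) simp
next
  case (Suc j)
  then obtain B where B: "siegel_expansion B (\<lambda>\<tau> z \<sigma>. G \<tau> z \<sigma> ^ Suc j)" "leading_at (int (Suc j)) B" by blast
  have "siegel_expansion (convolve A B) (\<lambda>\<tau> z \<sigma>. G \<tau> z \<sigma> ^ Suc (Suc j))"
    using siegel_expansion_mult[OF A B(1)] by simp
  moreover have "leading_at (int (Suc (Suc j))) (convolve A B)"
    using leading_at_convolve[OF l B(2)] by (simp add: add_ac)
  ultimately show ?case by blast
qed

text \<open>The normalized expansion and the one with positive definite support agree, by uniqueness. Positive definite integral forms have positive diagonal
entries, and \<open>\<rho>\<^sup>2 < 4\<close> if both are 1.\<close>
lemma chi10_expansion:
  assumes "is_igusa_chi10 F"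
  shows "\<exists>A. siegel_expansion A (\<lambda>\<tau> z \<sigma>. F (zmat \<tau> z \<sigma>)) \<and> leading_at 1 A"
proof -
  obtain a where a: "fourier_expansion F a" "a (vector [vector [1, 1/2], vector [1/2, 1]]) = 1"
    using assms unfolding is_igusa_chi10_def by blast
  obtain b where b: "fourier_expansion F b" "\<And>T v. T \<in> half_integral_psd \<Longrightarrow> b T \<noteq> 0 \<Longrightarrow> v \<noteq> 0 \<Longrightarrow> v \<bullet> (T *v v) > 0"
    using assms unfolding is_igusa_chi10_def siegel_cusp_form_def by blast
  note Ea = fourier_expansion_index[OF a(1)] and Eb = fourier_expansion_index[OF b(1)]
  have eq: "index_coeff a n \<rho> m = index_coeff b n \<rho> m" for n \<rho> m
    by (rule siegel_fourier_unique[where g = "\<lambda>\<tau> z \<sigma>. F (zmat \<tau> z \<sigma>)"])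
       (use Ea Eb in \<open>auto simp: siegel_expansion_def\<close>)
  have pd: "n \<ge> 1 \<and> m \<ge> 1 \<and> \<rho>\<^sup>2 < 4 * n * m" if "index_coeff a n \<rho> m \<noteq> 0" for n \<rho> m
  proof -
    have p: "(n, \<rho>, m) \<in> psd_index" and nz: "b (hmat n \<rho> m) \<noteq> 0"
      using that unfolding eq by (auto simp: index_coeff_def split: if_splits)
    have T: "hmat n \<rho> m \<in> half_integral_psd" using bij_betwE[OF bij_betw_hmat] p by fastforce
    have pos: "of_int n * x\<^sup>2 + of_int \<rho> * x * y + of_int m * y\<^sup>2 > 0" if "x \<noteq> 0 \<or> y \<noteq> 0" for x y :: real
    proof -
      have "vector [x, y] \<noteq> (0 :: real^2)" using that by (auto simp: vec_eq_iff forall_2)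
      from b(2)[OF T nz this] show ?thesis unfolding quadratic_form_hmat by simp
    qed
    have n: "n \<ge> 1" using pos[of 1 0] by simp
    have m: "m \<ge> 1" using pos[of 0 1] by simp
    have "real_of_int (n * (4 * n * m - \<rho>\<^sup>2)) > 0"
      using pos[of "- of_int \<rho>" "2 * of_int n"] n by (simp add: power2_eq_square algebra_simps)
    hence "n * (4 * n * m - \<rho>\<^sup>2) > 0" by (simp only: of_int_0_less_iff)
    hence "\<rho>\<^sup>2 < 4 * n * m" using n by (simp add: zero_less_mult_iff)
    with n m show ?thesis by blast
  qed
  have "leading_at 1 (index_coeff a)"
    unfolding leading_at_def
  proof (intro conjI allI impI)
    fix \<rho> :: int assume "index_coeff a 1 \<rho> 1 \<noteq> 0"
    hence "\<rho>\<^sup>2 < 2\<^sup>2" using pd[of 1 \<rho> 1] by simp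
    hence "\<rho> < 2" by (rule power2_less_imp_less) simp
    thus "\<rho> \<le> 1" by simp
  next
    have "hmat 1 1 1 = vector [vector [1, 1/2], vector [1/2, 1]]" by (simp add: hmat_def)
    thus "index_coeff a 1 1 1 = 1" using a(2) by (simp add: index_coeff_def psd_index_def)
  qed (use pd in blast)+
  with Ea show ?thesis by blast
qed

section \<open>Theta series of extremal lattices\<close>

theorem theorem1:
  fixes t :: nat
    and L :: "'a::real_inner set"
    and L' :: "'b::real_inner set"
  assumes "t \<in> {2, 3, 4, 5}"
    and "extremal (24 * t) L"
    and "extremal (24 * t) L'"
  shows "(t \<in> {2, 3, 4} \<longrightarrow>
            (\<forall>Z\<in>siegel_H2. siegel_theta L Z = siegel_theta L' Z)) \<and>
         (t = 5 \<longrightarrow>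
            (\<exists>c::int. \<forall>chi10. is_igusa_chi10 chi10 \<longrightarrow>
               (\<forall>Z\<in>siegel_H2. siegel_theta L Z - siegel_theta L' Z = of_int c * chi10 Z ^ 6)))"
proof -
  define A where "A = (\<lambda>n \<rho> m. rep_number L n \<rho> m - 1 * rep_number L' n \<rho> m)"
  define G where "G = (\<lambda>\<tau> z \<sigma>. siegel_theta L (zmat \<tau> z \<sigma>) - 1 * siegel_theta L' (zmat \<tau> z \<sigma>))"
  have uni: "even_unimodular (24 * t) L" "even_unimodular (24 * t) L'"
    using assms(2,3) by (auto simp: extremal_def)
  have E: "siegel_expansion A G"
    unfolding A_def G_def by (rule siegel_expansion_diff[OF theta_expansion[OF uni(1)] theta_expansion[OF uni(2)]])
  have J: "jacobi_invariant (12 * t) G"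
    unfolding G_def by (rule jacobi_invariant_diff[OF theta_jacobi_invariant[OF uni(1)] theta_jacobi_invariant[OF uni(2)]])
  have A0: "A 0 0 0 = 0" using extremal_rep_number(1)[OF assms(2)] extremal_rep_number(1)[OF assms(3)] by (simp add: A_def)
  have low: "A n \<rho> m = 0" if "1 \<le> m" "m \<le> int t" for n \<rho> m
    using extremal_rep_number(2)[OF assms(2) that] extremal_rep_number(2)[OF assms(3) that] by (simp add: A_def)
  show ?thesis
  proof (intro conjI impI ballI)
    fix Z assume t: "t \<in> {2, 3, 4}" and "Z \<in> siegel_H2"
    then obtain \<tau> z \<sigma> where Z: "Z = zmat \<tau> z \<sigma>" "H2_point \<tau> z \<sigma>" unfolding siegel_H2_iff by blast
    have "A n \<rho> m = 0" for n \<rho> m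
      by (rule siegel_coeffs_vanish[OF E J A0 low]) (use t in auto)
    from siegel_expansion_zero[OF E this Z(2)] show "siegel_theta L Z = siegel_theta L' Z"
      by (simp add: G_def Z(1))
  next
    assume t: "t = 5"
    \<comment> \<open>The coefficient of the difference at \<open>[6, 6, 6]\<close>; it does not depend on the form \<open>chi10\<close>.\<close>
    define c where "c = int (card (gram_fiber L 6 6 6)) - int (card (gram_fiber L' 6 6 6))"
    have A6: "A 6 6 6 = of_int c" by (simp add: A_def rep_number_def c_def)
    show "\<exists>c::int. \<forall>chi10. is_igusa_chi10 chi10 \<longrightarrow>
               (\<forall>Z\<in>siegel_H2. siegel_theta L Z - siegel_theta L' Z = of_int c * chi10 Z ^ 6)"
    proof (intro exI[of _ c] allI impI ballI)
      fix chi10 Z assume chi: "is_igusa_chi10 chi10" and "Z \<in> siegel_H2"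
      then obtain \<tau> z \<sigma> where Z: "Z = zmat \<tau> z \<sigma>" "H2_point \<tau> z \<sigma>" unfolding siegel_H2_iff by blast
      define X where "X = (\<lambda>\<tau> z \<sigma>. chi10 (zmat \<tau> z \<sigma>))"
      obtain X1 where X1: "siegel_expansion X1 X" "leading_at 1 X1"
        using chi10_expansion[OF chi] unfolding X_def by blast
      obtain B where B: "siegel_expansion B (\<lambda>\<tau> z \<sigma>. X \<tau> z \<sigma> ^ Suc 5)" "leading_at (int (Suc 5)) B"
        using siegel_expansion_power[OF X1, of 5] by blast
      have "siegel_modular_form 10 chi10" using chi by (simp add: is_igusa_chi10_def siegel_cusp_form_def)
      hence JX: "jacobi_invariant 10 X" unfolding X_def by (rule modular_form_jacobi_invariant) simp
      have JB: "jacobi_invariant (12 * t) (\<lambda>\<tau> z \<sigma>. X \<tau> z \<sigma> ^ Suc 5)"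
        using jacobi_invariant_power[OF JX, of "Suc 5"] t by simp
      have B0: "B n \<rho> m = 0" if "m < 6" for n \<rho> m using B(2) that unfolding leading_at_def by force
      have B6: "B 6 6 6 = 1" using B(2) by (simp add: leading_at_def)
      have "A n \<rho> m - of_int c * B n \<rho> m = 0" for n \<rho> m
      proof (rule siegel_coeffs_vanish[OF siegel_expansion_diff[OF E B(1)] jacobi_invariant_diff[OF J JB]])
        show "A 0 0 0 - of_int c * B 0 0 0 = 0" using A0 B0 by simp
        show "A n \<rho> m - of_int c * B n \<rho> m = 0" if "1 \<le> m" "m \<le> int t" for n \<rho> m
          using low[OF that] B0[of m n \<rho>] that t by simp
        show "t \<le> 4 \<or> t = 5 \<and> A 6 6 6 - of_int c * B 6 6 6 = 0" using t A6 B6 by simp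
      qed
      from siegel_expansion_zero[OF siegel_expansion_diff[OF E B(1)] this Z(2)]
      show "siegel_theta L Z - siegel_theta L' Z = of_int c * chi10 Z ^ 6"
        by (simp add: G_def X_def Z(1))
    qed
  qed
qed

end
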